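(* Let $P$ and $Q$ be groups each of which has a finite index subgroup that embeds into a right angled Artin group or a right angled Coxeter group. Then the amalgamated free product of $P$ and $Q$ along a virtually cyclic subgroup (that is, $P*_{R=S}Q$, where $R\leqslant P$ and $S\leqslant Q$ are virtually cyclic subgroups identified via an isomorphism $R\to S$) is cyclic subgroup separable.
   Context: Given a simplicial graph $\Gamma$ with vertex set $V\Gamma$ and edge set $E\Gamma$ and a family of groups $\mathfrak{G}=\{G_v\}_{v\in V\Gamma}$, the graph product $\Gamma\mathfrak{G}$ is the quotient of the free product $\ast_{v\in V\Gamma}G_v$ by the relations $[g_u,g_v]=1$ for all $g_u\in G_u$, $g_v\in G_v$ whenever $(u,v)\in E\Gamma$. A right angled Artin group is a graph product with all $G_v\cong\mathbb{Z}$; a right angled Coxeter group is a graph product with all $G_v\cong\mathbb{Z}/2\mathbb{Z}$. A group is virtually cyclic if it has a cyclic subgroup of finite index. A group $G$ is cyclic subgroup separable if every cyclic subgroup of $G$ is closed in the profinite topology on $G$, equivalently, every cyclic subgroup is an intersection of finite index subgroups of $G$. *)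

theory Defs
  imports "HOL-Analysis.Abstract_Topology" "HOL-Algebra.Elementary_Groups"
begin

section \<open>Free products\<close>

text \<open>Free products are words in the elements of the factors, modulo the smallest congruence
  that multiplies neighbouring letters of the same factor and deletes the identities.\<close>

inductive word_cong :: "'x set \<Rightarrow> ('x list \<times> 'x list) set \<Rightarrow> 'x list \<Rightarrow> 'x list \<Rightarrow> bool"
  for L :: "'x set" and Rel :: "('x list \<times> 'x list) set"
  where
    refl: "w \<in> lists L \<Longrightarrow> word_cong L Rel w w"
  | rel: "\<lbrakk>(u, v) \<in> Rel; p \<in> lists L; s \<in> lists L\<rbrakk> \<Longrightarrow> word_cong L Rel (p @ u @ s) (p @ v @ s)"
  | sym: "word_cong L Rel u v \<Longrightarrow> word_cong L Rel v u"
  | trans: "\<lbrakk>word_cong L Rel u v; word_cong L Rel v w\<rbrakk> \<Longrightarrow> word_cong L Rel u w"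

definition word_class :: "'x set \<Rightarrow> ('x list \<times> 'x list) set \<Rightarrow> 'x list \<Rightarrow> 'x list set"
  where "word_class L Rel w = {v. word_cong L Rel w v}"

definition word_monoid :: "'x set \<Rightarrow> ('x list \<times> 'x list) set \<Rightarrow> 'x list set monoid"
  where "word_monoid L Rel =
    \<lparr>carrier = word_class L Rel ` lists L,
     mult = (\<lambda>A B. \<Union>a\<in>A. \<Union>b\<in>B. word_class L Rel (a @ b)),
     one = word_class L Rel []\<rparr>"

definition free_product_letters :: "'i set \<Rightarrow> ('i \<Rightarrow> ('a, 'm) monoid_scheme) \<Rightarrow> ('i \<times> 'a) set"
  where "free_product_letters I G = (SIGMA i:I. carrier (G i))"

definition free_product_rels ::
    "'i set \<Rightarrow> ('i \<Rightarrow> ('a, 'm) monoid_scheme) \<Rightarrow> (('i \<times> 'a) list \<times> ('i \<times> 'a) list) set"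
  where "free_product_rels I G =
    {([(i, x), (i, y)], [(i, x \<otimes>\<^bsub>G i\<^esub> y)]) | i x y. i \<in> I \<and> x \<in> carrier (G i) \<and> y \<in> carrier (G i)}
    \<union> {([(i, \<one>\<^bsub>G i\<^esub>)], []) | i. i \<in> I}"

definition free_product :: "'i set \<Rightarrow> ('i \<Rightarrow> ('a, 'm) monoid_scheme) \<Rightarrow> ('i \<times> 'a) list set monoid"
  where "free_product I G = word_monoid (free_product_letters I G) (free_product_rels I G)"

definition free_product_incl ::
    "'i set \<Rightarrow> ('i \<Rightarrow> ('a, 'm) monoid_scheme) \<Rightarrow> 'i \<Rightarrow> 'a \<Rightarrow> ('i \<times> 'a) list set"
  where "free_product_incl I G i x =
    word_class (free_product_letters I G) (free_product_rels I G) [(i, x)]"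

text \<open>The free product of two groups is set up separately, on words over the disjoint sum of the
  carriers, because the two factors may have different element types.\<close>

definition free_product2_rels ::
    "('a, 'm) monoid_scheme \<Rightarrow> ('b, 'n) monoid_scheme \<Rightarrow> (('a + 'b) list \<times> ('a + 'b) list) set"
  where "free_product2_rels P Q =
    {([Inl x, Inl y], [Inl (x \<otimes>\<^bsub>P\<^esub> y)]) | x y. x \<in> carrier P \<and> y \<in> carrier P}
    \<union> {([Inr x, Inr y], [Inr (x \<otimes>\<^bsub>Q\<^esub> y)]) | x y. x \<in> carrier Q \<and> y \<in> carrier Q}
    \<union> {([Inl \<one>\<^bsub>P\<^esub>], []), ([Inr \<one>\<^bsub>Q\<^esub>], [])}"

definition free_product2 ::
    "('a, 'm) monoid_scheme \<Rightarrow> ('b, 'n) monoid_scheme \<Rightarrow> ('a + 'b) list set monoid"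
  where "free_product2 P Q = word_monoid (carrier P <+> carrier Q) (free_product2_rels P Q)"

definition free_product2_inl ::
    "('a, 'm) monoid_scheme \<Rightarrow> ('b, 'n) monoid_scheme \<Rightarrow> 'a \<Rightarrow> ('a + 'b) list set"
  where "free_product2_inl P Q x =
    word_class (carrier P <+> carrier Q) (free_product2_rels P Q) [Inl x]"

definition free_product2_inr ::
    "('a, 'm) monoid_scheme \<Rightarrow> ('b, 'n) monoid_scheme \<Rightarrow> 'b \<Rightarrow> ('a + 'b) list set"
  where "free_product2_inr P Q y =
    word_class (carrier P <+> carrier Q) (free_product2_rels P Q) [Inr y]"


section \<open>Graph products and amalgamated free products\<close>

definition normal_closure :: "('a, 'm) monoid_scheme \<Rightarrow> 'a set \<Rightarrow> 'a set"
  where "normal_closure G S = \<Inter>{N. N \<lhd> G \<and> S \<subseteq> N}"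

definition simplicial_graph :: "'v set \<Rightarrow> ('v \<times> 'v) set \<Rightarrow> bool"
  where "simplicial_graph V E \<longleftrightarrow> E \<subseteq> V \<times> V \<and> Relation.sym E \<and> irrefl E"

definition graph_product ::
    "'v set \<Rightarrow> ('v \<times> 'v) set \<Rightarrow> ('v \<Rightarrow> ('g, 'm) monoid_scheme) \<Rightarrow> ('v \<times> 'g) list set set monoid"
  where "graph_product V E G =
    (let F = free_product V G; \<iota> = free_product_incl V G
     in F Mod normal_closure F
          {\<iota> u g \<otimes>\<^bsub>F\<^esub> \<iota> v h \<otimes>\<^bsub>F\<^esub> inv\<^bsub>F\<^esub> (\<iota> u g) \<otimes>\<^bsub>F\<^esub> inv\<^bsub>F\<^esub> (\<iota> v h) | u v g h.
             (u, v) \<in> E \<and> g \<in> carrier (G u) \<and> h \<in> carrier (G v)})"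

text \<open>The explicit \<open>group\<close> assumption is needed because \<open>\<cong>\<close> alone does not force its left-hand
  side to be closed under multiplication.\<close>

definition right_angled_Artin :: "'v set \<Rightarrow> ('v \<times> 'v) set \<Rightarrow> ('v \<Rightarrow> ('g, 'm) monoid_scheme) \<Rightarrow> bool"
  where "right_angled_Artin V E G \<longleftrightarrow>
    simplicial_graph V E \<and> (\<forall>v\<in>V. group (G v) \<and> G v \<cong> integer_group)"

definition right_angled_Coxeter :: "'v set \<Rightarrow> ('v \<times> 'v) set \<Rightarrow> ('v \<Rightarrow> ('g, 'm) monoid_scheme) \<Rightarrow> bool"
  where "right_angled_Coxeter V E G \<longleftrightarrow>
    simplicial_graph V E \<and> (\<forall>v\<in>V. group (G v) \<and> G v \<cong> integer_mod_group 2)"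

text \<open>\<open>\<phi>\<close> is only used on the subgroup \<open>R\<close>, where it identifies \<open>r\<close> with \<open>\<phi> r\<close>; the other
  amalgamated subgroup is the image of \<open>R\<close>.\<close>

definition amalgamated_product ::
    "('a, 'm) monoid_scheme \<Rightarrow> ('b, 'n) monoid_scheme \<Rightarrow> 'a set \<Rightarrow> ('a \<Rightarrow> 'b) \<Rightarrow> ('a + 'b) list set set monoid"
  where "amalgamated_product P Q R \<phi> =
    (let F = free_product2 P Q
     in F Mod normal_closure F
          {free_product2_inl P Q r \<otimes>\<^bsub>F\<^esub> inv\<^bsub>F\<^esub> (free_product2_inr P Q (\<phi> r)) | r. r \<in> R})"


section \<open>Finite index and separability\<close>

definition finite_index_subgroup :: "'a set \<Rightarrow> ('a, 'm) monoid_scheme \<Rightarrow> bool"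
  where "finite_index_subgroup H G \<longleftrightarrow> subgroup H G \<and> finite (rcosets\<^bsub>G\<^esub> H)"

definition virtually_cyclic :: "('a, 'm) monoid_scheme \<Rightarrow> bool"
  where "virtually_cyclic G \<longleftrightarrow>
    (\<exists>C. finite_index_subgroup C G \<and> cyclic_group (G\<lparr>carrier := C\<rparr>))"

definition virtually_embeds :: "('a, 'm) monoid_scheme \<Rightarrow> ('b, 'n) monoid_scheme \<Rightarrow> bool"
  where "virtually_embeds G A \<longleftrightarrow>
    (\<exists>H f. finite_index_subgroup H G \<and> f \<in> mon (G\<lparr>carrier := H\<rparr>) A)"

definition profinite_topology :: "('a, 'm) monoid_scheme \<Rightarrow> 'a topology"
  where "profinite_topology G =
    topology_generated_by {H #>\<^bsub>G\<^esub> g | H g. finite_index_subgroup H G \<and> g \<in> carrier G}"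

definition cyclic_subgroup_separable :: "('a, 'm) monoid_scheme \<Rightarrow> bool"
  where "cyclic_subgroup_separable G \<longleftrightarrow>
    (\<forall>C. subgroup C G \<and> cyclic_group (G\<lparr>carrier := C\<rparr>) \<longrightarrow> closedin (profinite_topology G) C)"

end

theory Submission
  imports Defs "HOL-Combinatorics.Permutations"
begin

text \<open>For every non-trivial element of a right-angled Artin or Coxeter group, a reduced word \<open>w\<close> for it
  yields an action of the group on the integer functions on the sets of syllables of \<open>w\<close>, in which
  the vertex group of \<open>v\<close> acts through \<open>1 + n X\<close> or \<open>\<epsilon> + X\<close>, where \<open>X\<close> reads the next syllable at \<open>v\<close>
  and \<open>\<epsilon>\<close> is a sign. The coefficient of the full word in the action of \<open>w\<close> on the empty one is
  non-zero. The action is unipotent up to signs, so its congruence subgroups \<open>N m\<close> satisfy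
  \<open>g \<in> N m \<Longrightarrow> g [^] n \<in> N (n * m)\<close>, and the exponents of an infinite cyclic subgroup can be
  read off modulo \<open>m\<close> from a linear function. Both facts survive passage to finite index overgroups. They
  make cyclic subgroups closed, and they provide, for \<open>c\<close> of infinite order, some \<open>k\<close> such that \<open>c [^] k\<close>
  can be given every order in a suitable finite quotient.

  This makes it possible to choose arbitrarily small finite index normal subgroups of \<open>P\<close> and \<open>Q\<close> that
  match on the amalgamated virtually cyclic subgroup, hence quotients of the amalgam that are amalgams of
  finite groups. Reduced words stay reduced in small enough quotients, which preserves \<open>g \<notin> \<langle>c\<rangle>\<close>. For an
  amalgam of finite groups and a torsion-free cyclic subgroup \<open>D\<close>, the factors act freely on the cosets of
  \<open>D\<close>; a finite piece of this action that contains the paths of \<open>c\<close> and \<open>g\<close> extends to a finite set.\<close>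

section \<open>Finite index subgroups\<close>

text \<open>Residual finiteness of the factors is not enough: quotients of \<open>P\<close> and
  \<open>Q\<close> glue only if their kernels meet \<open>R\<close> and \<open>S\<close> in
  corresponding subgroups, whereas arbitrary kernels meet the infinite cyclic part in powers with
  unrelated exponents. What helps is that each side can realise every multiple of some fixed
  exponent, so that the product of the two exponents is available on both. Integral unipotent
  representations give this, since the order of an element modulo \<open>m\<close> grows essentially
  linearly in \<open>m\<close>. An element of finite order acts unipotently over the integers only
  as the identity, so Coxeter generators force the signs; they are harmless because 1 and -1 differ
  modulo any number above 2. Each non-trivial element gets its own representation, of a size given
  by its word length, so infinite graphs cause no trouble.

  For the finite amalgams the point is that elements of the factors have finite order, so no
  non-trivial one is conjugate into a torsion-free \<open>D\<close>. An element \<open>c\<close> of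
  finite order is left to residual finiteness, which is itself the case of trivial
  \<open>D\<close>.\<close>

definition finite_index_normal :: "'a set \<Rightarrow> ('a, 'm) monoid_scheme \<Rightarrow> bool"
  where "finite_index_normal N G \<longleftrightarrow> N \<lhd> G \<and> finite (rcosets\<^bsub>G\<^esub> N)"

text \<open>The condition on \<open>N\<close> says that the image of \<open>g\<close> in the finite
  quotient misses the image of the cyclic group of \<open>c\<close>. This elementwise form pulls
  back along homomorphisms; the topology enters only at the very end.\<close>

definition cyclically_separable :: "('a, 'm) monoid_scheme \<Rightarrow> bool"
  where "cyclically_separable G \<longleftrightarrow>
    (\<forall>c\<in>carrier G. \<forall>g\<in>carrier G. (\<forall>j::int. g \<noteq> c [^]\<^bsub>G\<^esub> j) \<longrightarrow>
      (\<exists>N. finite_index_normal N G \<and> (\<forall>j::int. g \<otimes>\<^bsub>G\<^esub> inv\<^bsub>G\<^esub> (c [^]\<^bsub>G\<^esub> j) \<notin> N)))"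

definition residually_finite :: "('a, 'm) monoid_scheme \<Rightarrow> bool"
  where "residually_finite G \<longleftrightarrow>
    (\<forall>g\<in>carrier G. g \<noteq> \<one>\<^bsub>G\<^esub> \<longrightarrow> (\<exists>N. finite_index_normal N G \<and> g \<notin> N))"

lemma finite_index_normalD:
  assumes "finite_index_normal N G"
  shows "N \<lhd> G" "subgroup N G" "group G" "finite (rcosets\<^bsub>G\<^esub> N)" "N \<subseteq> carrier G"
proof -
  show n: "N \<lhd> G" and "finite (rcosets\<^bsub>G\<^esub> N)"
    using assms unfolding finite_index_normal_def by auto
  then show "subgroup N G" by (metis normal_imp_subgroup)
  then show "N \<subseteq> carrier G" by (rule subgroup.subset)
  show "group G" using n by (simp add: normal_def)
qed

context group
begin

lemma mult_inv_cancel_left [simp]: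
  "\<lbrakk>x \<in> carrier G; y \<in> carrier G\<rbrakk> \<Longrightarrow> x \<otimes> (inv x \<otimes> y) = y"
  "\<lbrakk>x \<in> carrier G; y \<in> carrier G\<rbrakk> \<Longrightarrow> inv x \<otimes> (x \<otimes> y) = y"
  by (simp_all add: m_assoc[symmetric])

text \<open>A map with finite range whose fibres each lie in one coset bounds the index. In the
  applications \<open>F\<close> is a tuple of cosets, a permutation of cosets, a matrix of residues
  or a point of an orbit.\<close>

lemma finite_rcosets_by_map:
  assumes "subgroup H G" "finite (F ` carrier G)"
    and "\<And>x y. \<lbrakk>x \<in> carrier G; y \<in> carrier G; F x = F y\<rbrakk> \<Longrightarrow> x \<otimes> inv y \<in> H"
  shows "finite (rcosets H)"
proof -
  define f where "f = (\<lambda>u. H #> (SOME x. x \<in> carrier G \<and> F x = u))"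
  have "H #> x \<in> f ` F ` carrier G" if x: "x \<in> carrier G" for x
  proof -
    define y where "y = (SOME y. y \<in> carrier G \<and> F y = F x)"
    have y: "y \<in> carrier G \<and> F y = F x"
      unfolding y_def by (rule someI_ex) (use x in auto)
    have "x \<otimes> inv y \<in> H"
      using assms(3)[of x y] x y by auto
    then have "H #> x = H #> y"
      using repr_independence x y assms(1)
      by (metis subgroup.rcos_module_rev is_group)
    then show ?thesis
      unfolding f_def y_def image_image using x by auto
  qed
  then have "rcosets H \<subseteq> f ` F ` carrier G"
    unfolding RCOSETS_def by auto
  then show ?thesis
    using assms(2) finite_subset by blast
qed

lemma finite_image_r_coset: "finite (rcosets H) \<Longrightarrow> finite ((\<lambda>x. H #> x) ` carrier G)"
  by (rule finite_subset[of _ "rcosets H"]) (auto simp: RCOSETS_def)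

lemma r_coset_eq_iff:
  assumes "subgroup H G" "x \<in> carrier G" "y \<in> carrier G"
  shows "H #> x = H #> y \<longleftrightarrow> x \<otimes> inv y \<in> H"
  using assms by (metis repr_independence subgroup.rcos_module is_group rcos_self)

lemma finite_index_normal_Int:
  assumes "finite_index_normal M G" "finite_index_normal N G"
  shows "finite_index_normal (M \<inter> N) G"
proof -
  note M = finite_index_normalD[OF assms(1)] and N = finite_index_normalD[OF assms(2)]
  have n: "M \<inter> N \<lhd> G"
    using normal_subgroup_intersect M N by blast
  have "finite (rcosets (M \<inter> N))"
  proof (rule finite_rcosets_by_map)
    show "subgroup (M \<inter> N) G" using n normal_imp_subgroup by blast
    show "finite ((\<lambda>x. (M #> x, N #> x)) ` carrier G)"
      by (rule finite_subset[OF _ finite_cartesian_product[OF finite_image_r_coset[OF M(4)] finite_image_r_coset[OF N(4)]]]) auto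
  qed (use M N r_coset_eq_iff in auto)
  with n show ?thesis unfolding finite_index_normal_def by blast
qed

lemma finite_index_normal_carrier: "finite_index_normal (carrier G) G"
proof -
  have "subgroup (carrier G) G" by (rule subgroup_self)
  moreover from this have "carrier G \<lhd> G" by (simp add: normal_inv_iff)
  moreover have "finite (rcosets (carrier G))"
    by (rule finite_rcosets_by_map[where F = "\<lambda>_. ()"]) (auto simp: subgroup_self)
  ultimately show ?thesis unfolding finite_index_normal_def by blast
qed

lemma finite_index_normal_INT:
  assumes "finite T" "\<And>t. t \<in> T \<Longrightarrow> finite_index_normal (N t) G"
  shows "\<exists>M. finite_index_normal M G \<and> (\<forall>t\<in>T. M \<subseteq> N t)"
  using assms
proof (induction T)
  case empty
  then show ?case using finite_index_normal_carrier by blast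
next
  case (insert t T)
  then obtain M where "finite_index_normal M G" "\<forall>t\<in>T. M \<subseteq> N t" by auto
  then show ?case
    using insert by (intro exI[of _ "M \<inter> N t"]) (auto intro: finite_index_normal_Int)
qed

text \<open>Two powers of \<open>c\<close> fall into the same coset by the pigeonhole principle; the
  difference of their exponents is \<open>n\<close>.\<close>

lemma finite_index_normal_pow:
  assumes N: "finite_index_normal N G" and c: "c \<in> carrier G"
  shows "\<exists>n>0. c [^] (n::nat) \<in> N"
proof -
  note N' = finite_index_normalD[OF N]
  have "finite (range (\<lambda>n::nat. N #> c [^] n))"
    by (rule finite_subset[OF _ finite_image_r_coset[OF N'(4)]]) (use c in auto)
  then have "\<not> inj (\<lambda>n::nat. N #> c [^] n)"
    using finite_imageD infinite_UNIV_nat by blast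
  then obtain i j :: nat where ij: "i < j" "N #> c [^] j = N #> c [^] i"
    unfolding inj_def by (metis linorder_neqE_nat)
  then have "c [^] j \<otimes> inv (c [^] i) \<in> N"
    using r_coset_eq_iff N'(2) c by auto
  moreover have "c [^] j = c [^] (j - i) \<otimes> c [^] i"
    using ij(1) c by (simp add: nat_pow_mult)
  ultimately have "c [^] (j - i) \<in> N" using c by (simp add: m_assoc)
  then show ?thesis using ij(1) by (intro exI[of _ "j - i"]) auto
qed

end

lemma finite_index_normal_vimage:
  assumes G: "group G" and h: "h \<in> hom G K" and N: "finite_index_normal N K"
  shows "finite_index_normal {x \<in> carrier G. h x \<in> N} G"
proof -
  note N' = finite_index_normalD[OF N]
  interpret G: group G by fact
  interpret K: group K by (rule N')
  interpret h: group_hom G K h by unfold_locales (rule h)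
  interpret N: normal N K by (rule N')
  have s: "subgroup {x \<in> carrier G. h x \<in> N} G"
    by (rule G.subgroupI) (auto simp: N.m_closed N.m_inv_closed)
  have "{x \<in> carrier G. h x \<in> N} \<lhd> G"
    using s by (auto simp: G.normal_inv_iff N.inv_op_closed2)
  moreover have "finite (rcosets\<^bsub>G\<^esub> {x \<in> carrier G. h x \<in> N})"
  proof (rule G.finite_rcosets_by_map[OF s])
    show "finite ((\<lambda>x. N #>\<^bsub>K\<^esub> h x) ` carrier G)"
      by (rule finite_subset[OF _ K.finite_image_r_coset[OF N'(4)]]) auto
  qed (use K.r_coset_eq_iff[OF N'(2)] in auto)
  ultimately show ?thesis unfolding finite_index_normal_def by blast
qed

text \<open>The normal core: the cosets of \<open>H\<close> are permuted by right multiplication, and the kernel of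
  this action is the core.\<close>

lemma (in group) finite_index_normal_core:
  assumes H: "finite_index_subgroup H G"
  shows "finite_index_normal {x \<in> carrier G. \<forall>y\<in>carrier G. y \<otimes> x \<otimes> inv y \<in> H} G" (is "finite_index_normal ?N G")
proof -
  have sH: "subgroup H G" and fH: "finite (rcosets H)"
    using H unfolding finite_index_subgroup_def by auto
  have s: "subgroup ?N G"
  proof (rule subgroupI)
    show "?N \<noteq> {}" using subgroup.one_closed[OF sH] by (auto intro!: exI[of _ \<one>])
    show "inv a \<in> ?N" if a: "a \<in> ?N" for a
    proof -
      have "y \<otimes> inv a \<otimes> inv y = inv (y \<otimes> a \<otimes> inv y)" if "y \<in> carrier G" for y
        using that a by (simp add: inv_mult_group m_assoc)
      then show ?thesis using a subgroup.m_inv_closed[OF sH] by auto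
    qed
    show "a \<otimes> b \<in> ?N" if a: "a \<in> ?N" and b: "b \<in> ?N" for a b
    proof -
      have "y \<otimes> (a \<otimes> b) \<otimes> inv y = (y \<otimes> a \<otimes> inv y) \<otimes> (y \<otimes> b \<otimes> inv y)" if "y \<in> carrier G" for y
        using that a b by (simp add: m_assoc)
      then show ?thesis using a b subgroup.m_closed[OF sH] by auto
    qed
  qed auto
  have n: "?N \<lhd> G"
  proof (unfold normal_inv_iff, intro conjI ballI s)
    fix x h assume x: "x \<in> carrier G" and h: "h \<in> ?N"
    have "y \<otimes> (x \<otimes> h \<otimes> inv x) \<otimes> inv y = (y \<otimes> x) \<otimes> h \<otimes> inv (y \<otimes> x)" if "y \<in> carrier G" for y
      using that x h by (simp add: inv_mult_group m_assoc)
    then show "x \<otimes> h \<otimes> inv x \<in> ?N" using x h by auto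
  qed
  have "finite (rcosets ?N)"
  proof (rule finite_rcosets_by_map[OF s])
    let ?F = "\<lambda>x. restrict (\<lambda>U. U #> x) (rcosets H)"
    have "?F ` carrier G \<subseteq> rcosets H \<rightarrow>\<^sub>E rcosets H"
    proof (intro image_subsetI PiE_I)
      fix x U assume "x \<in> carrier G" "U \<in> rcosets H"
      then obtain z where "z \<in> carrier G" "U = H #> z" unfolding RCOSETS_def by blast
      with \<open>x \<in> carrier G\<close> have "U #> x = H #> (z \<otimes> x)"
        by (simp add: coset_mult_assoc subgroup.subset[OF sH])
      with \<open>x \<in> carrier G\<close> \<open>z \<in> carrier G\<close> \<open>U \<in> rcosets H\<close> show "?F x U \<in> rcosets H"
        by (simp add: rcosetsI subgroup.subset[OF sH])
    qed simp
    then show "finite (?F ` carrier G)"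
      by (rule finite_subset) (rule finite_PiE[OF fH], rule fH)
    fix x y assume x: "x \<in> carrier G" and y: "y \<in> carrier G" and e: "?F x = ?F y"
    have "z \<otimes> (x \<otimes> inv y) \<otimes> inv z \<in> H" if z: "z \<in> carrier G" for z
    proof -
      have "?F x (H #> z) = ?F y (H #> z)" by (simp only: e)
      moreover have "H #> z \<in> rcosets H" using z by (simp add: rcosetsI subgroup.subset[OF sH])
      ultimately have "H #> (z \<otimes> x) = H #> (z \<otimes> y)"
        using x y z by (simp add: coset_mult_assoc subgroup.subset[OF sH])
      then have "(z \<otimes> x) \<otimes> inv (z \<otimes> y) \<in> H" using r_coset_eq_iff[OF sH] x y z by simp
      then show ?thesis using x y z by (simp add: inv_mult_group m_assoc)
    qed
    then show "x \<otimes> inv y \<in> ?N" using x y by auto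
  qed
  with n show ?thesis unfolding finite_index_normal_def by blast
qed

text \<open>The coset of \<open>x\<close> modulo \<open>K\<close> is determined by its coset modulo
  \<open>H\<close>, which fixes a representative \<open>r x\<close>, together with the coset of
  \<open>x \<otimes> inv (r x)\<close> modulo \<open>K\<close> inside \<open>H\<close>. Both take
  finitely many values.\<close>

lemma (in group) finite_index_subgroup_trans:
  assumes H: "finite_index_subgroup H G" and K: "finite_index_subgroup K (G\<lparr>carrier := H\<rparr>)"
  shows "finite_index_subgroup K G"
proof -
  let ?H = "G\<lparr>carrier := H\<rparr>"
  have sH: "subgroup H G" and fH: "finite (rcosets H)"
    using H unfolding finite_index_subgroup_def by auto
  interpret H: group ?H by (rule subgroup.subgroup_is_group[OF sH is_group])
  have sK: "subgroup K ?H" and fK: "finite (rcosets\<^bsub>?H\<^esub> K)"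
    using K unfolding finite_index_subgroup_def by auto
  have s: "subgroup K G" using incl_subgroup[OF sH sK] .
  define r where "r = (\<lambda>x. SOME y. y \<in> carrier G \<and> H #> y = H #> x)"
  have r: "r x \<in> carrier G \<and> H #> r x = H #> x" if "x \<in> carrier G" for x
    unfolding r_def by (rule someI_ex) (use that in auto)
  have rr: "r x = r y" if "H #> x = H #> y" for x y unfolding r_def by (simp add: that)
  have xr: "x \<otimes> inv (r x) \<in> H" if "x \<in> carrier G" for x
    using r[OF that] r_coset_eq_iff[OF sH] that by metis
  let ?F = "\<lambda>x. (H #> x, K #>\<^bsub>?H\<^esub> (x \<otimes> inv (r x)))"
  have "finite (rcosets K)"
  proof (rule finite_rcosets_by_map[OF s])
    have "?F ` carrier G \<subseteq> (\<lambda>x. H #> x) ` carrier G \<times> (\<lambda>x. K #>\<^bsub>?H\<^esub> x) ` carrier ?H"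
    proof (intro image_subsetI SigmaI imageI)
      show "x \<otimes> inv (r x) \<in> carrier ?H" if "x \<in> carrier G" for x using xr[OF that] by simp
    qed
    then show "finite (?F ` carrier G)"
      by (rule finite_subset) (rule finite_cartesian_product[OF finite_image_r_coset[OF fH] H.finite_image_r_coset[OF fK]])
    fix x y assume x: "x \<in> carrier G" and y: "y \<in> carrier G" and e: "?F x = ?F y"
    have e1: "r x = r y" by (rule rr) (rule conjunct1[OF iffD1[OF prod.inject e]])
    have "(x \<otimes> inv (r x)) \<otimes> inv (y \<otimes> inv (r y)) \<in> K"
    proof -
      have "K #> (x \<otimes> inv (r x)) = K #> (y \<otimes> inv (r y))"
        using conjunct2[OF iffD1[OF prod.inject e]] unfolding r_coset_def by simp
      then show ?thesis
        using iffD1[OF r_coset_eq_iff[OF s, of "x \<otimes> inv (r x)" "y \<otimes> inv (r y)"]] x y r[OF x] r[OF y] by blast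
    qed
    then show "x \<otimes> inv y \<in> K"
      using x y r[OF y] e1 by (simp add: inv_mult_group m_assoc)
  qed
  then show ?thesis using s unfolding finite_index_subgroup_def by blast
qed

section \<open>Power filtrations\<close>

text \<open>\<open>N m\<close> plays the part of a congruence subgroup of level \<open>m\<close> in
  a group of integral unipotent matrices: there \<open>(1 + m X) ^ n\<close> is 1 modulo
  \<open>n * m\<close> once small divisors are built into the level. The second clause keeps just
  this trace of the matrices, in a form that finite index overgroups inherit.\<close>

definition power_filtration :: "('a, 'm) monoid_scheme \<Rightarrow> (nat \<Rightarrow> 'a set) \<Rightarrow> bool"
  where "power_filtration G N \<longleftrightarrow> (\<forall>m>0. finite_index_normal (N m) G) \<and>
    (\<forall>m>0. \<forall>n>0. \<forall>g\<in>N m. g [^]\<^bsub>G\<^esub> (n::nat) \<in> N (n * m))"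

text \<open>The second clause says that the residue of the exponent \<open>j\<close> of \<open>c [^] h\<close> modulo \<open>N m\<close> is
  controlled by an integer that does not depend on \<open>m\<close>; it is what a vector \<open>f\<close> with
  \<open>c [^] (h * j) \<cdot> f = f + j u\<close> and a non-zero coordinate \<open>x\<close> of \<open>u\<close> provide.\<close>

definition power_filtered :: "('a, 'm) monoid_scheme \<Rightarrow> bool"
  where "power_filtered G \<longleftrightarrow>
    (\<forall>g\<in>carrier G. g \<noteq> \<one>\<^bsub>G\<^esub> \<longrightarrow> (\<exists>N. power_filtration G N \<and> (\<exists>m>0. g \<notin> N m))) \<and>
    (\<forall>c\<in>carrier G. (\<forall>n>0. c [^]\<^bsub>G\<^esub> (n::nat) \<noteq> \<one>\<^bsub>G\<^esub>) \<longrightarrow>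
      (\<exists>N h x. power_filtration G N \<and> h > 0 \<and> x \<noteq> (0::int) \<and>
        (\<forall>g\<in>carrier G. \<exists>a. \<forall>m>0. \<forall>j::int.
          inv\<^bsub>G\<^esub> g \<otimes>\<^bsub>G\<^esub> c [^]\<^bsub>G\<^esub> (int h * j) \<in> N m \<longrightarrow> int m dvd j * x - a)))"

lemma power_filtrationD:
  assumes "power_filtration G N" "m > 0"
  shows "finite_index_normal (N m) G" "n > 0 \<Longrightarrow> g \<in> N m \<Longrightarrow> g [^]\<^bsub>G\<^esub> (n::nat) \<in> N (n * m)"
  using assms unfolding power_filtration_def by auto

lemma power_filteredD1:
  assumes "power_filtered G" "g \<in> carrier G" "g \<noteq> \<one>\<^bsub>G\<^esub>"
  obtains N m where "power_filtration G N" "m > 0" "g \<notin> N m"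
  using assms unfolding power_filtered_def by blast

lemma power_filteredD2:
  assumes "power_filtered G" "c \<in> carrier G" "\<And>n. n > 0 \<Longrightarrow> c [^]\<^bsub>G\<^esub> (n::nat) \<noteq> \<one>\<^bsub>G\<^esub>"
  obtains N h x where "power_filtration G N" "h > 0" "x \<noteq> (0::int)"
    "\<And>g. g \<in> carrier G \<Longrightarrow> \<exists>a. \<forall>m>0. \<forall>j::int.
          inv\<^bsub>G\<^esub> g \<otimes>\<^bsub>G\<^esub> c [^]\<^bsub>G\<^esub> (int h * j) \<in> N m \<longrightarrow> int m dvd j * x - a"
proof -
  have "\<exists>N h x. power_filtration G N \<and> h > 0 \<and> x \<noteq> (0::int) \<and>
        (\<forall>g\<in>carrier G. \<exists>a. \<forall>m>0. \<forall>j::int.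
          inv\<^bsub>G\<^esub> g \<otimes>\<^bsub>G\<^esub> c [^]\<^bsub>G\<^esub> (int h * j) \<in> N m \<longrightarrow> int m dvd j * x - a)"
    using assms unfolding power_filtered_def by (metis (no_types, lifting))
  then show ?thesis using that by blast
qed

section \<open>Transfer of power filtrations to finite index overgroups\<close>

lemma (in group) subgroup_nat_pow_closed:
  assumes "subgroup H G" "x \<in> H"
  shows "x [^] (n::nat) \<in> H"
  by (induction n) (simp_all add: assms subgroup.one_closed[OF assms(1)] subgroup.m_closed[OF assms(1)])

lemma (in group) nat_pow_conj:
  assumes "x \<in> carrier G" "y \<in> carrier G"
  shows "(y \<otimes> x \<otimes> inv y) [^] (n::nat) = y \<otimes> x [^] n \<otimes> inv y"
  by (induction n) (use assms in \<open>simp_all add: m_assoc\<close>)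

text \<open>\<open>K m\<close> collects the elements all of whose conjugates lie in the preimage of
  \<open>N m\<close>. Powers commute with conjugation and with \<open>f\<close>, so the power clause
  is checked conjugate by conjugate.\<close>

lemma power_filtration_core:
  assumes P: "group P" and H: "finite_index_subgroup H P"
    and f: "f \<in> hom (P\<lparr>carrier := H\<rparr>) A" and A: "group A" and N: "power_filtration A N"
  defines "K \<equiv> \<lambda>m. {x \<in> carrier P. \<forall>y\<in>carrier P. y \<otimes>\<^bsub>P\<^esub> x \<otimes>\<^bsub>P\<^esub> inv\<^bsub>P\<^esub> y \<in> {x\<in>H. f x \<in> N m}}"
  shows "power_filtration P K"
proof -
  let ?H = "P\<lparr>carrier := H\<rparr>"
  interpret P: group P by fact
  have sH: "subgroup H P" using H unfolding finite_index_subgroup_def by auto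
  interpret H: group ?H by (rule subgroup.subgroup_is_group[OF sH P])
  interpret A: group A by fact
  interpret f: group_hom ?H A f by unfold_locales (rule f)
  have "finite_index_normal (K m) P" if m: "m > 0" for m
  proof -
    have "finite_index_normal {x \<in> carrier ?H. f x \<in> N m} ?H"
      by (rule finite_index_normal_vimage[OF H.is_group f]) (rule power_filtrationD[OF N m])
    then have "finite_index_subgroup {x\<in>H. f x \<in> N m} ?H"
      using finite_index_normalD(2,4)[of "{x \<in> carrier ?H. f x \<in> N m}" ?H]
      unfolding finite_index_subgroup_def by simp
    then have "finite_index_subgroup {x\<in>H. f x \<in> N m} P"
      by (rule P.finite_index_subgroup_trans[OF H])
    then show ?thesis unfolding K_def by (rule P.finite_index_normal_core)
  qed
  moreover have "g [^]\<^bsub>P\<^esub> n \<in> K (n * m)" if m: "m > 0" and n: "n > 0" and g: "g \<in> K m" for g and n m :: nat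
  proof -
    have gP: "g \<in> carrier P" using g unfolding K_def by auto
    have "y \<otimes>\<^bsub>P\<^esub> g [^]\<^bsub>P\<^esub> n \<otimes>\<^bsub>P\<^esub> inv\<^bsub>P\<^esub> y \<in> {x\<in>H. f x \<in> N (n * m)}" if y: "y \<in> carrier P" for y
    proof -
      let ?z = "y \<otimes>\<^bsub>P\<^esub> g \<otimes>\<^bsub>P\<^esub> inv\<^bsub>P\<^esub> y"
      have z: "?z \<in> H" "f ?z \<in> N m" using g y unfolding K_def by auto
      have "f (?z [^]\<^bsub>?H\<^esub> n) = f ?z [^]\<^bsub>A\<^esub> n" using f.hom_nat_pow z by simp
      also have "\<dots> \<in> N (n * m)" by (rule power_filtrationD(2)[OF N m n z(2)])
      finally have "f (?z [^]\<^bsub>P\<^esub> n) \<in> N (n * m)" using P.nat_pow_consistent[of ?z n H] by simp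
      moreover have "?z [^]\<^bsub>P\<^esub> n \<in> H"
        by (rule P.subgroup_nat_pow_closed[OF sH z(1)])
      ultimately show ?thesis using P.nat_pow_conj[OF gP y] by simp
    qed
    then show ?thesis using gP unfolding K_def by auto
  qed
  ultimately show ?thesis unfolding power_filtration_def by blast
qed

text \<open>Elements outside \<open>H\<close> are separated by the core of \<open>H\<close> alone,
  those of \<open>H\<close> by the filtration pulled back along \<open>f\<close>. An element of
  infinite order has a power in \<open>H\<close>, which merely multiplies the exponent
  \<open>h\<close>; the linear function keeps its slope \<open>x\<close>.\<close>

lemma power_filtered_virtually_embeds:
  assumes P: "group P" and A: "group A" and e: "virtually_embeds P A" and pf: "power_filtered A"
  shows "power_filtered P"
proof -
  obtain H f where H: "finite_index_subgroup H P" and fm: "f \<in> mon (P\<lparr>carrier := H\<rparr>) A"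
    using e unfolding virtually_embeds_def by blast
  let ?H = "P\<lparr>carrier := H\<rparr>"
  have f: "f \<in> hom ?H A" and inj: "inj_on f H" using fm unfolding mon_def by auto
  interpret P: group P by fact
  have sH: "subgroup H P" using H unfolding finite_index_subgroup_def by auto
  interpret H: group ?H by (rule subgroup.subgroup_is_group[OF sH P])
  interpret A: group A by fact
  interpret f: group_hom ?H A f by unfold_locales (rule f)
  have HP: "H \<subseteq> carrier P" by (rule subgroup.subset[OF sH])
  define core where "core = (\<lambda>N m. {x \<in> carrier P. \<forall>y\<in>carrier P.
     y \<otimes>\<^bsub>P\<^esub> x \<otimes>\<^bsub>P\<^esub> inv\<^bsub>P\<^esub> y \<in> {x\<in>H. f x \<in> (N :: nat \<Rightarrow> _) m}})"
  have pfc: "power_filtration P (core N)" if "power_filtration A N" for N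
    using power_filtration_core[OF P H f A that] unfolding core_def .
  have coreD: "x \<in> H \<and> f x \<in> N m" if "x \<in> core N m" for x N m
  proof -
    from that have "x \<in> carrier P" "\<one>\<^bsub>P\<^esub> \<otimes>\<^bsub>P\<^esub> x \<otimes>\<^bsub>P\<^esub> inv\<^bsub>P\<^esub> \<one>\<^bsub>P\<^esub> \<in> {x\<in>H. f x \<in> N m}"
      unfolding core_def by blast+
    then show ?thesis by simp
  qed
  have f1: "f x \<noteq> \<one>\<^bsub>A\<^esub>" if "x \<in> H" "x \<noteq> \<one>\<^bsub>P\<^esub>" for x
  proof
    assume "f x = \<one>\<^bsub>A\<^esub>"
    then have "f x = f \<one>\<^bsub>P\<^esub>" using f.hom_one by simp
    then show False using inj that subgroup.one_closed[OF sH] by (auto dest: inj_onD)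
  qed
  show ?thesis
    unfolding power_filtered_def
  proof (intro conjI ballI impI)
    fix g assume g: "g \<in> carrier P" "g \<noteq> \<one>\<^bsub>P\<^esub>"
    show "\<exists>N. power_filtration P N \<and> (\<exists>m>0. g \<notin> N m)"
    proof (cases "g \<in> H")
      case True
      then obtain N m where N: "power_filtration A N" "m > 0" "f g \<notin> N m"
        using power_filteredD1[OF pf, of "f g"] f1 g f.hom_closed by auto
      show ?thesis
        by (intro exI[of _ "core N"] conjI pfc N exI[of _ m]) (use coreD N(3) in blast)
    next
      case False
      \<comment> \<open>A constant filtration suffices here, since its core already lies inside
        \<open>H\<close>.\<close>
      define N where "N = (\<lambda>m::nat. carrier A)"
      have "power_filtration A N"
        unfolding power_filtration_def N_def by (auto intro: A.finite_index_normal_carrier)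
      then show ?thesis
        by (intro exI[of _ "core N"] conjI pfc exI[of _ 1]) (use False coreD in auto)
    qed
  next
    fix c assume c: "c \<in> carrier P" and inf: "\<forall>n>0. c [^]\<^bsub>P\<^esub> (n::nat) \<noteq> \<one>\<^bsub>P\<^esub>"
    have "finite_index_normal {x \<in> carrier P. \<forall>y\<in>carrier P. y \<otimes>\<^bsub>P\<^esub> x \<otimes>\<^bsub>P\<^esub> inv\<^bsub>P\<^esub> y \<in> H} P" (is "finite_index_normal ?C P")
      by (rule P.finite_index_normal_core[OF H])
    then obtain l where l: "l > 0" "c [^]\<^bsub>P\<^esub> (l::nat) \<in> ?C"
      using P.finite_index_normal_pow[OF _ c] by blast
    then have "\<one>\<^bsub>P\<^esub> \<otimes>\<^bsub>P\<^esub> c [^]\<^bsub>P\<^esub> l \<otimes>\<^bsub>P\<^esub> inv\<^bsub>P\<^esub> \<one>\<^bsub>P\<^esub> \<in> H" by blast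
    then have clH: "c [^]\<^bsub>P\<^esub> l \<in> H" using c by simp
    let ?d = "c [^]\<^bsub>P\<^esub> l"
    have dinf: "f ?d [^]\<^bsub>A\<^esub> n \<noteq> \<one>\<^bsub>A\<^esub>" if n: "n > 0" for n :: nat
    proof -
      have "f ?d [^]\<^bsub>A\<^esub> n = f (?d [^]\<^bsub>P\<^esub> n)"
        using f.hom_nat_pow[of ?d n] clH P.nat_pow_consistent[of ?d n H] by simp
      moreover have "?d [^]\<^bsub>P\<^esub> n \<in> H"
        by (rule P.subgroup_nat_pow_closed[OF sH clH])
      moreover have "?d [^]\<^bsub>P\<^esub> n \<noteq> \<one>\<^bsub>P\<^esub>" using inf n l c by (simp add: P.nat_pow_pow)
      ultimately show ?thesis using f1 by simp
    qed
    have "f ?d \<in> carrier A" using clH f.hom_closed by auto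
    from power_filteredD2[OF pf this dinf] obtain N h x where N: "power_filtration A N" "h > 0" "x \<noteq> (0::int)"
      and a: "\<And>g. g \<in> carrier A \<Longrightarrow> \<exists>a. \<forall>m>0. \<forall>j::int.
          inv\<^bsub>A\<^esub> g \<otimes>\<^bsub>A\<^esub> f ?d [^]\<^bsub>A\<^esub> (int h * j) \<in> N m \<longrightarrow> int m dvd j * x - a" by blast
    have "\<exists>a. \<forall>m>0. \<forall>j::int. inv\<^bsub>P\<^esub> g \<otimes>\<^bsub>P\<^esub> c [^]\<^bsub>P\<^esub> (int (l * h) * j) \<in> core N m \<longrightarrow> int m dvd j * x - a"
      if g: "g \<in> carrier P" for g
    proof -
      have e: "c [^]\<^bsub>P\<^esub> (int (l * h) * j) = ?d [^]\<^bsub>P\<^esub> (int h * j)" for j :: int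
        using c P.int_pow_pow[of c "int l" "int h * j"] by (simp add: int_pow_int mult.assoc)
      have eH: "?d [^]\<^bsub>P\<^esub> j \<in> H" "f (?d [^]\<^bsub>P\<^esub> j) = f ?d [^]\<^bsub>A\<^esub> j" for j :: int
        using P.int_pow_consistent[OF sH clH, of j] f.hom_int_pow[of ?d j] H.int_pow_closed[of ?d j] clH by simp_all
      show ?thesis
      proof (cases "g \<in> H")
        case True
        then have fg: "f g \<in> carrier A" using f.hom_closed by simp
        have gi: "inv\<^bsub>P\<^esub> g \<in> H" "f (inv\<^bsub>P\<^esub> g) = inv\<^bsub>A\<^esub> (f g)"
          using subgroup.m_inv_closed[OF sH True] f.hom_inv[of g] P.m_inv_consistent[OF sH True] True by auto
        have "f (inv\<^bsub>P\<^esub> g \<otimes>\<^bsub>P\<^esub> ?d [^]\<^bsub>P\<^esub> j) = inv\<^bsub>A\<^esub> (f g) \<otimes>\<^bsub>A\<^esub> f ?d [^]\<^bsub>A\<^esub> j" for j :: int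
          using f.hom_mult[of "inv\<^bsub>P\<^esub> g" "?d [^]\<^bsub>P\<^esub> j"] gi eH by simp
        then show ?thesis using a[OF fg] coreD e by metis
      next
        \<comment> \<open>Every \<open>core N m\<close> lies in \<open>H\<close>, so the premise on
          \<open>j\<close> is never met and any \<open>a\<close> would do.\<close>
        case False
        have "inv\<^bsub>P\<^esub> g \<otimes>\<^bsub>P\<^esub> ?d [^]\<^bsub>P\<^esub> j \<notin> H" for j :: int
        proof
          assume "inv\<^bsub>P\<^esub> g \<otimes>\<^bsub>P\<^esub> ?d [^]\<^bsub>P\<^esub> j \<in> H"
          then have "?d [^]\<^bsub>P\<^esub> j \<otimes>\<^bsub>P\<^esub> inv\<^bsub>P\<^esub> (inv\<^bsub>P\<^esub> g \<otimes>\<^bsub>P\<^esub> ?d [^]\<^bsub>P\<^esub> j) \<in> H"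
            using eH(1)[of j] subgroup.m_inv_closed[OF sH] subgroup.m_closed[OF sH] by blast
          then show False using g c False by (simp add: P.inv_mult_group P.m_assoc[symmetric])
        qed
        then show ?thesis using coreD e by metis
      qed
    qed
    then show "\<exists>N h x. power_filtration P N \<and> h > 0 \<and> x \<noteq> (0::int) \<and>
        (\<forall>g\<in>carrier P. \<exists>a. \<forall>m>0. \<forall>j::int.
          inv\<^bsub>P\<^esub> g \<otimes>\<^bsub>P\<^esub> c [^]\<^bsub>P\<^esub> (int h * j) \<in> N m \<longrightarrow> int m dvd j * x - a)"
      using pfc[OF N(1)] N(2,3) l(1) by (intro exI[of _ "core N"] exI[of _ "l * h"] exI[of _ x]) auto
  qed
qed

section \<open>Residual finiteness and separation of cyclic subgroups\<close>

lemma (in group) mult_inv_eq_one_iff: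
  assumes "x \<in> carrier G" "y \<in> carrier G"
  shows "x \<otimes> inv y = \<one> \<longleftrightarrow> x = y"
proof
  assume "x \<otimes> inv y = \<one>"
  then have "x \<otimes> inv y \<otimes> y = y" using assms by simp
  then show "x = y" using assms by (simp add: m_assoc)
qed (use assms in simp)

text \<open>Reconciles the left quotient in \<open>power_filtered\<close> with the right quotient in
  \<open>cyclically_separable\<close>.\<close>

lemma (in normal) inv_mult_mem_iff:
  assumes x: "x \<in> carrier G" and y: "y \<in> carrier G"
  shows "inv x \<otimes> y \<in> H \<longleftrightarrow> x \<otimes> inv y \<in> H"
proof
  assume "inv x \<otimes> y \<in> H"
  then have "x \<otimes> inv (inv x \<otimes> y) \<otimes> inv x \<in> H"
    using x m_inv_closed inv_op_closed2 by blast
  then show "x \<otimes> inv y \<in> H" using x y by (simp add: inv_mult_group m_assoc)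
next
  assume "x \<otimes> inv y \<in> H"
  then have "inv x \<otimes> inv (x \<otimes> inv y) \<otimes> x \<in> H"
    using x m_inv_closed inv_op_closed1 by blast
  then show "inv x \<otimes> y \<in> H" using x y by (simp add: inv_mult_group m_assoc)
qed

lemma power_filtered_residually_finite: "power_filtered G \<Longrightarrow> residually_finite G"
  unfolding residually_finite_def
  by (metis power_filteredD1 power_filtrationD(1))

lemma (in group) residually_finite_finite:
  assumes "residually_finite G" "finite F" "F \<subseteq> carrier G" "\<one> \<notin> F"
  shows "\<exists>N. finite_index_normal N G \<and> N \<inter> F = {}"
proof -
  have "\<forall>t\<in>F. \<exists>N. finite_index_normal N G \<and> t \<notin> N"
    using assms(1,3,4) unfolding residually_finite_def by (metis subsetD)
  then obtain N where N: "\<And>t. t \<in> F \<Longrightarrow> finite_index_normal (N t) G \<and> t \<notin> N t" by metis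
  then obtain M where "finite_index_normal M G" "\<forall>t\<in>F. M \<subseteq> N t"
    using finite_index_normal_INT[OF assms(2), of N] by blast
  then show ?thesis using N by blast
qed

lemma (in group) int_pow_eq_mod:
  assumes c: "c \<in> carrier G" and n: "c [^] (n::nat) = \<one>"
  shows "c [^] (j::int) = c [^] (j mod int n)"
proof -
  have "c [^] j = c [^] (int n * (j div int n) + j mod int n)" by simp
  also have "\<dots> = (c [^] n) [^] (j div int n) \<otimes> c [^] (j mod int n)"
    using c by (simp only: int_pow_mult int_pow_pow[symmetric] int_pow_int)
  finally show ?thesis using n c by simp
qed

text \<open>Only the finitely many elements \<open>g \<otimes> inv (c [^] i)\<close> with
  \<open>0 \<le> i < n\<close> have to be kept out of \<open>N\<close>, and none of them is
  trivial.\<close>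

lemma (in group) residually_finite_separates_torsion:
  assumes rf: "residually_finite G" and c: "c \<in> carrier G" and g: "g \<in> carrier G"
    and n: "n > 0" "c [^] (n::nat) = \<one>" and gc: "\<And>j::int. g \<noteq> c [^] j"
  shows "\<exists>N. finite_index_normal N G \<and> (\<forall>j::int. g \<otimes> inv (c [^] j) \<notin> N)"
proof -
  let ?F = "(\<lambda>i. g \<otimes> inv (c [^] i)) ` {0..<int n}"
  have "g \<otimes> inv (c [^] i) \<noteq> \<one>" for i :: int
    using gc[of i] mult_inv_eq_one_iff[OF g int_pow_closed[OF c]] by blast
  then have "\<one> \<notin> ?F" by (metis (no_types, lifting) imageE)
  moreover have "?F \<subseteq> carrier G" using c g by auto
  ultimately have "\<exists>N. finite_index_normal N G \<and> N \<inter> ?F = {}"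
    by (intro residually_finite_finite[OF rf]) auto
  then obtain N where N: "finite_index_normal N G" "N \<inter> ?F = {}" by blast
  have "g \<otimes> inv (c [^] j) \<in> ?F" for j :: int
    using int_pow_eq_mod[OF c n(2), of j] n(1) by auto
  then show ?thesis using N by blast
qed

text \<open>The case of infinite order carries the idea. With \<open>d = c [^] h\<close>, a coset of
  \<open>N m\<close> containing both \<open>u\<close> and \<open>d [^] j\<close> forces
  \<open>j * x\<close> to agree with \<open>a\<close> modulo \<open>m\<close>. Either
  \<open>x\<close> does not divide \<open>a\<close> and level \<open>\<bar>x\<bar>\<close>
  separates, or \<open>j\<close> is forced close to one exponent \<open>b\<close>; then
  \<open>u\<close> differs from \<open>d [^] b\<close> by a non-trivial element, which a second
  filtration excludes. The cyclic group of \<open>c\<close> is a union of \<open>h\<close> cosets of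
  that of \<open>d\<close>.\<close>

lemma power_filtered_cyclically_separable:
  assumes G: "group G" and pf: "power_filtered G"
  shows "cyclically_separable G"
  unfolding cyclically_separable_def
proof (intro ballI impI)
  interpret group G by fact
  fix c g assume c: "c \<in> carrier G" and g: "g \<in> carrier G" and gc: "\<forall>j::int. g \<noteq> c [^]\<^bsub>G\<^esub> j"
  show "\<exists>N. finite_index_normal N G \<and> (\<forall>j::int. g \<otimes>\<^bsub>G\<^esub> inv\<^bsub>G\<^esub> (c [^]\<^bsub>G\<^esub> j) \<notin> N)"
  proof (cases "\<exists>n>0. c [^]\<^bsub>G\<^esub> (n::nat) = \<one>\<^bsub>G\<^esub>")
    case True
    then show ?thesis
      using residually_finite_separates_torsion[OF power_filtered_residually_finite[OF pf] c g] gc by blast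
  next
    case False
    then have inf: "\<And>n. n > 0 \<Longrightarrow> c [^]\<^bsub>G\<^esub> (n::nat) \<noteq> \<one>\<^bsub>G\<^esub>" by blast
    obtain N h x where N: "power_filtration G N" and h: "h > 0" and x: "x \<noteq> (0::int)"
      and a: "\<And>g. g \<in> carrier G \<Longrightarrow> \<exists>a. \<forall>m>0. \<forall>j::int.
          inv\<^bsub>G\<^esub> g \<otimes>\<^bsub>G\<^esub> c [^]\<^bsub>G\<^esub> (int h * j) \<in> N m \<longrightarrow> int m dvd j * x - a"
      using power_filteredD2[OF pf c inf] by metis
    define d where "d = c [^]\<^bsub>G\<^esub> h"
    have d: "d \<in> carrier G" unfolding d_def using c by simp
    have dp: "c [^]\<^bsub>G\<^esub> (int h * j) = d [^]\<^bsub>G\<^esub> j" for j :: int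
      using c int_pow_pow[of c "int h" j] by (simp add: d_def int_pow_int)
    have claim: "\<exists>K. finite_index_normal K G \<and> (\<forall>j::int. u \<otimes>\<^bsub>G\<^esub> inv\<^bsub>G\<^esub> (d [^]\<^bsub>G\<^esub> j) \<notin> K)"
      if u: "u \<in> carrier G" and ud: "\<forall>j::int. u \<noteq> d [^]\<^bsub>G\<^esub> j" for u
    proof -
      obtain a where a: "\<And>m j. m > 0 \<Longrightarrow> u \<otimes>\<^bsub>G\<^esub> inv\<^bsub>G\<^esub> (d [^]\<^bsub>G\<^esub> (j::int)) \<in> N m \<Longrightarrow> int m dvd j * x - a"
        using a[OF u] unfolding dp
        using normal.inv_mult_mem_iff[OF finite_index_normalD(1)[OF power_filtrationD(1)[OF N]] u int_pow_closed[OF d]]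
        by blast
      show ?thesis
      proof (cases "x dvd a")
        case False
        have "u \<otimes>\<^bsub>G\<^esub> inv\<^bsub>G\<^esub> (d [^]\<^bsub>G\<^esub> j) \<notin> N (nat \<bar>x\<bar>)" for j :: int
        proof
          assume "u \<otimes>\<^bsub>G\<^esub> inv\<^bsub>G\<^esub> (d [^]\<^bsub>G\<^esub> j) \<in> N (nat \<bar>x\<bar>)"
          then have "x dvd j * x - a" using a[of "nat \<bar>x\<bar>" j] x by simp
          then have "x dvd a"
            by (metis dvd_add_left_iff dvd_diff_commute dvd_triv_right diff_add_cancel)
          then show False using False by simp
        qed
        then show ?thesis using power_filtrationD(1)[OF N, of "nat \<bar>x\<bar>"] x by auto
      next
        case True
        then obtain b where b: "a = x * b" by blast
        define e where "e = u \<otimes>\<^bsub>G\<^esub> inv\<^bsub>G\<^esub> (d [^]\<^bsub>G\<^esub> b)"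
        have e: "e \<in> carrier G" unfolding e_def using u d by simp
        have "e \<noteq> \<one>\<^bsub>G\<^esub>"
          using ud mult_inv_eq_one_iff[OF u int_pow_closed[OF d]] unfolding e_def by blast
        then obtain N' m where N': "power_filtration G N'" "m > 0" "e \<notin> N' m"
          using power_filteredD1[OF pf e] by metis
        \<comment> \<open>From a power of \<open>d\<close> in level 1 the power clause of
          \<open>N'\<close> produces one in level \<open>m\<close>, namely
          \<open>d [^] (k * m)\<close>.\<close>
        obtain k where k: "k > 0" "d [^]\<^bsub>G\<^esub> (k::nat) \<in> N' 1"
          using finite_index_normal_pow[OF power_filtrationD(1)[OF N'(1)] d, of 1] by auto
        \<comment> \<open>The factor \<open>\<bar>x\<bar>\<close> cancels against \<open>x\<close>
          in \<open>j * x - a = x * (j - b)\<close>; what remains says that \<open>k * m\<close>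
          divides \<open>j - b\<close>, so \<open>d [^] (j - b)\<close> lies in
          \<open>N' m\<close>.\<close>
        let ?M = "nat \<bar>x\<bar> * k * m"
        let ?K = "N ?M \<inter> N' m"
        have M: "?M > 0" using x k N' by simp
        have K: "finite_index_normal ?K G"
          using finite_index_normal_Int power_filtrationD(1)[OF N M] power_filtrationD(1)[OF N'(1,2)] by blast
        have sN': "subgroup (N' m) G" using finite_index_normalD(2) power_filtrationD(1)[OF N'(1,2)] by blast
        have "u \<otimes>\<^bsub>G\<^esub> inv\<^bsub>G\<^esub> (d [^]\<^bsub>G\<^esub> j) \<notin> ?K" for j :: int
        proof
          assume uj: "u \<otimes>\<^bsub>G\<^esub> inv\<^bsub>G\<^esub> (d [^]\<^bsub>G\<^esub> j) \<in> ?K"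
          then have "int ?M dvd j * x - a" using a[OF M] by blast
          moreover have "int ?M = \<bar>x\<bar> * int (k * m)" by simp
          moreover have "j * x - a = x * (j - b)" unfolding b by (simp add: algebra_simps)
          ultimately have "\<bar>x\<bar> * int (k * m) dvd x * (j - b)" by (simp add: mult.assoc)
          moreover have "\<bar>x\<bar> * int (k * m) = \<bar>x * int (k * m)\<bar>" by (simp add: abs_mult)
          ultimately have "x * int (k * m) dvd x * (j - b)" by (simp only: abs_dvd_iff)
          then have "int (k * m) dvd j - b" using x by simp
          then obtain q where q: "j - b = int (k * m) * q" by blast
          have "(d [^]\<^bsub>G\<^esub> k) [^]\<^bsub>G\<^esub> m \<in> N' (m * 1)"
            by (rule power_filtrationD(2)[OF N'(1)]) (use k N' in auto)
          then have "d [^]\<^bsub>G\<^esub> (k * m) \<in> N' m" using d by (simp add: nat_pow_pow)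
          then have "(d [^]\<^bsub>G\<^esub> (k * m)) [^]\<^bsub>G\<^esub> q \<in> N' m" by (rule subgroup_int_pow_closed[OF sN'])
          then have "d [^]\<^bsub>G\<^esub> (j - b) \<in> N' m"
            unfolding q using d by (simp only: int_pow_pow[symmetric] int_pow_int)
          then have "u \<otimes>\<^bsub>G\<^esub> inv\<^bsub>G\<^esub> (d [^]\<^bsub>G\<^esub> j) \<otimes>\<^bsub>G\<^esub> d [^]\<^bsub>G\<^esub> (j - b) \<in> N' m"
            using uj subgroup.m_closed[OF sN'] by blast
          also have "u \<otimes>\<^bsub>G\<^esub> inv\<^bsub>G\<^esub> (d [^]\<^bsub>G\<^esub> j) \<otimes>\<^bsub>G\<^esub> d [^]\<^bsub>G\<^esub> (j - b) = e"
            unfolding e_def using u d by (simp add: int_pow_diff m_assoc)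
          finally show False using N' by blast
        qed
        then show ?thesis using K by blast
      qed
    qed
    \<comment> \<open>Since \<open>g\<close> is no power of \<open>c\<close>, none of its translates
      by powers of \<open>c\<close> is a power of \<open>d\<close>. Later \<open>i\<close> only has
      to run through the residues modulo \<open>h\<close>.\<close>
    have gi: "\<forall>j::int. g \<otimes>\<^bsub>G\<^esub> inv\<^bsub>G\<^esub> (c [^]\<^bsub>G\<^esub> i) \<noteq> d [^]\<^bsub>G\<^esub> j" for i :: int
    proof
      fix j :: int
      show "g \<otimes>\<^bsub>G\<^esub> inv\<^bsub>G\<^esub> (c [^]\<^bsub>G\<^esub> i) \<noteq> d [^]\<^bsub>G\<^esub> j"
      proof
        assume "g \<otimes>\<^bsub>G\<^esub> inv\<^bsub>G\<^esub> (c [^]\<^bsub>G\<^esub> i) = d [^]\<^bsub>G\<^esub> j"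
        then have "g = c [^]\<^bsub>G\<^esub> (int h * j) \<otimes>\<^bsub>G\<^esub> c [^]\<^bsub>G\<^esub> i"
          unfolding dp using c g d by (metis int_pow_closed inv_closed inv_solve_right')
        then have "g = c [^]\<^bsub>G\<^esub> (int h * j + i)" using c by (simp add: int_pow_mult)
        then show False using gc by blast
      qed
    qed
    have "\<exists>K. finite_index_normal K G \<and> (\<forall>j::int. g \<otimes>\<^bsub>G\<^esub> inv\<^bsub>G\<^esub> (c [^]\<^bsub>G\<^esub> i) \<otimes>\<^bsub>G\<^esub> inv\<^bsub>G\<^esub> (d [^]\<^bsub>G\<^esub> j) \<notin> K)" for i :: int
      using claim[OF _ gi] c g by simp
    then obtain K where K: "\<And>i::int. finite_index_normal (K i) G"
      "\<And>i j::int. g \<otimes>\<^bsub>G\<^esub> inv\<^bsub>G\<^esub> (c [^]\<^bsub>G\<^esub> i) \<otimes>\<^bsub>G\<^esub> inv\<^bsub>G\<^esub> (d [^]\<^bsub>G\<^esub> j) \<notin> K i" by metis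
    obtain L where L: "finite_index_normal L G" "\<forall>i\<in>{0..<int h}. L \<subseteq> K i"
      using finite_index_normal_INT[of "{0..<int h}" K] K(1) by auto
    have "g \<otimes>\<^bsub>G\<^esub> inv\<^bsub>G\<^esub> (c [^]\<^bsub>G\<^esub> j) \<notin> L" for j :: int
    proof -
      have "c [^]\<^bsub>G\<^esub> j = c [^]\<^bsub>G\<^esub> (int h * (j div int h) + j mod int h)" by simp
      also have "\<dots> = d [^]\<^bsub>G\<^esub> (j div int h) \<otimes>\<^bsub>G\<^esub> c [^]\<^bsub>G\<^esub> (j mod int h)"
        using c by (simp only: int_pow_mult dp)
      finally have "g \<otimes>\<^bsub>G\<^esub> inv\<^bsub>G\<^esub> (c [^]\<^bsub>G\<^esub> j) =
          g \<otimes>\<^bsub>G\<^esub> inv\<^bsub>G\<^esub> (c [^]\<^bsub>G\<^esub> (j mod int h)) \<otimes>\<^bsub>G\<^esub> inv\<^bsub>G\<^esub> (d [^]\<^bsub>G\<^esub> (j div int h))"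
        using c g d by (simp add: inv_mult_group m_assoc)
      moreover have "j mod int h \<in> {0..<int h}" using h by simp
      ultimately show ?thesis using K(2) L(2) by (metis subsetD)
    qed
    then show ?thesis using L(1) by blast
  qed
qed

text \<open>Let \<open>e m\<close> be the order of \<open>d = c [^] h\<close> modulo \<open>N m\<close>. The filtration gives
  \<open>e (n * m) dvd n * e m\<close>, while \<open>m dvd e m * x\<close>, so the integer \<open>n * e 1 div e n\<close> is bounded.
  Beyond an \<open>n\<close> where it is maximal, \<open>e\<close> is exactly linear.\<close>

lemma power_filtered_quasi_potent:
  assumes G: "group G" and pf: "power_filtered G"
    and c: "c \<in> carrier G" and inf: "\<And>n. n > 0 \<Longrightarrow> c [^]\<^bsub>G\<^esub> (n::nat) \<noteq> \<one>\<^bsub>G\<^esub>"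
  shows "\<exists>k>0. \<forall>n>0. \<exists>N. finite_index_normal N G \<and>
    (\<forall>j::int. c [^]\<^bsub>G\<^esub> (int k * j) \<in> N \<longleftrightarrow> int n dvd j)"
proof -
  interpret group G by fact
  obtain N h x where N: "power_filtration G N" and h: "h > 0" and x: "x \<noteq> (0::int)"
    and a: "\<And>g. g \<in> carrier G \<Longrightarrow> \<exists>a. \<forall>m>0. \<forall>j::int.
        inv\<^bsub>G\<^esub> g \<otimes>\<^bsub>G\<^esub> c [^]\<^bsub>G\<^esub> (int h * j) \<in> N m \<longrightarrow> int m dvd j * x - a"
    using power_filteredD2[OF pf c inf] by metis
  define d where "d = c [^]\<^bsub>G\<^esub> h"
  have d: "d \<in> carrier G" unfolding d_def using c by simp
  have dp: "c [^]\<^bsub>G\<^esub> (int h * j) = d [^]\<^bsub>G\<^esub> j" for j :: int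
    using c int_pow_pow[of c "int h" j] by (simp add: d_def int_pow_int)
  have fN: "finite_index_normal (N m) G" if "m > 0" for m using power_filtrationD(1)[OF N that] .
  have sN: "subgroup (N m) G" if "m > 0" for m using finite_index_normalD(2)[OF fN[OF that]] .
  obtain a0 where a0: "\<And>m j::int. m > 0 \<Longrightarrow> d [^]\<^bsub>G\<^esub> j \<in> N (nat m) \<Longrightarrow> m dvd j * x - a0"
  proof -
    obtain a0 where a0: "\<And>m j. m > 0 \<Longrightarrow> d [^]\<^bsub>G\<^esub> (j::int) \<in> N m \<Longrightarrow> int m dvd j * x - a0"
      using a[OF one_closed] d unfolding dp by auto
    show ?thesis
    proof (rule that)
      fix m j :: int assume "m > 0" "d [^]\<^bsub>G\<^esub> j \<in> N (nat m)"
      then show "m dvd j * x - a0" using a0[of "nat m" j] by simp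
    qed
  qed
  \<comment> \<open>The exponent \<open>j = 0\<close> is admissible at every level, so every
    positive integer divides \<open>a0\<close>.\<close>
  have "m dvd a0" if "m > 0" for m :: int
    using a0[OF that, of 0] subgroup.one_closed[OF sN, of "nat m"] that by simp
  from this[of "\<bar>a0\<bar> + 1"] have "a0 = 0" using dvd_imp_le_int[of a0 "\<bar>a0\<bar> + 1"] by force
  then have x': "int m dvd j * x" if "m > 0" "d [^]\<^bsub>G\<^esub> j \<in> N m" for m j
    using a0[of "int m" j] that by simp
  define e where "e = (\<lambda>m. LEAST n. n > 0 \<and> d [^]\<^bsub>G\<^esub> (n::nat) \<in> N m)"
  have e: "e m > 0 \<and> d [^]\<^bsub>G\<^esub> (e m) \<in> N m" if "m > 0" for m
    unfolding e_def by (rule LeastI_ex) (use finite_index_normal_pow[OF fN[OF that] d] in blast)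
  have e_iff: "d [^]\<^bsub>G\<^esub> (j::int) \<in> N m \<longleftrightarrow> int (e m) dvd j" if m: "m > 0" for m j
  proof
    assume "int (e m) dvd j"
    then obtain q where "j = int (e m) * q" by blast
    then have "d [^]\<^bsub>G\<^esub> j = (d [^]\<^bsub>G\<^esub> (e m)) [^]\<^bsub>G\<^esub> q" using d by (simp only: int_pow_pow[symmetric] int_pow_int)
    then show "d [^]\<^bsub>G\<^esub> j \<in> N m" using subgroup_int_pow_closed[OF sN[OF m]] e[OF m] by simp
  next
    assume j: "d [^]\<^bsub>G\<^esub> j \<in> N m"
    let ?q = "j div int (e m)" and ?r = "j mod int (e m)"
    have "d [^]\<^bsub>G\<^esub> ?r = d [^]\<^bsub>G\<^esub> (j - int (e m) * ?q)" by (simp add: minus_mult_div_eq_mod)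
    also have "\<dots> = d [^]\<^bsub>G\<^esub> j \<otimes>\<^bsub>G\<^esub> inv\<^bsub>G\<^esub> ((d [^]\<^bsub>G\<^esub> (e m)) [^]\<^bsub>G\<^esub> ?q)"
      using d by (simp only: int_pow_diff int_pow_pow[symmetric] int_pow_int)
    also have "\<dots> \<in> N m"
      using j subgroup.m_closed[OF sN[OF m]] subgroup.m_inv_closed[OF sN[OF m]]
        subgroup_int_pow_closed[OF sN[OF m]] e[OF m] by blast
    finally have r: "d [^]\<^bsub>G\<^esub> (nat ?r) \<in> N m" using e[OF m] by (simp flip: int_pow_int)
    have "\<not> nat ?r < e m \<or> nat ?r = 0"
      using not_less_Least[of "nat ?r" "\<lambda>n. n > 0 \<and> d [^]\<^bsub>G\<^esub> (n::nat) \<in> N m"] r unfolding e_def by blast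
    moreover have "?r < int (e m)" "0 \<le> ?r" using e[OF m] by simp_all
    ultimately have "?r = 0" by linarith
    then show "int (e m) dvd j" by auto
  qed
  have e_dvd: "e (n * m) dvd n * e m" if m: "m > 0" and n: "n > 0" for m n
  proof -
    have "(d [^]\<^bsub>G\<^esub> (e m)) [^]\<^bsub>G\<^esub> n \<in> N (n * m)"
      by (rule power_filtrationD(2)[OF N m n]) (use e[OF m] in blast)
    then have "d [^]\<^bsub>G\<^esub> (int (n * e m)) \<in> N (n * m)" 
      using d by (simp only: nat_pow_pow int_pow_int mult.commute)
    then have "int (e (n * m)) dvd int (n * e m)" using e_iff[of "n * m"] m n by simp
    then show ?thesis by (simp only: of_nat_dvd_iff)
  qed
  define q where "q = (\<lambda>n. n * e 1 div e n)"
  have q: "q n * e n = n * e 1" if "n > 0" for n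
    using e_dvd[of 1 n] that unfolding q_def by simp
  have q_bound: "q n \<le> e 1 * nat \<bar>x\<bar>" if n: "n > 0" for n
  proof -
    have "int n dvd int (e n) * x" using x'[OF n, of "int (e n)"] e_iff[OF n, of "int (e n)"] by simp
    moreover have "int (e n * nat \<bar>x\<bar>) = \<bar>int (e n) * x\<bar>" by (simp add: abs_mult)
    ultimately have "int n dvd int (e n * nat \<bar>x\<bar>)" by (simp only: dvd_abs_iff)
    then have "n dvd e n * nat \<bar>x\<bar>" by (simp only: of_nat_dvd_iff)
    then have "n \<le> e n * nat \<bar>x\<bar>" using e[OF n] x by (intro dvd_imp_le) auto
    then have "q n * e n \<le> (e 1 * nat \<bar>x\<bar>) * e n" unfolding q[OF n] by (simp add: mult.commute mult.left_commute)
    then show ?thesis using e[OF n] by simp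
  qed
  have "\<exists>n. n > 0 \<and> (\<forall>m. m > 0 \<longrightarrow> q m \<le> q n)"
    using ex_has_greatest_nat[of "\<lambda>n. n > 0" 1 q "Suc (e 1 * nat \<bar>x\<bar>)"] q_bound by (auto simp: less_Suc_eq_le)
  then obtain n0 where n0: "n0 > 0" "\<And>m. m > 0 \<Longrightarrow> q m \<le> q n0" by blast
  \<comment> \<open>If \<open>e (n * n0)\<close> were a proper divisor of \<open>n * e n0\<close>,
    with cofactor \<open>t\<close>, then \<open>q (n * n0) = q n0 * t\<close> would exceed the
    maximum of \<open>q\<close>.\<close>
  have elin: "e (n * n0) = n * e n0" if n: "n > 0" for n
  proof -
    obtain t where t: "n * e n0 = e (n * n0) * t" using e_dvd[OF n0(1) n] by blast
    have nn: "n * n0 > 0" using n n0 by simp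
    have "q (n * n0) * e (n * n0) = n * (q n0 * e n0)" using q[OF nn] q[OF n0(1)] by simp
    also have "\<dots> = (q n0 * t) * e (n * n0)" using t by (metis mult.assoc mult.commute)
    finally have "q (n * n0) = q n0 * t" using e[OF nn] by simp
    then have "q n0 * t \<le> q n0 * 1" using n0(2)[OF nn] by simp
    moreover have "q n0 > 0" using q[OF n0(1)] n0(1) e[of 1] by (metis mult_is_0 neq0_conv zero_less_one)
    ultimately have "t \<le> 1" by (metis mult_le_cancel1)
    moreover have "t > 0" using t n e[OF n0(1)] by (metis mult_is_0 neq0_conv)
    ultimately show ?thesis using t by (metis One_nat_def le_antisym Suc_leI mult.right_neutral)
  qed
  show ?thesis
  \<comment> \<open>Relative to the base exponent \<open>h * e n0\<close> the subgroup
    \<open>N (n * n0)\<close> has exponent exactly \<open>n\<close>.\<close>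
  proof (intro exI[of _ "h * e n0"] conjI allI impI)
    show "0 < h * e n0" using h e[OF n0(1)] by simp
    fix n :: nat assume n: "n > 0"
    have nn: "n * n0 > 0" using n n0 by simp
    have "c [^]\<^bsub>G\<^esub> (int (h * e n0) * j) \<in> N (n * n0) \<longleftrightarrow> int n dvd j" for j :: int
    proof -
      have "c [^]\<^bsub>G\<^esub> (int (h * e n0) * j) = d [^]\<^bsub>G\<^esub> (int (e n0) * j)" by (simp add: mult.assoc flip: dp)
      then have "c [^]\<^bsub>G\<^esub> (int (h * e n0) * j) \<in> N (n * n0) \<longleftrightarrow> int (e n0) * int n dvd int (e n0) * j"
        using e_iff[OF nn] elin[OF n] by (simp add: mult.commute)
      then show ?thesis using e[OF n0(1)] by simp
    qed
    then show "\<exists>N. finite_index_normal N G \<and> (\<forall>j::int. c [^]\<^bsub>G\<^esub> (int (h * e n0) * j) \<in> N \<longleftrightarrow> int n dvd j)"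
      using fN[OF nn] by blast
  qed
qed

section \<open>Virtually cyclic subgroups and matching kernels\<close>

lemma cyclically_separableD:
  assumes "cyclically_separable G" "c \<in> carrier G" "g \<in> carrier G" "\<And>j::int. g \<noteq> c [^]\<^bsub>G\<^esub> j"
  shows "\<exists>N. finite_index_normal N G \<and> (\<forall>j::int. g \<otimes>\<^bsub>G\<^esub> inv\<^bsub>G\<^esub> (c [^]\<^bsub>G\<^esub> j) \<notin> N)"
  using assms unfolding cyclically_separable_def by simp

lemma cyclic_group_int_pow:
  assumes C: "subgroup C G" and G: "group G" and cyc: "cyclic_group (G\<lparr>carrier := C\<rparr>)"
  obtains c where "c \<in> C" "C = range (\<lambda>j::int. c [^]\<^bsub>G\<^esub> j)"
proof -
  interpret group G by fact
  let ?C = "G\<lparr>carrier := C\<rparr>"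
  obtain c where c: "c \<in> carrier ?C" and e: "carrier ?C = range (\<lambda>n::int. c [^]\<^bsub>?C\<^esub> n)"
    using cyc group.cyclic_group[OF subgroup.subgroup_is_group[OF C G]] by blast
  have "C = range (\<lambda>j::int. c [^]\<^bsub>G\<^esub> j)"
    using e c int_pow_consistent[OF C] by simp
  then show ?thesis using that c by simp
qed

text \<open>The form in which virtual cyclicity is used: \<open>R\<close> is a finite union of
  translates of one cyclic group, with all powers and products taken in \<open>P\<close> rather than
  in the subgroup structure.\<close>

lemma virtually_cyclic_cosets:
  assumes R: "subgroup R P" and P: "group P" and v: "virtually_cyclic (P\<lparr>carrier := R\<rparr>)"
  obtains d T where "d \<in> R" "finite T" "T \<subseteq> R" "\<And>u. u \<in> R \<Longrightarrow> \<exists>t\<in>T. \<exists>j::int. u = d [^]\<^bsub>P\<^esub> j \<otimes>\<^bsub>P\<^esub> t"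
proof -
  interpret group P by fact
  let ?R = "P\<lparr>carrier := R\<rparr>"
  interpret R: group ?R by (rule subgroup.subgroup_is_group[OF R P])
  obtain C where C: "subgroup C ?R" "finite (rcosets\<^bsub>?R\<^esub> C)" and cyc: "cyclic_group (?R\<lparr>carrier := C\<rparr>)"
    using v unfolding virtually_cyclic_def finite_index_subgroup_def by blast
  have CP: "subgroup C P" using incl_subgroup[OF R C(1)] .
  have CR: "C \<subseteq> R" using subgroup.subset[OF C(1)] by simp
  obtain d where d: "d \<in> C" "C = range (\<lambda>j::int. d [^]\<^bsub>P\<^esub> j)"
    using cyclic_group_int_pow[OF CP P] cyc by auto
  define s where "s = (\<lambda>U. SOME t. t \<in> R \<and> U = C #>\<^bsub>?R\<^esub> t)"
  have s: "s U \<in> R \<and> U = C #>\<^bsub>?R\<^esub> s U" if "U \<in> rcosets\<^bsub>?R\<^esub> C" for U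
    unfolding s_def by (rule someI_ex) (use that in \<open>auto simp: RCOSETS_def\<close>)
  show ?thesis
  proof (rule that[of d "s ` (rcosets\<^bsub>?R\<^esub> C)"])
    show "d \<in> R" using d CR by blast
    show "finite (s ` (rcosets\<^bsub>?R\<^esub> C))" using C by simp
    show "s ` (rcosets\<^bsub>?R\<^esub> C) \<subseteq> R" using s by blast
    fix u assume u: "u \<in> R"
    then have U: "C #>\<^bsub>?R\<^esub> u \<in> rcosets\<^bsub>?R\<^esub> C" using R.rcosetsI[of C u] CR by simp
    have "u \<in> C #>\<^bsub>?R\<^esub> u" using R.rcos_self[OF _ C(1)] u by simp
    then have "u \<in> C #>\<^bsub>?R\<^esub> s (C #>\<^bsub>?R\<^esub> u)" using s[OF U] by simp
    then obtain y where "y \<in> C" "u = y \<otimes>\<^bsub>P\<^esub> s (C #>\<^bsub>?R\<^esub> u)" unfolding r_coset_def by auto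
    then show "\<exists>t\<in>s ` (rcosets\<^bsub>?R\<^esub> C). \<exists>j::int. u = d [^]\<^bsub>P\<^esub> j \<otimes>\<^bsub>P\<^esub> t"
      using U d(2) by blast
  qed
qed

text \<open>\<open>p\<close> avoids the coset of \<open>t\<close> exactly if
  \<open>p \<otimes> inv t\<close> avoids the cyclic group of \<open>d\<close>; the subgroups for
  the different \<open>t\<close> are intersected.\<close>

lemma (in group) cyclically_separable_finite_cosets:
  assumes cs: "cyclically_separable G" and d: "d \<in> carrier G" and T: "finite T" "T \<subseteq> carrier G"
    and p: "p \<in> carrier G" and pR: "\<And>t j. t \<in> T \<Longrightarrow> p \<noteq> d [^] (j::int) \<otimes> t"
  shows "\<exists>N. finite_index_normal N G \<and> (\<forall>t\<in>T. \<forall>j::int. p \<otimes> inv (d [^] j \<otimes> t) \<notin> N)"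
proof -
  have "\<exists>N. finite_index_normal N G \<and> (\<forall>j::int. p \<otimes> inv t \<otimes> inv (d [^] j) \<notin> N)" if t: "t \<in> T" for t
  proof -
    have "t \<in> carrier G" using t T by blast
    then have "p \<otimes> inv t \<noteq> d [^] j" for j :: int
      using pR[OF t, of j] p d by (metis inv_closed inv_solve_right' int_pow_closed)
    moreover have "p \<otimes> inv t \<in> carrier G" using p \<open>t \<in> carrier G\<close> by simp
    ultimately show ?thesis by (intro cyclically_separableD[OF cs d]) auto
  qed
  then obtain N where N: "\<And>t. t \<in> T \<Longrightarrow> finite_index_normal (N t) G"
    "\<And>t j. t \<in> T \<Longrightarrow> p \<otimes> inv t \<otimes> inv (d [^] (j::int)) \<notin> N t" by metis
  obtain M where M: "finite_index_normal M G" "\<forall>t\<in>T. M \<subseteq> N t"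
    using finite_index_normal_INT[OF T(1), of N] N(1) by blast
  have "p \<otimes> inv (d [^] j \<otimes> t) \<notin> M" if t: "t \<in> T" for t and j :: int
  proof -
    have tG: "t \<in> carrier G" using t T by blast
    have "p \<otimes> inv (d [^] j \<otimes> t) = p \<otimes> inv t \<otimes> inv (d [^] j)"
      using p d tG by (simp add: inv_mult_group m_assoc)
    then show ?thesis using N(2)[OF t] M(2) t by auto
  qed
  then show ?thesis using M(1) by blast
qed

text \<open>\<open>N\<close> is cut out by three conditions: \<open>N0\<close>, a subgroup
  \<open>L\<close> that forces elements of \<open>R\<close> to be powers of
  \<open>D = d [^] k\<close>, and a subgroup \<open>M\<close> that fixes the exponents of those
  powers exactly. Since some \<open>D [^] n0\<close> lies in \<open>N0\<close> and \<open>L\<close>,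
  only multiples of \<open>n0\<close> are prescribed to \<open>M\<close>, and the first two
  conditions become automatic on the resulting powers.\<close>

lemma power_filtered_subgroup_Int:
  assumes G: "group G" and pf: "power_filtered G" and R: "subgroup R G"
    and d: "d \<in> R" and T: "finite T" "T \<subseteq> R"
    and RT: "\<And>u. u \<in> R \<Longrightarrow> \<exists>t\<in>T. \<exists>j::int. u = d [^]\<^bsub>G\<^esub> j \<otimes>\<^bsub>G\<^esub> t"
    and inf: "\<And>n. n > 0 \<Longrightarrow> d [^]\<^bsub>G\<^esub> (n::nat) \<noteq> \<one>\<^bsub>G\<^esub>"
    and N0: "finite_index_normal N0 G"
  shows "\<exists>e>0. \<forall>n>0. \<exists>N. finite_index_normal N G \<and> N \<subseteq> N0 \<and>
    N \<inter> R = range (\<lambda>j::int. d [^]\<^bsub>G\<^esub> (int (e * n) * j))"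
proof -
  interpret group G by fact
  have dG: "d \<in> carrier G" and TG: "T \<subseteq> carrier G"
    using d T subgroup.subset[OF R] by auto
  obtain k where k: "k > 0" and qp: "\<And>n. n > 0 \<Longrightarrow> \<exists>N. finite_index_normal N G \<and>
    (\<forall>j::int. d [^]\<^bsub>G\<^esub> (int k * j) \<in> N \<longleftrightarrow> int n dvd j)"
    using power_filtered_quasi_potent[OF G pf dG inf] by blast
  define D where "D = d [^]\<^bsub>G\<^esub> k"
  have D: "D \<in> carrier G" unfolding D_def using dG by simp
  have Dp: "d [^]\<^bsub>G\<^esub> (int k * j) = D [^]\<^bsub>G\<^esub> j" for j :: int
    using dG int_pow_pow[of d "int k" j] by (simp add: D_def int_pow_int)
  \<comment> \<open>Representatives of \<open>R\<close> modulo the smaller cyclic group of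
    \<open>D\<close>: each old one is translated by \<open>d [^] i\<close> for the residues
    \<open>i\<close> modulo \<open>k\<close>.\<close>
  define T' where "T' = {u. \<exists>t\<in>T. \<exists>i\<in>{0..<int k}. u = d [^]\<^bsub>G\<^esub> i \<otimes>\<^bsub>G\<^esub> t}"
  have T': "finite T'" "T' \<subseteq> carrier G"
  proof -
    have "T' = (\<lambda>(t, i). d [^]\<^bsub>G\<^esub> i \<otimes>\<^bsub>G\<^esub> t) ` (T \<times> {0..<int k})" unfolding T'_def by auto
    then show "finite T'" using T by simp
    show "T' \<subseteq> carrier G" unfolding T'_def using TG dG by auto
  qed
  have RT': "\<exists>t\<in>T'. \<exists>j::int. u = D [^]\<^bsub>G\<^esub> j \<otimes>\<^bsub>G\<^esub> t" if u: "u \<in> R" for u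
  proof -
    obtain t j where t: "t \<in> T" and j: "u = d [^]\<^bsub>G\<^esub> (j::int) \<otimes>\<^bsub>G\<^esub> t" using RT[OF u] by blast
    have tG: "t \<in> carrier G" using t TG by blast
    have "d [^]\<^bsub>G\<^esub> j = d [^]\<^bsub>G\<^esub> (int k * (j div int k) + j mod int k)" by simp
    also have "\<dots> = D [^]\<^bsub>G\<^esub> (j div int k) \<otimes>\<^bsub>G\<^esub> d [^]\<^bsub>G\<^esub> (j mod int k)"
      using dG by (simp only: int_pow_mult Dp)
    finally have "u = D [^]\<^bsub>G\<^esub> (j div int k) \<otimes>\<^bsub>G\<^esub> (d [^]\<^bsub>G\<^esub> (j mod int k) \<otimes>\<^bsub>G\<^esub> t)"
      unfolding j using D dG tG by (simp add: m_assoc)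
    moreover have "j mod int k \<in> {0..<int k}" using k by simp
    then have "d [^]\<^bsub>G\<^esub> (j mod int k) \<otimes>\<^bsub>G\<^esub> t \<in> T'" unfolding T'_def using t by blast
    ultimately show ?thesis by blast
  qed
  define F where "F = {t \<in> T'. \<forall>j::int. t \<noteq> D [^]\<^bsub>G\<^esub> j}"
  have "\<exists>K. finite_index_normal K G \<and> (\<forall>j::int. t \<otimes>\<^bsub>G\<^esub> inv\<^bsub>G\<^esub> (D [^]\<^bsub>G\<^esub> j) \<notin> K)" if t: "t \<in> F" for t
  proof -
    have "t \<in> carrier G" "\<forall>j::int. t \<noteq> D [^]\<^bsub>G\<^esub> j" using t T' unfolding F_def by auto
    then show ?thesis
      by (intro cyclically_separableD[OF power_filtered_cyclically_separable[OF G pf] D]) auto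
  qed
  then obtain K where K: "\<And>t. t \<in> F \<Longrightarrow> finite_index_normal (K t) G"
    "\<And>t j. t \<in> F \<Longrightarrow> t \<otimes>\<^bsub>G\<^esub> inv\<^bsub>G\<^esub> (D [^]\<^bsub>G\<^esub> (j::int)) \<notin> K t" by metis
  have "finite F" using T' unfolding F_def by simp
  from finite_index_normal_INT[OF this, of K] obtain L where L: "finite_index_normal L G" "\<forall>t\<in>F. L \<subseteq> K t"
    using K(1) by blast
  \<comment> \<open>Conjugation turns \<open>D [^] j \<otimes> t\<close> into
    \<open>t \<otimes> D [^] j\<close>, which \<open>L\<close> excludes unless the representative
    \<open>t\<close> is itself a power of \<open>D\<close>.\<close>
  have LR: "\<exists>j::int. u = D [^]\<^bsub>G\<^esub> j" if u: "u \<in> L" "u \<in> R" for u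
  proof (rule ccontr)
    assume no: "\<nexists>j::int. u = D [^]\<^bsub>G\<^esub> j"
    obtain t j where t: "t \<in> T'" and j: "u = D [^]\<^bsub>G\<^esub> (j::int) \<otimes>\<^bsub>G\<^esub> t" using RT'[OF u(2)] by blast
    have tG: "t \<in> carrier G" using t T' by blast
    have "t \<in> F"
    proof (rule ccontr)
      assume "t \<notin> F"
      then obtain i :: int where "t = D [^]\<^bsub>G\<^esub> i" using t unfolding F_def by blast
      then have "u = D [^]\<^bsub>G\<^esub> (j + i)" unfolding j using D by (simp add: int_pow_mult)
      then show False using no by blast
    qed
    have "inv\<^bsub>G\<^esub> (D [^]\<^bsub>G\<^esub> j) \<otimes>\<^bsub>G\<^esub> u \<otimes>\<^bsub>G\<^esub> D [^]\<^bsub>G\<^esub> j \<in> L"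
      using normal.inv_op_closed1[OF finite_index_normalD(1)[OF L(1)]] D u(1) by simp
    also have "inv\<^bsub>G\<^esub> (D [^]\<^bsub>G\<^esub> j) \<otimes>\<^bsub>G\<^esub> u \<otimes>\<^bsub>G\<^esub> D [^]\<^bsub>G\<^esub> j = t \<otimes>\<^bsub>G\<^esub> inv\<^bsub>G\<^esub> (D [^]\<^bsub>G\<^esub> (- j))"
      unfolding j using D tG by (simp add: m_assoc int_pow_neg)
    finally show False using K(2)[OF \<open>t \<in> F\<close>] L(2) \<open>t \<in> F\<close> by blast
  qed
  have N0L: "finite_index_normal (N0 \<inter> L) G" by (rule finite_index_normal_Int[OF N0 L(1)])
  obtain n0 where n0: "n0 > 0" "D [^]\<^bsub>G\<^esub> (n0::nat) \<in> N0 \<inter> L"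
    using finite_index_normal_pow[OF N0L D] by blast
  show ?thesis
  proof (intro exI[of _ "k * n0"] conjI allI impI)
    show "0 < k * n0" using k n0 by simp
    fix n :: nat assume n: "n > 0"
    obtain M where M: "finite_index_normal M G" "\<And>j::int. d [^]\<^bsub>G\<^esub> (int k * j) \<in> M \<longleftrightarrow> int (n0 * n) dvd j"
      using qp[of "n0 * n"] n n0 by auto
    let ?N = "N0 \<inter> L \<inter> M"
    have "?N \<inter> R = range (\<lambda>j::int. d [^]\<^bsub>G\<^esub> (int (k * n0 * n) * j))"
    proof (intro equalityI subsetI)
      fix u assume u: "u \<in> ?N \<inter> R"
      then obtain j :: int where j: "u = d [^]\<^bsub>G\<^esub> (int k * j)" using LR Dp by auto
      then have "int (n0 * n) dvd j" using M(2) u by blast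
      then obtain q where "j = int (n0 * n) * q" by blast
      then have "u = d [^]\<^bsub>G\<^esub> (int (k * n0 * n) * q)" unfolding j by (simp add: mult.assoc)
      then show "u \<in> range (\<lambda>j::int. d [^]\<^bsub>G\<^esub> (int (k * n0 * n) * j))" by blast
    next
      fix u assume "u \<in> range (\<lambda>j::int. d [^]\<^bsub>G\<^esub> (int (k * n0 * n) * j))"
      then obtain j :: int where "u = d [^]\<^bsub>G\<^esub> (int (k * n0 * n) * j)" by blast
      then have u: "u = d [^]\<^bsub>G\<^esub> (int k * (int (n0 * n) * j))" by (simp add: mult.assoc)
      then have "u \<in> M" using M(2) by simp
      have "u = (D [^]\<^bsub>G\<^esub> n0) [^]\<^bsub>G\<^esub> (int n * j)"
        unfolding u Dp using D int_pow_pow[of D "int n0" "int n * j"] by (simp add: int_pow_int mult.assoc)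
      then have "u \<in> N0 \<inter> L"
        using subgroup_int_pow_closed[OF finite_index_normalD(2)[OF N0L] n0(2)] by simp
      moreover have "u \<in> R" unfolding u by (rule subgroup_int_pow_closed[OF R d])
      ultimately show "u \<in> ?N \<inter> R" using \<open>u \<in> M\<close> by blast
    qed
    then show "\<exists>N. finite_index_normal N G \<and> N \<subseteq> N0 \<and> N \<inter> R = range (\<lambda>j::int. d [^]\<^bsub>G\<^esub> (int (k * n0 * n) * j))"
      using finite_index_normal_Int[OF N0L M(1)] by blast
  qed
qed

text \<open>If \<open>R\<close> is finite, both intersections are made trivial. Otherwise each side
  can prescribe any multiple of its own constant, \<open>e1\<close> or \<open>e2\<close>, as the
  exponent of the intersection; \<open>n = e2\<close> on one side and \<open>n = e1\<close> on the
  other yield the common exponent \<open>e1 * e2\<close>.\<close>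

lemma compatible_finite_index_normal:
  assumes P: "group P" and pfP: "power_filtered P" and Q: "group Q" and pfQ: "power_filtered Q"
    and R: "subgroup R P" and vR: "virtually_cyclic (P\<lparr>carrier := R\<rparr>)" and S: "subgroup S Q"
    and \<phi>: "\<phi> \<in> iso (P\<lparr>carrier := R\<rparr>) (Q\<lparr>carrier := S\<rparr>)"
    and N0: "finite_index_normal N0 P" and M0: "finite_index_normal M0 Q"
  shows "\<exists>N M. finite_index_normal N P \<and> N \<subseteq> N0 \<and> finite_index_normal M Q \<and> M \<subseteq> M0 \<and> \<phi> ` (N \<inter> R) = M \<inter> S"
proof -
  interpret P: group P by fact
  interpret Q: group Q by fact
  let ?R = "P\<lparr>carrier := R\<rparr>" and ?S = "Q\<lparr>carrier := S\<rparr>"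
  interpret R: group ?R by (rule subgroup.subgroup_is_group[OF R P])
  interpret S: group ?S by (rule subgroup.subgroup_is_group[OF S Q])
  interpret \<phi>: group_hom ?R ?S \<phi> using \<phi> by unfold_locales (simp add: iso_def)
  have bij: "bij_betw \<phi> R S" using \<phi> by (simp add: iso_def)
  have \<phi>pow: "\<phi> (d [^]\<^bsub>P\<^esub> j) = \<phi> d [^]\<^bsub>Q\<^esub> j" if "d \<in> R" for d and j :: int
    using \<phi>.hom_int_pow[of d j] that P.int_pow_consistent[OF R that, of j]
      Q.int_pow_consistent[OF S, of "\<phi> d" j] \<phi>.hom_closed[of d] by simp
  have \<phi>S: "\<phi> u \<in> S" if "u \<in> R" for u using \<phi>.hom_closed[of u] that by simp
  obtain d T where d: "d \<in> R" and T: "finite T" "T \<subseteq> R"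
    and RT: "\<And>u. u \<in> R \<Longrightarrow> \<exists>t\<in>T. \<exists>j::int. u = d [^]\<^bsub>P\<^esub> j \<otimes>\<^bsub>P\<^esub> t"
    using virtually_cyclic_cosets[OF R P vR] by metis
  have dP: "d \<in> carrier P" using d subgroup.subset[OF R] by blast
  have ST: "\<exists>t\<in>\<phi> ` T. \<exists>j::int. u = \<phi> d [^]\<^bsub>Q\<^esub> j \<otimes>\<^bsub>Q\<^esub> t" if u: "u \<in> S" for u
  proof -
    obtain v where v: "v \<in> R" "u = \<phi> v" using u bij unfolding bij_betw_def by blast
    obtain t j where t: "t \<in> T" and j: "v = d [^]\<^bsub>P\<^esub> (j::int) \<otimes>\<^bsub>P\<^esub> t" using RT[OF v(1)] by blast
    have "\<phi> v = \<phi> (d [^]\<^bsub>P\<^esub> j) \<otimes>\<^bsub>Q\<^esub> \<phi> t"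
      unfolding j using \<phi>.hom_mult[of "d [^]\<^bsub>P\<^esub> j" t] P.subgroup_int_pow_closed[OF R d] t T by auto
    then show ?thesis using v \<phi>pow[OF d] t by auto
  qed
  show ?thesis
  proof (cases "\<exists>n>0. d [^]\<^bsub>P\<^esub> (n::nat) = \<one>\<^bsub>P\<^esub>")
    case True
    then obtain n where n: "n > 0" "d [^]\<^bsub>P\<^esub> (n::nat) = \<one>\<^bsub>P\<^esub>" by blast
    have "R \<subseteq> (\<lambda>(i, t). d [^]\<^bsub>P\<^esub> i \<otimes>\<^bsub>P\<^esub> t) ` ({0..<int n} \<times> T)"
    proof
      fix u assume "u \<in> R"
      then obtain t j where t: "t \<in> T" and j: "u = d [^]\<^bsub>P\<^esub> (j::int) \<otimes>\<^bsub>P\<^esub> t" using RT by blast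
      have "u = d [^]\<^bsub>P\<^esub> (j mod int n) \<otimes>\<^bsub>P\<^esub> t" using j P.int_pow_eq_mod[OF dP n(2), of j] by simp
      moreover have "j mod int n \<in> {0..<int n}" using n by simp
      ultimately show "u \<in> (\<lambda>(i, t). d [^]\<^bsub>P\<^esub> i \<otimes>\<^bsub>P\<^esub> t) ` ({0..<int n} \<times> T)" using t by force
    qed
    then have fR: "finite R" by (rule finite_subset) (simp add: T)
    then have fS: "finite S" using bij bij_betw_finite by blast
    obtain N where N: "finite_index_normal N P" "N \<inter> (R - {\<one>\<^bsub>P\<^esub>}) = {}"
      using P.residually_finite_finite[OF power_filtered_residually_finite[OF pfP], of "R - {\<one>\<^bsub>P\<^esub>}"] fR
        subgroup.subset[OF R] by blast
    obtain M where M: "finite_index_normal M Q" "M \<inter> (S - {\<one>\<^bsub>Q\<^esub>}) = {}"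
      using Q.residually_finite_finite[OF power_filtered_residually_finite[OF pfQ], of "S - {\<one>\<^bsub>Q\<^esub>}"] fS
        subgroup.subset[OF S] by blast
    have "N \<inter> N0 \<inter> R = {\<one>\<^bsub>P\<^esub>}"
      using N(2) subgroup.one_closed[OF R] subgroup.one_closed[OF finite_index_normalD(2)[OF N(1)]]
        subgroup.one_closed[OF finite_index_normalD(2)[OF N0]] by blast
    moreover have "M \<inter> M0 \<inter> S = {\<one>\<^bsub>Q\<^esub>}"
      using M(2) subgroup.one_closed[OF S] subgroup.one_closed[OF finite_index_normalD(2)[OF M(1)]]
        subgroup.one_closed[OF finite_index_normalD(2)[OF M0]] by blast
    moreover have "\<phi> \<one>\<^bsub>P\<^esub> = \<one>\<^bsub>Q\<^esub>" using \<phi>.hom_one by simp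
    ultimately have "\<phi> ` (N \<inter> N0 \<inter> R) = M \<inter> M0 \<inter> S" by simp
    then show ?thesis
      using P.finite_index_normal_Int[OF N(1) N0] Q.finite_index_normal_Int[OF M(1) M0] by blast
  next
    case False
    then have inf: "\<And>n. n > 0 \<Longrightarrow> d [^]\<^bsub>P\<^esub> (n::nat) \<noteq> \<one>\<^bsub>P\<^esub>" by blast
    have inf': "\<phi> d [^]\<^bsub>Q\<^esub> n \<noteq> \<one>\<^bsub>Q\<^esub>" if n: "n > 0" for n :: nat
    proof
      assume "\<phi> d [^]\<^bsub>Q\<^esub> n = \<one>\<^bsub>Q\<^esub>"
      then have "\<phi> (d [^]\<^bsub>P\<^esub> n) = \<phi> \<one>\<^bsub>P\<^esub>" using \<phi>pow[OF d, of "int n"] \<phi>.hom_one by (simp add: int_pow_int)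
      then have "d [^]\<^bsub>P\<^esub> n = \<one>\<^bsub>P\<^esub>"
        using bij P.subgroup_nat_pow_closed[OF R d] subgroup.one_closed[OF R] unfolding bij_betw_def inj_on_def by blast
      then show False using inf n by blast
    qed
    obtain e1 where e1: "e1 > 0" "\<And>n. n > 0 \<Longrightarrow> \<exists>N. finite_index_normal N P \<and> N \<subseteq> N0 \<and>
      N \<inter> R = range (\<lambda>j::int. d [^]\<^bsub>P\<^esub> (int (e1 * n) * j))"
      using power_filtered_subgroup_Int[OF P pfP R d T RT inf N0] by blast
    have T': "finite (\<phi> ` T)" "\<phi> ` T \<subseteq> S" using T \<phi>S by auto
    obtain e2 where e2: "e2 > 0" "\<And>n. n > 0 \<Longrightarrow> \<exists>N. finite_index_normal N Q \<and> N \<subseteq> M0 \<and>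
      N \<inter> S = range (\<lambda>j::int. \<phi> d [^]\<^bsub>Q\<^esub> (int (e2 * n) * j))"
      using power_filtered_subgroup_Int[OF Q pfQ S \<phi>S[OF d] T' ST inf' M0] by blast
    obtain N where N: "finite_index_normal N P" "N \<subseteq> N0" "N \<inter> R = range (\<lambda>j::int. d [^]\<^bsub>P\<^esub> (int (e1 * e2) * j))"
      using e1(2)[OF e2(1)] by blast
    obtain M where M: "finite_index_normal M Q" "M \<subseteq> M0" "M \<inter> S = range (\<lambda>j::int. \<phi> d [^]\<^bsub>Q\<^esub> (int (e2 * e1) * j))"
      using e2(2)[OF e1(1)] by blast
    have "\<phi> ` (N \<inter> R) = M \<inter> S" unfolding N(3) M(3) image_image \<phi>pow[OF d] by (simp add: mult.commute)
    then show ?thesis using N M by blast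
  qed
qed

section \<open>Presentations by generators and relations\<close>

definition word_eval :: "('k, 'm) monoid_scheme \<Rightarrow> ('x \<Rightarrow> 'k) \<Rightarrow> 'x list \<Rightarrow> 'k"
  where "word_eval K h w = foldr (\<lambda>l x. h l \<otimes>\<^bsub>K\<^esub> x) w \<one>\<^bsub>K\<^esub>"

lemma word_eval_simps [simp]:
  "word_eval K h [] = \<one>\<^bsub>K\<^esub>"
  "word_eval K h (l # w) = h l \<otimes>\<^bsub>K\<^esub> word_eval K h w"
  by (simp_all add: word_eval_def)

lemma (in monoid) word_eval_closed: "h \<in> L \<rightarrow> carrier G \<Longrightarrow> w \<in> lists L \<Longrightarrow> word_eval G h w \<in> carrier G"
  by (induction w) auto

lemma (in monoid) word_eval_append:
  "\<lbrakk>h \<in> L \<rightarrow> carrier G; u \<in> lists L; v \<in> lists L\<rbrakk> \<Longrightarrow>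
    word_eval G h (u @ v) = word_eval G h u \<otimes> word_eval G h v"
  by (induction u) (auto simp: m_assoc word_eval_closed Pi_iff)

lemma hom_word_eval:
  assumes "group G" "group K" "f \<in> hom G K" "h \<in> L \<rightarrow> carrier G" "w \<in> lists L"
  shows "f (word_eval G h w) = word_eval K (\<lambda>l. f (h l)) w"
proof -
  interpret G: group G by fact
  interpret f: group_hom G K f using assms by (simp add: group_hom_def group_hom_axioms_def)
  show ?thesis using assms(5)
    by (induction w) (use assms(4) G.word_eval_closed[OF assms(4)] in \<open>auto simp: Pi_iff\<close>)
qed

subsection \<open>Groups presented by words\<close>

context
  fixes L :: "'x set" and Rel :: "('x list \<times> 'x list) set"
  assumes Rel: "Rel \<subseteq> lists L \<times> lists L"
begin

lemma word_cong_lists: "word_cong L Rel u v \<Longrightarrow> u \<in> lists L \<and> v \<in> lists L"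
  by (induction rule: word_cong.induct) (use Rel in \<open>auto\<close>)

lemma word_cong_append_left: "word_cong L Rel u v \<Longrightarrow> w \<in> lists L \<Longrightarrow> word_cong L Rel (w @ u) (w @ v)"
proof (induction rule: word_cong.induct)
  case (rel u v p s)
  then show ?case using word_cong.rel[of u v Rel "w @ p" L s] by simp
next
  case (refl u)
  then show ?case by (intro word_cong.refl) simp
qed (blast intro: word_cong.sym, blast intro: word_cong.trans)

lemma word_cong_append_right: "word_cong L Rel u v \<Longrightarrow> w \<in> lists L \<Longrightarrow> word_cong L Rel (u @ w) (v @ w)"
proof (induction rule: word_cong.induct)
  case (rel u v p s)
  then show ?case using word_cong.rel[of u v Rel p L "s @ w"] by simp
next
  case (refl u)
  then show ?case by (intro word_cong.refl) simp
qed (blast intro: word_cong.sym, blast intro: word_cong.trans)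

lemma word_cong_append:
  assumes "word_cong L Rel u u'" "word_cong L Rel v v'"
  shows "word_cong L Rel (u @ v) (u' @ v')"
  by (rule word_cong.trans[OF word_cong_append_right[OF assms(1)] word_cong_append_left[OF assms(2)]])
    (simp_all only: word_cong_lists[OF assms(1)] word_cong_lists[OF assms(2)])

lemma word_class_eqI: "word_cong L Rel u v \<Longrightarrow> word_class L Rel u = word_class L Rel v"
  unfolding word_class_def
  by (intro Collect_cong iffI) (erule word_cong.trans[OF word_cong.sym], assumption, erule word_cong.trans, assumption)

lemma word_class_self: "u \<in> lists L \<Longrightarrow> u \<in> word_class L Rel u"
  unfolding word_class_def by (simp add: word_cong.refl)

lemma word_monoid_mult:
  assumes "u \<in> lists L" "v \<in> lists L"
  shows "word_class L Rel u \<otimes>\<^bsub>word_monoid L Rel\<^esub> word_class L Rel v = word_class L Rel (u @ v)"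
proof -
  have "word_class L Rel (a @ b) = word_class L Rel (u @ v)"
    if "a \<in> word_class L Rel u" "b \<in> word_class L Rel v" for a b
  proof -
    have "word_cong L Rel u a" "word_cong L Rel v b" using that by (simp_all add: word_class_def)
    from word_class_eqI[OF word_cong_append[OF this]] show ?thesis by simp
  qed
  then have "(\<Union>a\<in>word_class L Rel u. \<Union>b\<in>word_class L Rel v. word_class L Rel (a @ b)) =
      (\<Union>a\<in>word_class L Rel u. \<Union>b\<in>word_class L Rel v. word_class L Rel (u @ v))"
    by (intro SUP_cong HOL.refl)
  also have "\<dots> = word_class L Rel (u @ v)"
    using word_class_self[OF assms(1)] word_class_self[OF assms(2)] by blast
  finally show ?thesis unfolding word_monoid_def by simp
qed

lemma word_monoid_carrier: "carrier (word_monoid L Rel) = word_class L Rel ` lists L"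
  and word_monoid_one: "\<one>\<^bsub>word_monoid L Rel\<^esub> = word_class L Rel []"
  by (simp_all add: word_monoid_def)

lemma word_monoid_rel: "(u, v) \<in> Rel \<Longrightarrow> word_class L Rel u = word_class L Rel v"
  using word_cong.rel[of u v Rel "[]" L "[]"] word_class_eqI[of u v] by simp

text \<open>Left inverses of single letters suffice: taken letter by letter in reverse order they
  give left inverses of all words.\<close>

lemma word_monoid_group:
  assumes inv: "\<And>l. l \<in> L \<Longrightarrow> \<exists>l'\<in>L. word_cong L Rel [l', l] []"
  shows "group (word_monoid L Rel)"
proof (rule groupI)
  let ?M = "word_monoid L Rel"
  show "\<one>\<^bsub>?M\<^esub> \<in> carrier ?M" by (auto simp: word_monoid_carrier word_monoid_one)
  fix x assume "x \<in> carrier ?M"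
  then obtain u where u: "u \<in> lists L" "x = word_class L Rel u" by (auto simp: word_monoid_carrier)
  show "\<one>\<^bsub>?M\<^esub> \<otimes>\<^bsub>?M\<^esub> x = x" using word_monoid_mult[of "[]" u] u by (simp add: word_monoid_one)
  have "\<exists>v\<in>lists L. word_cong L Rel (v @ u) []" using u(1)
  proof (induction u)
    case Nil
    then show ?case by (intro bexI[of _ "[]"]) (auto intro: word_cong.refl)
  next
    case (Cons l u)
    then obtain v where v: "v \<in> lists L" "word_cong L Rel (v @ u) []" by auto
    obtain l' where l': "l' \<in> L" "word_cong L Rel [l', l] []" using inv Cons.hyps(1) by blast
    have "word_cong L Rel (v @ [l', l] @ u) (v @ [] @ u)"
      using v Cons l' by (intro word_cong_append_left word_cong_append_right) auto
    then have "word_cong L Rel ((v @ [l']) @ l # u) []" using word_cong.trans[OF _ v(2)] by simp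
    then show ?case using v(1) l'(1) by (intro bexI[of _ "v @ [l']"]) auto
  qed
  then obtain v where v: "v \<in> lists L" "word_cong L Rel (v @ u) []" by blast
  then have "word_class L Rel v \<otimes>\<^bsub>?M\<^esub> x = \<one>\<^bsub>?M\<^esub>"
    using u word_monoid_mult word_class_eqI by (simp add: word_monoid_one)
  then show "\<exists>y\<in>carrier ?M. y \<otimes>\<^bsub>?M\<^esub> x = \<one>\<^bsub>?M\<^esub>" using v(1) by (auto simp: word_monoid_carrier)
  fix y assume "y \<in> carrier ?M"
  then obtain w where w: "w \<in> lists L" "y = word_class L Rel w" by (auto simp: word_monoid_carrier)
  show "x \<otimes>\<^bsub>?M\<^esub> y \<in> carrier ?M" using u w word_monoid_mult by (auto simp: word_monoid_carrier)
  fix z assume "z \<in> carrier ?M"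
  then obtain t where "t \<in> lists L" "z = word_class L Rel t" by (auto simp: word_monoid_carrier)
  then show "x \<otimes>\<^bsub>?M\<^esub> y \<otimes>\<^bsub>?M\<^esub> z = x \<otimes>\<^bsub>?M\<^esub> (y \<otimes>\<^bsub>?M\<^esub> z)"
    using u w by (simp add: word_monoid_mult)
qed

lemma word_monoid_generated:
  "w \<in> lists L \<Longrightarrow> word_class L Rel w = word_eval (word_monoid L Rel) (\<lambda>l. word_class L Rel [l]) w"
proof (induction w)
  case (Cons l w)
  then show ?case using word_monoid_mult[of "[l]" w] by auto
qed (simp add: word_monoid_one)

text \<open>Von Dyck's principle: evaluation in \<open>K\<close> respects each generating relation,
  hence the whole congruence, and so may be computed on an arbitrary member of a class.\<close>

lemma word_monoid_universal:
  assumes K: "group K" and h: "h \<in> L \<rightarrow> carrier K"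
    and rel: "\<And>u v. (u, v) \<in> Rel \<Longrightarrow> word_eval K h u = word_eval K h v"
  obtains f where "f \<in> hom (word_monoid L Rel) K"
    "\<And>w. w \<in> lists L \<Longrightarrow> f (word_class L Rel w) = word_eval K h w"
proof -
  interpret K: group K by fact
  have e: "word_eval K h u = word_eval K h v" if "word_cong L Rel u v" for u v
    using that
  proof (induction rule: word_cong.induct)
    case (rel u v p s)
    then have "u \<in> lists L" "v \<in> lists L" using Rel by auto
    then show ?case using rel assms(3)[of u v] by (simp add: K.word_eval_append[OF h])
  qed auto
  define f where "f = (\<lambda>U. word_eval K h (SOME w. w \<in> U))"
  have f: "f (word_class L Rel w) = word_eval K h w" if "w \<in> lists L" for w
  proof -
    have "(SOME v. v \<in> word_class L Rel w) \<in> word_class L Rel w"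
      using word_class_self[OF that] by (rule someI)
    then have "word_cong L Rel w (SOME v. v \<in> word_class L Rel w)" unfolding word_class_def by simp
    then show ?thesis unfolding f_def using e by metis
  qed
  have "f \<in> hom (word_monoid L Rel) K"
  proof (rule homI)
    fix x assume "x \<in> carrier (word_monoid L Rel)"
    then obtain u where u: "u \<in> lists L" "x = word_class L Rel u" by (auto simp: word_monoid_carrier)
    then show "f x \<in> carrier K" using f K.word_eval_closed[OF h] by simp
    fix y assume "y \<in> carrier (word_monoid L Rel)"
    then obtain v where v: "v \<in> lists L" "y = word_class L Rel v" by (auto simp: word_monoid_carrier)
    then show "f (x \<otimes>\<^bsub>word_monoid L Rel\<^esub> y) = f x \<otimes>\<^bsub>K\<^esub> f y"
      using u f word_monoid_mult K.word_eval_append[OF h] by simp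
  qed
  then show ?thesis using that f by blast
qed

end

lemma (in group) normal_closure:
  assumes T: "T \<subseteq> carrier G"
  shows "normal_closure G T \<lhd> G" "T \<subseteq> normal_closure G T"
proof -
  let ?A = "{N. N \<lhd> G \<and> T \<subseteq> N}"
  have ne: "carrier G \<in> ?A" using finite_index_normalD(1)[OF finite_index_normal_carrier] T by simp
  have "subgroup (\<Inter>?A) G"
    by (rule subgroups_Inter) (use ne normal_imp_subgroup in auto)
  moreover have "x \<otimes> h \<otimes> inv x \<in> \<Inter>?A" if "x \<in> carrier G" "h \<in> \<Inter>?A" for x h
    using that normal.inv_op_closed2 by fastforce
  ultimately show "normal_closure G T \<lhd> G" unfolding normal_closure_def by (simp add: normal_inv_iff)
  show "T \<subseteq> normal_closure G T" unfolding normal_closure_def by blast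
qed

text \<open>The kernel of \<open>f\<close> is one of the normal subgroups whose intersection is the
  closure.\<close>

lemma normal_closure_universal:
  assumes G: "group G" and K: "group K" and f: "f \<in> hom G K" and T: "T \<subseteq> carrier G"
    and fT: "\<And>t. t \<in> T \<Longrightarrow> f t = \<one>\<^bsub>K\<^esub>"
  obtains g where "g \<in> hom (G Mod normal_closure G T) K"
    "\<And>x. x \<in> carrier G \<Longrightarrow> g (normal_closure G T #>\<^bsub>G\<^esub> x) = f x"
proof -
  interpret G: group G by fact
  interpret f: group_hom G K f using assms by (simp add: group_hom_def group_hom_axioms_def)
  let ?N = "normal_closure G T"
  have N: "?N \<lhd> G" by (rule G.normal_closure(1)[OF T])
  have "T \<subseteq> kernel G K f" using T fT by (auto simp: kernel_def)
  then have "?N \<subseteq> kernel G K f" unfolding normal_closure_def using f.normal_kernel by blast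
  then have "f x = f y" if "x \<in> carrier G" "y \<in> carrier G" "?N #>\<^bsub>G\<^esub> x = ?N #>\<^bsub>G\<^esub> y" for x y
  proof -
    have "x \<otimes>\<^bsub>G\<^esub> inv\<^bsub>G\<^esub> y \<in> ?N" using G.r_coset_eq_iff[OF normal_imp_subgroup[OF N]] that by blast
    then have "f (x \<otimes>\<^bsub>G\<^esub> inv\<^bsub>G\<^esub> y) = \<one>\<^bsub>K\<^esub>" using \<open>?N \<subseteq> kernel G K f\<close> by (auto simp: kernel_def)
    then show ?thesis using that f.H.mult_inv_eq_one_iff[of "f x" "f y"] by simp
  qed
  then show ?thesis using FactGroup_universal[OF f N] that by metis
qed

lemma FactGroup_generated:
  assumes G: "group G" and N: "N \<lhd> G" and h: "h \<in> L \<rightarrow> carrier G" and w: "w \<in> lists L"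
  shows "N #>\<^bsub>G\<^esub> word_eval G h w = word_eval (G Mod N) (\<lambda>l. N #>\<^bsub>G\<^esub> h l) w"
  by (rule hom_word_eval[OF G normal.factorgroup_is_group[OF N] normal.r_coset_hom_Mod[OF N] h w])

subsection \<open>Graph products\<close>

text \<open>The canonical image of a letter. The normal closure is written out as in
  \<open>graph_product\<close>, so that both unfold to the same quotient.\<close>

definition graph_product_incl ::
    "'v set \<Rightarrow> ('v \<times> 'v) set \<Rightarrow> ('v \<Rightarrow> ('g, 'm) monoid_scheme) \<Rightarrow> 'v \<times> 'g \<Rightarrow> ('v \<times> 'g) list set set"
  where "graph_product_incl V E G l =
    (let F = free_product V G; \<iota> = free_product_incl V G
     in normal_closure F
          {\<iota> u g \<otimes>\<^bsub>F\<^esub> \<iota> v h \<otimes>\<^bsub>F\<^esub> inv\<^bsub>F\<^esub> (\<iota> u g) \<otimes>\<^bsub>F\<^esub> inv\<^bsub>F\<^esub> (\<iota> v h) | u v g h.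
             (u, v) \<in> E \<and> g \<in> carrier (G u) \<and> h \<in> carrier (G v)}
        #>\<^bsub>F\<^esub> \<iota> (fst l) (snd l))"

locale graph_of_groups =
  fixes V :: "'v set" and E :: "('v \<times> 'v) set" and G :: "'v \<Rightarrow> ('g, 'm) monoid_scheme"
  assumes EV: "E \<subseteq> V \<times> V" and groups: "\<And>v. v \<in> V \<Longrightarrow> group (G v)"
begin

abbreviation "letters \<equiv> free_product_letters V G"
abbreviation "rels \<equiv> free_product_rels V G"
abbreviation "F \<equiv> free_product V G"
abbreviation "\<iota> \<equiv> free_product_incl V G"
abbreviation "\<Gamma> \<equiv> graph_product V E G"
abbreviation "j \<equiv> graph_product_incl V E G"

definition "T = {\<iota> u g \<otimes>\<^bsub>F\<^esub> \<iota> v h \<otimes>\<^bsub>F\<^esub> inv\<^bsub>F\<^esub> (\<iota> u g) \<otimes>\<^bsub>F\<^esub> inv\<^bsub>F\<^esub> (\<iota> v h) | u v g h.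
             (u, v) \<in> E \<and> g \<in> carrier (G u) \<and> h \<in> carrier (G v)}"

lemma \<Gamma>_eq: "\<Gamma> = F Mod normal_closure F T"
  and j_eq: "j l = normal_closure F T #>\<^bsub>F\<^esub> \<iota> (fst l) (snd l)"
  unfolding T_def graph_product_def graph_product_incl_def by (simp_all add: Let_def)

lemma rels: "rels \<subseteq> lists letters \<times> lists letters"
  using groups by (auto simp: free_product_rels_def free_product_letters_def group.is_monoid monoid.m_closed monoid.one_closed)

lemma F_group: "group F"
  unfolding free_product_def
proof (rule word_monoid_group[OF rels])
  fix l assume "l \<in> letters"
  then obtain v x where l: "l = (v, x)" "v \<in> V" "x \<in> carrier (G v)" by (auto simp: free_product_letters_def)
  interpret Gv: group "G v" by (rule groups) fact
  let ?l' = "(v, inv\<^bsub>G v\<^esub> x)"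
  have "word_cong letters rels ([] @ [?l', l] @ []) ([] @ [(v, inv\<^bsub>G v\<^esub> x \<otimes>\<^bsub>G v\<^esub> x)] @ [])"
    by (rule word_cong.rel) (use l in \<open>auto simp: free_product_rels_def\<close>)
  moreover have "word_cong letters rels ([] @ [(v, \<one>\<^bsub>G v\<^esub>)] @ []) ([] @ [] @ [])"
    by (rule word_cong.rel) (use l in \<open>auto simp: free_product_rels_def\<close>)
  ultimately have "word_cong letters rels [?l', l] []" using l word_cong.trans[of letters rels "[?l', l]" "[(v, \<one>\<^bsub>G v\<^esub>)]" "[]"] by simp
  moreover have "?l' \<in> letters" using l by (simp add: free_product_letters_def)
  ultimately show "\<exists>l'\<in>letters. word_cong letters rels [l', l] []" by blast
qed

sublocale F: group F by (rule F_group)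

lemma \<iota>: "v \<in> V \<Longrightarrow> \<iota> v \<in> hom (G v) F"
proof (rule homI)
  assume v: "v \<in> V"
  fix x assume x: "x \<in> carrier (G v)"
  show "\<iota> v x \<in> carrier F" using x v
    unfolding free_product_def free_product_incl_def word_monoid_carrier[OF rels]
    by (intro imageI) (simp add: free_product_letters_def)
  fix y assume y: "y \<in> carrier (G v)"
  have "([(v, x), (v, y)], [(v, x \<otimes>\<^bsub>G v\<^esub> y)]) \<in> rels"
    using x y v by (auto simp: free_product_rels_def)
  from word_monoid_rel[OF rels this] show "\<iota> v (x \<otimes>\<^bsub>G v\<^esub> y) = \<iota> v x \<otimes>\<^bsub>F\<^esub> \<iota> v y"
    using word_monoid_mult[OF rels, of "[(v, x)]" "[(v, y)]"] x y v
    by (simp add: free_product_def free_product_incl_def free_product_letters_def)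
qed

lemma \<iota>_closed: "v \<in> V \<Longrightarrow> x \<in> carrier (G v) \<Longrightarrow> \<iota> v x \<in> carrier F"
  using \<iota> by (auto simp: hom_def)

lemma T: "T \<subseteq> carrier F"
  unfolding T_def using EV \<iota>_closed by (auto intro!: F.m_closed F.inv_closed)

lemmas normal_NT = F.normal_closure(1)[OF T]

lemma \<Gamma>_group: "group \<Gamma>"
  unfolding \<Gamma>_eq by (rule normal.factorgroup_is_group[OF normal_NT])

sublocale \<Gamma>: group \<Gamma> by (rule \<Gamma>_group)

lemma j_hom: "v \<in> V \<Longrightarrow> (\<lambda>x. j (v, x)) \<in> hom (G v) \<Gamma>"
  using hom_compose[OF \<iota>[of v] normal.r_coset_hom_Mod[OF normal_NT]]
  unfolding \<Gamma>_eq j_eq by (simp add: o_def)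

lemma j_closed: "j \<in> letters \<rightarrow> carrier \<Gamma>"
  using j_hom by (auto simp: free_product_letters_def hom_def)

lemma j_commute:
  assumes "(u, v) \<in> E" "g \<in> carrier (G u)" "h \<in> carrier (G v)"
  shows "j (u, g) \<otimes>\<^bsub>\<Gamma>\<^esub> j (v, h) = j (v, h) \<otimes>\<^bsub>\<Gamma>\<^esub> j (u, g)"
proof -
  let ?N = "normal_closure F T"
  have uv: "u \<in> V" "v \<in> V" using assms EV by auto
  have c: "\<iota> u g \<in> carrier F" "\<iota> v h \<in> carrier F" using \<iota>_closed uv assms by auto
  have "\<iota> u g \<otimes>\<^bsub>F\<^esub> \<iota> v h \<otimes>\<^bsub>F\<^esub> inv\<^bsub>F\<^esub> (\<iota> u g) \<otimes>\<^bsub>F\<^esub> inv\<^bsub>F\<^esub> (\<iota> v h) \<in> T"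
    unfolding T_def using assms by blast
  then have "\<iota> u g \<otimes>\<^bsub>F\<^esub> \<iota> v h \<otimes>\<^bsub>F\<^esub> inv\<^bsub>F\<^esub> (\<iota> u g) \<otimes>\<^bsub>F\<^esub> inv\<^bsub>F\<^esub> (\<iota> v h) \<in> ?N" using F.normal_closure(2)[OF T] by blast
  then have "(\<iota> u g \<otimes>\<^bsub>F\<^esub> \<iota> v h) \<otimes>\<^bsub>F\<^esub> inv\<^bsub>F\<^esub> (\<iota> v h \<otimes>\<^bsub>F\<^esub> \<iota> u g) \<in> ?N"
    using c by (simp add: F.inv_mult_group F.m_assoc)
  then have "?N #>\<^bsub>F\<^esub> (\<iota> u g \<otimes>\<^bsub>F\<^esub> \<iota> v h) = ?N #>\<^bsub>F\<^esub> (\<iota> v h \<otimes>\<^bsub>F\<^esub> \<iota> u g)"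
    using c F.r_coset_eq_iff[OF normal_imp_subgroup[OF normal_NT]] by simp
  then show ?thesis
    unfolding \<Gamma>_eq j_eq using c hom_mult[OF normal.r_coset_hom_Mod[OF normal_NT]] by simp
qed

lemma j_generates:
  assumes "x \<in> carrier \<Gamma>"
  obtains w where "w \<in> lists letters" "x = word_eval \<Gamma> j w"
proof -
  let ?N = "normal_closure F T"
  from assms obtain y where y: "y \<in> carrier F" "x = ?N #>\<^bsub>F\<^esub> y" unfolding \<Gamma>_eq carrier_FactGroup by blast
  then obtain w where w: "w \<in> lists letters" "y = word_class letters rels w"
    by (auto simp: free_product_def word_monoid_carrier[OF rels])
  have eq: "(\<lambda>l. word_class letters rels [l]) = (\<lambda>l. \<iota> (fst l) (snd l))"
    by (simp add: free_product_incl_def)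
  have "y = word_eval F (\<lambda>l. \<iota> (fst l) (snd l)) w"
    using word_monoid_generated[OF rels w(1)] w(2) unfolding eq free_product_def by simp
  moreover have "(\<lambda>l. \<iota> (fst l) (snd l)) \<in> letters \<rightarrow> carrier F"
    using \<iota>_closed by (auto simp: free_product_letters_def)
  ultimately have "x = word_eval \<Gamma> j w"
    using FactGroup_generated[OF F_group normal_NT _ w(1)] y(2) unfolding \<Gamma>_eq j_eq by simp
  then show ?thesis using that w(1) by blast
qed

text \<open>Together with \<open>j_hom\<close>, \<open>j_commute\<close> and
  \<open>j_generates\<close> this characterises the graph product; its construction as an iterated
  quotient is not opened again.\<close>

lemma \<Gamma>_universal:
  assumes K: "group K" and h: "\<And>v. v \<in> V \<Longrightarrow> (\<lambda>x. h (v, x)) \<in> hom (G v) K"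
    and c: "\<And>u v x y. \<lbrakk>(u, v) \<in> E; x \<in> carrier (G u); y \<in> carrier (G v)\<rbrakk> \<Longrightarrow>
      h (u, x) \<otimes>\<^bsub>K\<^esub> h (v, y) = h (v, y) \<otimes>\<^bsub>K\<^esub> h (u, x)"
  obtains f where "f \<in> hom \<Gamma> K" "\<And>l. l \<in> letters \<Longrightarrow> f (j l) = h l"
proof -
  interpret K: group K by fact
  have hc: "h \<in> letters \<rightarrow> carrier K" using h by (auto simp: free_product_letters_def hom_def)
  have hrel: "word_eval K h u = word_eval K h v" if uv: "(u, v) \<in> rels" for u v
  proof -
    consider v' x y where "v' \<in> V" "x \<in> carrier (G v')" "y \<in> carrier (G v')"
        "u = [(v', x), (v', y)]" "v = [(v', x \<otimes>\<^bsub>G v'\<^esub> y)]"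
      | v' where "v' \<in> V" "u = [(v', \<one>\<^bsub>G v'\<^esub>)]" "v = []"
      using uv unfolding free_product_rels_def by blast
    then show ?thesis
    proof cases
      case 1
      have "h (v', x \<otimes>\<^bsub>G v'\<^esub> y) = h (v', x) \<otimes>\<^bsub>K\<^esub> h (v', y)" using hom_mult[OF h] 1 by simp
      moreover have "h (v', x) \<in> carrier K" "h (v', y) \<in> carrier K" using 1 h by (auto simp: hom_def)
      ultimately show ?thesis using 1 by (simp add: K.m_assoc)
    next
      case 2
      interpret Gv: group "G v'" by (rule groups) fact
      have "h (v', \<one>\<^bsub>G v'\<^esub>) = \<one>\<^bsub>K\<^esub>" using hom_one[OF h groups K] 2 by simp
      then show ?thesis using 2 by simp
    qed
  qed
  obtain f0 where f0: "f0 \<in> hom F K" "\<And>w. w \<in> lists letters \<Longrightarrow> f0 (word_class letters rels w) = word_eval K h w"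
    using word_monoid_universal[OF rels K hc hrel] unfolding free_product_def by metis
  interpret f0: group_hom F K f0 using f0(1) by unfold_locales
  have f0\<iota>: "f0 (\<iota> v x) = h (v, x)" if "v \<in> V" "x \<in> carrier (G v)" for v x
  proof -
    have "(v, x) \<in> letters" using that by (simp add: free_product_letters_def)
    then show ?thesis
      using f0(2)[of "[(v, x)]"] funcset_mem[OF hc] by (simp add: free_product_incl_def)
  qed
  have "f0 t = \<one>\<^bsub>K\<^esub>" if tT: "t \<in> T" for t
  proof -
    obtain u v g h' where t: "t = \<iota> u g \<otimes>\<^bsub>F\<^esub> \<iota> v h' \<otimes>\<^bsub>F\<^esub> inv\<^bsub>F\<^esub> (\<iota> u g) \<otimes>\<^bsub>F\<^esub> inv\<^bsub>F\<^esub> (\<iota> v h')"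
      "(u, v) \<in> E" "g \<in> carrier (G u)" "h' \<in> carrier (G v)" using tT unfolding T_def by blast
    have uv: "u \<in> V" "v \<in> V" using t EV by auto
    have hK: "h (u, g) \<in> carrier K" "h (v, h') \<in> carrier K" using h[OF uv(1)] h[OF uv(2)] t by (auto simp: hom_def)
    have "f0 t = (h (u, g) \<otimes>\<^bsub>K\<^esub> h (v, h')) \<otimes>\<^bsub>K\<^esub> inv\<^bsub>K\<^esub> (h (v, h') \<otimes>\<^bsub>K\<^esub> h (u, g))"
      using \<iota>_closed uv t f0\<iota> hK by (simp add: K.inv_mult_group K.m_assoc)
    then show ?thesis using c[OF t(2-4)] hK by simp
  qed
  from normal_closure_universal[OF F_group K f0(1) T this] obtain f where f: "f \<in> hom \<Gamma> K"
    "\<And>x. x \<in> carrier F \<Longrightarrow> f (normal_closure F T #>\<^bsub>F\<^esub> x) = f0 x"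
    unfolding \<Gamma>_eq by metis
  have "f (j l) = h l" if "l \<in> letters" for l
    using that f(2) \<iota>_closed f0\<iota> unfolding j_eq by (auto simp: free_product_letters_def)
  then show ?thesis using that f(1) by blast
qed

end

section \<open>Triangular representations\<close>

text \<open>One target for all actions below: invertible operators, with \<open>S = UNIV\<close>,
  permutations of normal forms, and permutations of a finite set.\<close>

definition permutation_group :: "'x set \<Rightarrow> ('x \<Rightarrow> 'x) monoid"
  where "permutation_group S = \<lparr>carrier = {p. p permutes S}, monoid.mult = (\<circ>), one = id\<rparr>"

lemma permutation_group_simps [simp]:
  "carrier (permutation_group S) = {p. p permutes S}"
  "p \<otimes>\<^bsub>permutation_group S\<^esub> q = p \<circ> q"
  "\<one>\<^bsub>permutation_group S\<^esub> = id"
  by (simp_all add: permutation_group_def)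

lemma group_permutation_group: "group (permutation_group S)"
proof (rule groupI)
  fix p assume "p \<in> carrier (permutation_group S)"
  then have "p permutes S" by simp
  then show "\<exists>q\<in>carrier (permutation_group S). q \<otimes>\<^bsub>permutation_group S\<^esub> p = \<one>\<^bsub>permutation_group S\<^esub>"
    using permutes_inv permutes_inv_o(2) by (intro bexI[of _ "inv_into UNIV p"]) auto
qed (auto intro: permutes_compose permutes_id simp: o_assoc)

text \<open>Pascal's rule as needed in the induction for \<open>(1 + Z) ^ n\<close>, with
  \<open>a i\<close> standing for a coordinate of the \<open>i\<close>-th iterate of
  \<open>Z\<close> on a vector.\<close>

lemma pascal_sum:
  fixes a :: "nat \<Rightarrow> int"
  shows "(\<Sum>i\<le>n. int (n choose i) * (a (Suc i) + a i)) = (\<Sum>i\<le>Suc n. int (Suc n choose i) * a i)"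
proof -
  have "(\<Sum>i\<le>Suc n. int (Suc n choose i) * a i) = a 0 + (\<Sum>i\<le>n. int ((n choose i) + (n choose Suc i)) * a (Suc i))"
    by (simp only: sum.atMost_Suc_shift binomial_Suc_Suc binomial_n_0 of_nat_1 mult_1_left)
  also have "\<dots> = (\<Sum>i\<le>n. int (n choose i) * a (Suc i)) + (a 0 + (\<Sum>i\<le>n. int (n choose Suc i) * a (Suc i)))"
    by (simp add: distrib_right sum.distrib)
  also have "a 0 + (\<Sum>i\<le>n. int (n choose Suc i) * a (Suc i)) = (\<Sum>i\<le>Suc n. int (n choose i) * a i)"
    by (simp only: sum.atMost_Suc_shift binomial_n_0 of_nat_1 mult_1_left)
  also have "\<dots> = (\<Sum>i\<le>n. int (n choose i) * a i)" by simp
  finally show ?thesis by (simp add: distrib_left sum.distrib)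
qed

text \<open>From \<open>i * (n choose i) = n * (n - 1 choose (i - 1))\<close>: one of the
  \<open>i\<close> factors \<open>c\<close> supplies the factor \<open>i\<close> on the left, and
  for \<open>i > 1\<close> another factor \<open>c\<close> survives.\<close>

lemma binomial_power_dvd:
  fixes c :: nat
  assumes "i > 0" "i dvd c"
  shows "n * c dvd (n choose i) * c ^ i"
proof -
  obtain i' where i: "i = Suc i'" using assms(1) by (cases i) auto
  obtain q where q: "c = i * q" using assms(2) by blast
  show ?thesis
  proof (cases i')
    case 0
    then show ?thesis using i by simp
  next
    case (Suc i'')
    have "c * c ^ i' = i * q * c ^ i'" by (rule arg_cong[where f = "\<lambda>t. t * c ^ i'", OF q])
    then have "c ^ i = i * q * c ^ i'" using i by simp
    then have "(n choose i) * c ^ i = (i * (n choose i)) * q * c ^ i'" by (simp only: ac_simps)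
    also have "i * (n choose i) = n * (n - 1 choose i')"
      using i times_binomial_minus1_eq[of i n] assms(1) by simp
    finally have "(n choose i) * c ^ i = n * c * ((n - 1 choose i') * q * c ^ i'')" using Suc by simp
    then show ?thesis by (metis dvd_triv_left)
  qed
qed

text \<open>Sets outside \<open>Pow {..<k}\<close> are inert, so that total functions can replace vectors of finite
  length.\<close>

definition signed_triangular :: "nat \<Rightarrow> ((nat set \<Rightarrow> int) \<Rightarrow> (nat set \<Rightarrow> int)) \<Rightarrow> bool"
  where "signed_triangular k T \<longleftrightarrow>
    (\<forall>f g. T (\<lambda>S. f S + g S) = (\<lambda>S. T f S + T g S)) \<and>
    (\<forall>a f. T (\<lambda>S. a * f S) = (\<lambda>S. a * T f S)) \<and>
    (\<forall>f S. \<not> S \<subseteq> {..<k} \<longrightarrow> T f S = f S) \<and>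
    (\<exists>\<sigma>. (\<forall>S. \<sigma> S = 1 \<or> \<sigma> S = (-1::int)) \<and>
      (\<forall>f S. S \<subseteq> {..<k} \<longrightarrow> (\<forall>U. S \<subset> U \<longrightarrow> U \<subseteq> {..<k} \<longrightarrow> f U = 0) \<longrightarrow> T f S = \<sigma> S * f S))"

lemma signed_triangularD:
  assumes "signed_triangular k T"
  shows "T (\<lambda>S. f S + g S) = (\<lambda>S. T f S + T g S)"
    "T (\<lambda>S. a * f S) = (\<lambda>S. a * T f S)"
    "T (\<lambda>S. f S - g S) = (\<lambda>S. T f S - T g S)"
    "\<not> S \<subseteq> {..<k} \<Longrightarrow> T f S = f S"
    "T (\<lambda>S. 0) = (\<lambda>S. 0)"
proof -
  note d = assms[unfolded signed_triangular_def]
  show add: "T (\<lambda>S. f S + g S) = (\<lambda>S. T f S + T g S)" for f g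
    by (rule conjunct1[OF d, THEN spec, THEN spec])
  show mult: "T (\<lambda>S. a * f S) = (\<lambda>S. a * T f S)" for a f
    by (rule conjunct1[OF conjunct2[OF d], THEN spec, THEN spec])
  show "T (\<lambda>S. f S - g S) = (\<lambda>S. T f S - T g S)"
    using add[of f "\<lambda>S. (-1) * g S"] mult[of "-1" g] by simp
  show "\<not> S \<subseteq> {..<k} \<Longrightarrow> T f S = f S"
    by (rule conjunct1[OF conjunct2[OF conjunct2[OF d]], THEN spec, THEN spec, THEN mp])
  show "T (\<lambda>S. 0) = (\<lambda>S. 0)" using mult[of 0 "\<lambda>S. 0"] by simp
qed

lemma signed_triangular_sign:
  assumes "signed_triangular k T"
  obtains \<sigma> where "\<And>S. \<sigma> S = 1 \<or> \<sigma> S = (-1::int)"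
    "\<And>f S. \<lbrakk>S \<subseteq> {..<k}; \<And>U. S \<subset> U \<Longrightarrow> U \<subseteq> {..<k} \<Longrightarrow> f U = 0\<rbrakk> \<Longrightarrow> T f S = \<sigma> S * f S"
proof -
  from conjunct2[OF conjunct2[OF conjunct2[OF assms[unfolded signed_triangular_def]]]]
  obtain \<sigma> where "(\<forall>S. \<sigma> S = 1 \<or> \<sigma> S = (-1::int)) \<and>
    (\<forall>f S. S \<subseteq> {..<k} \<longrightarrow> (\<forall>U. S \<subset> U \<longrightarrow> U \<subseteq> {..<k} \<longrightarrow> f U = 0) \<longrightarrow> T f S = \<sigma> S * f S)"
    by (rule exE)
  then show ?thesis using that[of \<sigma>] by simp
qed

lemma signed_triangular_sum:
  assumes "signed_triangular k T" "finite B"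
  shows "T (\<lambda>S. \<Sum>b\<in>B. a b * f b S) = (\<lambda>S. \<Sum>b\<in>B. a b * T (f b) S)"
  using assms(2)
proof induction
  case (insert x B)
  then show ?case
    using signed_triangularD(1)[OF assms(1), of "\<lambda>S. a x * f x S" "\<lambda>S. \<Sum>b\<in>B. a b * f b S"]
    by (simp add: signed_triangularD(2)[OF assms(1)])
qed (simp add: signed_triangularD(5)[OF assms(1)])

text \<open>If \<open>f\<close> vanishes above \<open>S\<close> then so does \<open>T' f\<close>, so
  the diagonal signs of \<open>T\<close> and \<open>T'\<close> multiply.\<close>

lemma signed_triangular_comp:
  assumes T: "signed_triangular k T" and T': "signed_triangular k T'"
  shows "signed_triangular k (T \<circ> T')"
proof -
  obtain \<sigma> where \<sigma>: "\<And>S. \<sigma> S = 1 \<or> \<sigma> S = (-1::int)"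
    "\<And>f S. \<lbrakk>S \<subseteq> {..<k}; \<And>U. S \<subset> U \<Longrightarrow> U \<subseteq> {..<k} \<Longrightarrow> f U = 0\<rbrakk> \<Longrightarrow> T f S = \<sigma> S * f S"
    using signed_triangular_sign[OF T] by blast
  obtain \<sigma>' where \<sigma>': "\<And>S. \<sigma>' S = 1 \<or> \<sigma>' S = (-1::int)"
    "\<And>f S. \<lbrakk>S \<subseteq> {..<k}; \<And>U. S \<subset> U \<Longrightarrow> U \<subseteq> {..<k} \<Longrightarrow> f U = 0\<rbrakk> \<Longrightarrow> T' f S = \<sigma>' S * f S"
    using signed_triangular_sign[OF T'] by blast
  have "(T \<circ> T') f S = \<sigma> S * \<sigma>' S * f S"
    if S: "S \<subseteq> {..<k}" and f: "\<And>U. S \<subset> U \<Longrightarrow> U \<subseteq> {..<k} \<Longrightarrow> f U = 0" for f S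
  proof -
    have "T' f U = 0" if U: "S \<subset> U" "U \<subseteq> {..<k}" for U
    proof -
      have "T' f U = \<sigma>' U * f U" 
      proof (rule \<sigma>'(2)[OF U(2)])
        fix W assume "U \<subset> W" "W \<subseteq> {..<k}"
        then show "f W = 0" using U(1) by (intro f) auto
      qed
      then show ?thesis using f[OF U] by simp
    qed
    then have "T (T' f) S = \<sigma> S * T' f S" by (rule \<sigma>(2)[OF S])
    moreover have "T' f S = \<sigma>' S * f S" by (rule \<sigma>'(2)[OF S f])
    ultimately show ?thesis by simp
  qed
  moreover have "\<sigma> S * \<sigma>' S = 1 \<or> \<sigma> S * \<sigma>' S = -1" for S
    using \<sigma>(1)[of S] \<sigma>'(1)[of S] by auto
  ultimately have "\<exists>\<tau>. (\<forall>S. \<tau> S = 1 \<or> \<tau> S = (-1::int)) \<and>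
      (\<forall>f S. S \<subseteq> {..<k} \<longrightarrow> (\<forall>U. S \<subset> U \<longrightarrow> U \<subseteq> {..<k} \<longrightarrow> f U = 0) \<longrightarrow> (T \<circ> T') f S = \<tau> S * f S)"
    by (intro exI[of _ "\<lambda>S. \<sigma> S * \<sigma>' S"] conjI allI impI) simp_all
  then show ?thesis
    unfolding signed_triangular_def
    using signed_triangularD[OF T] signed_triangularD[OF T'] by simp
qed

text \<open>Nilpotence of the unipotent part comes from the inclusion grading: each application of
  \<open>T - 1\<close> lowers the cardinality bound on the support by one.\<close>

lemma unitriangular_nilpotent:
  fixes Z :: "(nat set \<Rightarrow> int) \<Rightarrow> nat set \<Rightarrow> int"
  assumes out: "\<And>f S. \<not> S \<subseteq> {..<k} \<Longrightarrow> Z f S = 0"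
    and tri: "\<And>f S. \<lbrakk>S \<subseteq> {..<k}; \<And>U. S \<subset> U \<Longrightarrow> U \<subseteq> {..<k} \<Longrightarrow> f U = 0\<rbrakk> \<Longrightarrow> Z f S = 0"
  shows "i \<ge> k + 2 \<Longrightarrow> (Z ^^ i) f = (\<lambda>S. 0)"
proof -
  \<comment> \<open>The bound \<open>k + 1\<close> leaves only inert sets for \<open>i = 0\<close>,
    because subsets of \<open>{..<k}\<close> have at most \<open>k\<close> elements; from
    \<open>i = k + 1\<close> on it is met even by the empty set and hence by every set.\<close>
  have step: "(Z ^^ Suc i) f S = 0" if "\<not> S \<subseteq> {..<k} \<or> card S + i \<ge> k + 1" for i f S
    using that
  proof (induction i arbitrary: S)
    case 0
    then have "\<not> S \<subseteq> {..<k}" using card_mono[of "{..<k}" S] by fastforce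
    then show ?case using out by simp
  next
    case (Suc i)
    show ?case
    proof (cases "S \<subseteq> {..<k}")
      case True
      have "(Z ^^ Suc i) f U = 0" if "S \<subset> U" "U \<subseteq> {..<k}" for U
      proof (rule Suc.IH)
        have "card S < card U" using that finite_subset[OF that(2)] by (intro psubset_card_mono) auto
        then show "\<not> U \<subseteq> {..<k} \<or> k + 1 \<le> card U + i" using Suc.prems True by linarith
      qed
      then show ?thesis using tri[OF True] by simp
    qed (use out in simp)
  qed
  assume "i \<ge> k + 2"
  then obtain i' where "i = Suc i'" "i' \<ge> k + 1" by (cases i) auto
  then show ?thesis using step[of _ i' f] by auto
qed

section \<open>Congruence subgroups of a triangular representation\<close>

locale signed_triangular_rep = group A for A :: "('a, 'm) monoid_scheme" (structure) +
  fixes k :: nat and \<rho> :: "'a \<Rightarrow> (nat set \<Rightarrow> int) \<Rightarrow> (nat set \<Rightarrow> int)"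
  assumes \<rho>_mult: "\<And>x y. \<lbrakk>x \<in> carrier A; y \<in> carrier A\<rbrakk> \<Longrightarrow> \<rho> (x \<otimes> y) = \<rho> x \<circ> \<rho> y"
    and \<rho>_one: "\<rho> \<one> = id"
    and \<rho>_tri: "\<And>x. x \<in> carrier A \<Longrightarrow> signed_triangular k (\<rho> x)"
begin

definition Z where "Z x f = (\<lambda>S. \<rho> x f S - f S)"
text \<open>The factorial has two purposes: it is divisible by every positive \<open>i\<close> up to
  \<open>k + 1\<close>, the degrees that survive in the binomial expansion, and it exceeds 2, so
  that a diagonal sign congruent to 1 is 1. Taking the modulus \<open>m * M\<close> in
  \<open>N m\<close> builds both into every level.\<close>

definition M where "M = (fact (k + 3) :: nat)"
definition N where "N m = {x \<in> carrier A. \<forall>f S. int (m * M) dvd Z x f S}"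

lemmas lin = signed_triangularD[OF \<rho>_tri]

lemma \<rho>_inv: "x \<in> carrier A \<Longrightarrow> \<rho> x (\<rho> (inv x) f) = f" "x \<in> carrier A \<Longrightarrow> \<rho> (inv x) (\<rho> x f) = f"
  using \<rho>_mult[of x "inv x"] \<rho>_mult[of "inv x" x] \<rho>_one by (auto simp: fun_eq_iff)

lemma \<rho>_pow: "x \<in> carrier A \<Longrightarrow> \<rho> (x [^] (n::nat)) = \<rho> x ^^ n"
  by (induction n) (simp_all add: \<rho>_one \<rho>_mult funpow_Suc_right del: funpow.simps(2))

lemma \<rho>_dvd: "x \<in> carrier A \<Longrightarrow> (\<And>S. c dvd f S) \<Longrightarrow> c dvd \<rho> x f S"
proof -
  assume x: "x \<in> carrier A" and "\<And>S. c dvd f S"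
  then have "f = (\<lambda>S. c * (f S div c))" by simp
  then have "\<rho> x f = (\<lambda>S. c * \<rho> x (\<lambda>S. f S div c) S)" using lin(2)[OF x] by metis
  then show ?thesis by simp
qed

lemma M_ge: "M \<ge> 3"
proof -
  have "k + 3 \<le> fact (k + 3)" by (rule fact_ge_self)
  then show ?thesis unfolding M_def by simp
qed

lemma N_subgroup: "subgroup (N m) A"
proof (rule subgroupI)
  show "N m \<noteq> {}" by (auto simp: N_def Z_def \<rho>_one intro!: exI[of _ \<one>])
  show "inv x \<in> N m" if x: "x \<in> N m" for x
  proof -
    have xA: "x \<in> carrier A" using x by (simp add: N_def)
    have "Z (inv x) f S = - Z x (\<rho> (inv x) f) S" for f S using \<rho>_inv(1)[OF xA] by (simp add: Z_def)
    then show ?thesis using x xA unfolding N_def by simp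
  qed
  show "x \<otimes> y \<in> N m" if x: "x \<in> N m" and y: "y \<in> N m" for x y
  proof -
    have xy: "x \<in> carrier A" "y \<in> carrier A" using x y by (simp_all add: N_def)
    have "Z (x \<otimes> y) f S = Z x (\<rho> y f) S + Z y f S" for f S using \<rho>_mult[OF xy] by (simp add: Z_def)
    then show ?thesis using x y xy unfolding N_def by (auto intro: dvd_add)
  qed
qed (auto simp: N_def)

lemma N_normal: "N m \<lhd> A"
  unfolding normal_inv_iff
proof (intro conjI ballI N_subgroup)
  fix g x assume g: "g \<in> carrier A" and x: "x \<in> N m"
  have xA: "x \<in> carrier A" using x by (simp add: N_def)
  have "Z (g \<otimes> x \<otimes> inv g) f S = \<rho> g (Z x (\<rho> (inv g) f)) S" for f S
  proof -
    have "\<rho> g (Z x (\<rho> (inv g) f)) = (\<lambda>S. \<rho> g (\<rho> x (\<rho> (inv g) f)) S - \<rho> g (\<rho> (inv g) f) S)"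
      unfolding Z_def by (rule lin(3)[OF g])
    then show ?thesis using g xA by (simp add: \<rho>_mult \<rho>_inv Z_def)
  qed
  then show "g \<otimes> x \<otimes> inv g \<in> N m"
    using x xA g \<rho>_dvd[OF g] unfolding N_def by simp
qed

text \<open>Modulo \<open>m * M\<close> an element is determined by the residues of its finitely
  many matrix entries in the basis \<open>\<delta> U\<close> with \<open>U\<close> a subset of
  \<open>{..<k}\<close>.\<close>

lemma N_finite_index:
  assumes m: "m > 0"
  shows "finite_index_normal (N m) A"
proof -
  let ?c = "int (m * M)"
  have c: "?c > 0" using m M_ge by simp
  let ?B = "Pow {..<k}"
  define \<delta> where "\<delta> = (\<lambda>U S. if S = (U :: nat set) then 1 else (0 :: int))"
  define F where "F = (\<lambda>x. restrict (\<lambda>(S, U). \<rho> x (\<delta> U) S mod ?c) (?B \<times> ?B))"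
  have expand: "\<rho> x f S = (\<Sum>U\<in>?B. f U * \<rho> x (\<delta> U) S)" if x: "x \<in> carrier A" and S: "S \<subseteq> {..<k}" for x f S
  proof -
    let ?g = "\<lambda>S. if S \<subseteq> {..<k} then 0 else f S"
    have "f = (\<lambda>S. (\<Sum>U\<in>?B. f U * \<delta> U S) + ?g S)"
      by (rule ext) (auto simp: \<delta>_def if_distrib cong: if_cong)
    then have "\<rho> x f = \<rho> x (\<lambda>S. (\<Sum>U\<in>?B. f U * \<delta> U S) + ?g S)" by simp
    also have "\<dots> = (\<lambda>S. (\<Sum>U\<in>?B. f U * \<rho> x (\<delta> U) S) + \<rho> x ?g S)"
      using lin(1)[OF x, of "\<lambda>S. \<Sum>U\<in>?B. f U * \<delta> U S" ?g] signed_triangular_sum[OF \<rho>_tri[OF x], of ?B f \<delta>] by simp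
    finally have "\<rho> x f S = (\<Sum>U\<in>?B. f U * \<rho> x (\<delta> U) S) + \<rho> x ?g S" by metis
    \<comment> \<open>Inert coordinates do not leak in: \<open>?g\<close> vanishes on all subsets of
      \<open>{..<k}\<close>, so triangularity at \<open>S\<close> gives 0.\<close>
    moreover have "\<rho> x ?g S = 0"
    proof -
      obtain \<sigma> where "\<And>f S. \<lbrakk>S \<subseteq> {..<k}; \<And>U. S \<subset> U \<Longrightarrow> U \<subseteq> {..<k} \<Longrightarrow> f U = 0\<rbrakk> \<Longrightarrow> \<rho> x f S = \<sigma> S * f S"
        using signed_triangular_sign[OF \<rho>_tri[OF x]] by metis
      from this[OF S, of ?g] show ?thesis using S by simp
    qed
    ultimately show ?thesis by simp
  qed
  have "finite (rcosets (N m))"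
  proof (rule finite_rcosets_by_map[OF N_subgroup])
    have "F ` carrier A \<subseteq> ?B \<times> ?B \<rightarrow>\<^sub>E {0..<?c}" 
    proof (rule image_subsetI)
      show "F x \<in> ?B \<times> ?B \<rightarrow>\<^sub>E {0..<?c}" for x
        unfolding F_def restrict_PiE_iff using c by (auto simp del: of_nat_mult)
    qed
    then show "finite (F ` carrier A)" by (rule finite_subset) (intro finite_PiE, auto)
    fix x y assume x: "x \<in> carrier A" and y: "y \<in> carrier A" and e: "F x = F y"
    have e': "\<rho> x (\<delta> U) S mod ?c = \<rho> y (\<delta> U) S mod ?c" if "S \<subseteq> {..<k}" "U \<subseteq> {..<k}" for S U
      using fun_cong[OF e, of "(S, U)"] that unfolding F_def by simp
    have d: "?c dvd \<rho> x f S - \<rho> y f S" for f S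
    proof (cases "S \<subseteq> {..<k}")
      case True
      have "\<rho> x f S - \<rho> y f S = (\<Sum>U\<in>?B. f U * (\<rho> x (\<delta> U) S - \<rho> y (\<delta> U) S))"
        unfolding expand[OF x True, of f] expand[OF y True, of f] by (simp add: sum_subtractf right_diff_distrib)
      also have "?c dvd \<dots>"
        by (intro dvd_sum dvd_mult) (use e'[OF True] in \<open>simp add: mod_eq_dvd_iff del: of_nat_mult\<close>)
      finally show ?thesis .
    qed (use lin(4)[OF x] lin(4)[OF y] in simp)
    have "Z (x \<otimes> inv y) f S = \<rho> x (\<rho> (inv y) f) S - \<rho> y (\<rho> (inv y) f) S" for f S
      using x y by (simp add: Z_def \<rho>_mult \<rho>_inv)
    then show "x \<otimes> inv y \<in> N m" using d x y unfolding N_def by simp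
  qed
  then show ?thesis using N_normal unfolding finite_index_normal_def by blast
qed

lemma Z_lin:
  assumes x: "x \<in> carrier A"
  shows "Z x (\<lambda>S. a * f S) = (\<lambda>S. a * Z x f S)" "\<not> S \<subseteq> {..<k} \<Longrightarrow> Z x f S = 0"
  using lin(2)[OF x] lin(4)[OF x] by (simp_all add: Z_def right_diff_distrib)

lemma binomial_expansion:
  assumes x: "x \<in> carrier A"
  shows "(\<rho> x ^^ n) f = (\<lambda>S. \<Sum>i\<le>n. int (n choose i) * (Z x ^^ i) f S)"
proof (induction n)
  case (Suc n)
  have "(\<rho> x ^^ Suc n) f = \<rho> x (\<lambda>S. \<Sum>i\<le>n. int (n choose i) * (Z x ^^ i) f S)" using Suc by simp
  also have "\<dots> = (\<lambda>S. \<Sum>i\<le>n. int (n choose i) * \<rho> x ((Z x ^^ i) f) S)"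
    by (rule signed_triangular_sum[OF \<rho>_tri[OF x]]) simp
  also have "\<dots> = (\<lambda>S. \<Sum>i\<le>n. int (n choose i) * ((Z x ^^ Suc i) f S + (Z x ^^ i) f S))"
    by (simp add: Z_def)
  finally show ?case using pascal_sum[of n "\<lambda>i. (Z x ^^ i) f _"] by simp
qed simp

text \<open>By linearity a factor already present passes through \<open>Z x\<close>, and each
  application contributes a further \<open>m * M\<close>.\<close>

lemma Z_pow_dvd:
  assumes x: "x \<in> N m"
  shows "int (m * M) ^ i dvd (Z x ^^ i) f S"
proof (induction i arbitrary: S)
  case (Suc i)
  let ?c = "int (m * M)" and ?g = "(Z x ^^ i) f"
  have xA: "x \<in> carrier A" using x by (simp add: N_def)
  have "?g = (\<lambda>S. ?c ^ i * (?g S div ?c ^ i))" using Suc.IH by (simp del: of_nat_mult)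
  then have "Z x ?g = (\<lambda>S. ?c ^ i * Z x (\<lambda>S. ?g S div ?c ^ i) S)" using Z_lin(1)[OF xA] by metis
  then have "(Z x ^^ Suc i) f S = ?c ^ i * Z x (\<lambda>S. ?g S div ?c ^ i) S" by simp
  moreover have "?c dvd Z x (\<lambda>S. ?g S div ?c ^ i) S" using x unfolding N_def by blast
  ultimately show ?case by (simp add: mult_dvd_mono mult.commute del: of_nat_mult)
qed simp

text \<open>Testing \<open>x\<close> on the indicator function of \<open>S\<close> shows that its
  sign at \<open>S\<close> is 1 modulo \<open>m * M\<close>, which is at least 3. So the sign is 1,
  and \<open>Z x\<close> is strictly triangular.\<close>

lemma N_nilpotent:
  assumes m: "m > 0" and x: "x \<in> N m" and i: "i \<ge> k + 2"
  shows "(Z x ^^ i) f = (\<lambda>S. 0)"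
proof (rule unitriangular_nilpotent[OF _ _ i])
  have xA: "x \<in> carrier A" using x by (simp add: N_def)
  show "Z x f S = 0" if "\<not> S \<subseteq> {..<k}" for f S using Z_lin(2)[OF xA that] .
  obtain \<sigma> where \<sigma>: "\<And>S. \<sigma> S = 1 \<or> \<sigma> S = (-1::int)"
    "\<And>f S. \<lbrakk>S \<subseteq> {..<k}; \<And>U. S \<subset> U \<Longrightarrow> U \<subseteq> {..<k} \<Longrightarrow> f U = 0\<rbrakk> \<Longrightarrow> \<rho> x f S = \<sigma> S * f S"
    using signed_triangular_sign[OF \<rho>_tri[OF xA]] by blast
  have c: "int (m * M) \<ge> 3" using mult_le_mono[of 1 m 3 M] m M_ge of_nat_le_iff[of 3 "m * M"] by (simp del: of_nat_mult)
  fix f S assume S: "S \<subseteq> {..<k}" and f: "\<And>U. S \<subset> U \<Longrightarrow> U \<subseteq> {..<k} \<Longrightarrow> f U = (0::int)"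
  let ?\<delta> = "\<lambda>U. if U = S then 1 else (0::int)"
  have "\<rho> x ?\<delta> S = \<sigma> S" using \<sigma>(2)[OF S, of ?\<delta>] by auto
  moreover have "int (m * M) dvd \<rho> x ?\<delta> S - ?\<delta> S" using x unfolding N_def Z_def by blast
  ultimately have "int (m * M) dvd \<sigma> S - 1" by simp
  then have "\<sigma> S \<noteq> -1" using c zdvd_imp_le[of "int (m * M)" 2] by (auto simp del: of_nat_mult)
  then have "\<sigma> S = 1" using \<sigma>(1) by blast
  then show "Z x f S = 0" using \<sigma>(2)[OF S] f by (simp add: Z_def)
qed

text \<open>In \<open>(1 + Z) ^ n - 1\<close> the terms with \<open>i \<ge> k + 2\<close> vanish by
  nilpotence. For smaller \<open>i > 0\<close> the number \<open>i\<close> divides \<open>M\<close>,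
  hence \<open>n * m * M\<close> divides \<open>(n choose i) * (m * M) ^ i\<close>, and thereby the
  whole term.\<close>

lemma N_power_filtration: "power_filtration A N"
  unfolding power_filtration_def
proof (intro conjI allI impI ballI)
  fix m :: nat assume m: "m > 0"
  show "finite_index_normal (N m) A" by (rule N_finite_index[OF m])
  fix n x assume n: "n > (0::nat)" and x: "x \<in> N m"
  let ?c = "m * M"
  have xA: "x \<in> carrier A" using x by (simp add: N_def)
  have "int (n * ?c) dvd Z (x [^] n) f S" for f S
  proof -
    have "Z (x [^] n) f S = (\<Sum>i\<le>n. int (n choose i) * (Z x ^^ i) f S) - f S"
      unfolding Z_def[of "x [^] n"] \<rho>_pow[OF xA] binomial_expansion[OF xA] ..
    also have "\<dots> = (\<Sum>i\<in>{..n} - {0}. int (n choose i) * (Z x ^^ i) f S)"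
      by (subst sum.remove[of "{..n}" 0]) auto
    also have "int (n * ?c) dvd \<dots>"
    proof (rule dvd_sum)
      fix i assume "i \<in> {..n} - {0}"
      then have i: "i > 0" by simp
      show "int (n * ?c) dvd int (n choose i) * (Z x ^^ i) f S"
      proof (cases "i \<ge> k + 2")
        case True
        then show ?thesis using N_nilpotent[OF m x True] by simp
      next
        case False
        then have "i dvd M" unfolding M_def using i by (intro dvd_fact) auto
        then have "n * ?c dvd (n choose i) * ?c ^ i" using i by (intro binomial_power_dvd) auto
        then have "int (n * ?c) dvd int ((n choose i) * ?c ^ i)" by (simp only: of_nat_dvd_iff)
        also have "int ((n choose i) * ?c ^ i) = int (n choose i) * int ?c ^ i" by simp
        also have "\<dots> dvd int (n choose i) * (Z x ^^ i) f S"
          using Z_pow_dvd[OF x] by (intro mult_dvd_mono) auto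
        finally show ?thesis .
      qed
    qed
    finally show ?thesis .
  qed
  then show "x [^] n \<in> N (n * m)" using xA unfolding N_def by (simp add: mult.assoc)
qed

lemma N_separates:
  assumes "g \<in> carrier A" "\<rho> g \<noteq> id"
  shows "\<exists>m>0. g \<notin> N m"
proof -
  obtain f S where fS: "Z g f S \<noteq> 0" using assms(2) unfolding Z_def by (metis eq_id_iff ext right_minus_eq)
  \<comment> \<open>A modulus larger than a non-zero coefficient of \<open>Z g\<close> cannot divide
    it.\<close>
  let ?m = "nat \<bar>Z g f S\<bar> + 1"
  have "\<not> int (?m * M) dvd Z g f S"
  proof
    assume "int (?m * M) dvd Z g f S"
    then have "int ?m dvd Z g f S" by (metis dvd_mult_left of_nat_mult)
    from dvd_imp_le_int[OF fS this] show False by simp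
  qed
  then have "g \<notin> N ?m" unfolding N_def by blast
  then show ?thesis by (intro exI[of _ ?m]) simp
qed

text \<open>Choosing \<open>f\<close> with \<open>(T - 1) f \<noteq> 0\<close> and \<open>(T - 1)\<^sup>2 f = 0\<close> for the unipotent operator \<open>T\<close> of
  \<open>c [^] 2\<close>, the orbit of \<open>f\<close> is linear in the exponent.\<close>

lemma N_linear:
  assumes c: "c \<in> carrier A" and c2: "\<rho> (c [^] (2::nat)) \<noteq> id"
  shows "\<exists>x::int. x \<noteq> 0 \<and> (\<forall>g\<in>carrier A. \<exists>a. \<forall>m>0. \<forall>j::int.
          inv g \<otimes> c [^] (int 2 * j) \<in> N m \<longrightarrow> int m dvd j * x - a)"
proof -
  define d where "d = c [^] (2::nat)"
  have d: "d \<in> carrier A" unfolding d_def using c by simp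
  have dp: "c [^] (int 2 * j) = d [^] j" for j :: int
    using c int_pow_pow[of c "int 2" j] unfolding d_def int_pow_int by simp
  obtain \<sigma> where \<sigma>: "\<And>S. \<sigma> S = 1 \<or> \<sigma> S = (-1::int)"
    "\<And>f S. \<lbrakk>S \<subseteq> {..<k}; \<And>U. S \<subset> U \<Longrightarrow> U \<subseteq> {..<k} \<Longrightarrow> f U = 0\<rbrakk> \<Longrightarrow> \<rho> c f S = \<sigma> S * f S"
    using signed_triangular_sign[OF \<rho>_tri[OF c]] by blast
  have dd: "\<rho> d f = \<rho> c (\<rho> c f)" for f
    unfolding d_def using \<rho>_mult[OF c c] c by (simp add: numeral_2_eq_2)
  \<comment> \<open>The diagonal signs of \<open>c\<close> occur squared in \<open>d\<close>, so
    \<open>d\<close> is genuinely unipotent; this is the reason for the exponent 2.\<close>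
  have tri: "Z d f S = 0" if S: "S \<subseteq> {..<k}" and f: "\<And>U. S \<subset> U \<Longrightarrow> U \<subseteq> {..<k} \<Longrightarrow> f U = 0" for f S
  proof -
    have "\<rho> c f U = 0" if U: "S \<subset> U" "U \<subseteq> {..<k}" for U
    proof -
      have "\<rho> c f U = \<sigma> U * f U" 
      proof (rule \<sigma>(2)[OF U(2)])
        fix W assume "U \<subset> W" "W \<subseteq> {..<k}"
        then show "f W = 0" using U(1) by (intro f) auto
      qed
      then show ?thesis using f[OF U] by simp
    qed
    then have "\<rho> c (\<rho> c f) S = \<sigma> S * \<rho> c f S" by (rule \<sigma>(2)[OF S])
    also have "\<rho> c f S = \<sigma> S * f S" by (rule \<sigma>(2)[OF S f])
    finally show ?thesis unfolding Z_def dd using \<sigma>(1)[of S] by auto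
  qed
  obtain f0 where f0: "Z d f0 \<noteq> (\<lambda>S. 0)" using c2 unfolding d_def[symmetric] Z_def
    by (metis eq_id_iff ext right_minus_eq)
  have nil: "\<exists>s. (Z d ^^ s) f0 = (\<lambda>S. 0)"
    by (rule exI, rule unitriangular_nilpotent[of k "Z d" "k + 2" f0, OF Z_lin(2)[OF d] tri]) auto
  define s where "s = (LEAST s. (Z d ^^ s) f0 = (\<lambda>S. 0))"
  have s: "(Z d ^^ s) f0 = (\<lambda>S. 0)" unfolding s_def by (rule LeastI_ex[OF nil])
  have s': "(Z d ^^ t) f0 \<noteq> (\<lambda>S. 0)" if "t < s" for t using not_less_Least that unfolding s_def by blast
  have "f0 \<noteq> (\<lambda>S. 0)" using f0 lin(5)[OF d] by (auto simp: Z_def)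
  then have "s \<noteq> 0" using s by (intro notI) simp
  moreover have "s \<noteq> 1" using s f0 by (intro notI) simp
  \<comment> \<open>Both \<open>f0\<close> and \<open>Z d f0\<close> are non-zero, so the first
    vanishing iterate has index at least 2 and one can stop two steps before it.\<close>
  ultimately obtain t where t: "s = Suc (Suc t)" by (metis One_nat_def not0_implies_Suc)
  define f where "f = (Z d ^^ t) f0"
  have Zf: "Z d f \<noteq> (\<lambda>S. 0)" and ZZf: "Z d (Z d f) = (\<lambda>S. 0)"
    using s' [of "Suc t"] s unfolding f_def t by simp_all
  obtain S where S: "Z d f S \<noteq> 0" using Zf by auto
  have Zfix: "\<rho> d (Z d f) = Z d f" using ZZf unfolding Z_def[of d "Z d f"] by (auto simp: fun_eq_iff)
  have step: "\<rho> d (\<lambda>S. f S + a * Z d f S) = (\<lambda>S. f S + (a + 1) * Z d f S)" for a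
    using lin(1)[OF d, of f "\<lambda>S. a * Z d f S"] lin(2)[OF d, of a "Z d f"] Zfix
    by (simp add: Z_def algebra_simps)
  have nat_pow: "\<rho> (d [^] n) (\<lambda>S. f S + a * Z d f S) = (\<lambda>S. f S + (a + int n) * Z d f S)" for n :: nat and a
    by (induction n arbitrary: a) (simp_all add: \<rho>_one d \<rho>_mult step add.assoc)
  have pow: "\<rho> (d [^] j) f = (\<lambda>S. f S + j * Z d f S)" for j :: int
  proof (cases "j \<ge> 0")
    case True
    then obtain n where "j = int n" using nonneg_int_cases by blast
    then show ?thesis using nat_pow[of n 0] by (simp add: int_pow_int)
  next
    case False
    then obtain n where n: "j = - int n" by (metis int_cases2 linear neg_0_le_iff_le of_nat_0_le_iff)
    have "\<rho> (inv (d [^] n)) (\<rho> (d [^] n) (\<lambda>S. f S + j * Z d f S)) = (\<lambda>S. f S + j * Z d f S)"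
      using \<rho>_inv(2) d by simp
    then show ?thesis unfolding nat_pow using n d by (simp add: int_pow_neg int_pow_int)
  qed
  have "\<exists>a. \<forall>m>0. \<forall>j::int. inv g \<otimes> d [^] j \<in> N m \<longrightarrow> int m dvd j * Z d f S - a" if g: "g \<in> carrier A" for g
  \<comment> \<open>Applying \<open>\<rho> g\<close> to the vector on which
    \<open>inv g \<otimes> d [^] j\<close> is congruent to the identity gives
    \<open>\<rho> (d [^] j) f - \<rho> g f\<close>, whose value at \<open>S\<close> is
    \<open>j * Z d f S - Z g f S\<close>.\<close>
  proof (intro exI[of _ "Z g f S"] allI impI)
    fix m :: nat and j :: int assume m: "m > 0" and "inv g \<otimes> d [^] j \<in> N m"
    then have "int (m * M) dvd Z (inv g \<otimes> d [^] j) f U" for U unfolding N_def by blast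
    then have dv: "int (m * M) dvd \<rho> g (Z (inv g \<otimes> d [^] j) f) S" by (rule \<rho>_dvd[OF g])
    have "\<rho> g (Z (inv g \<otimes> d [^] j) f) = (\<lambda>S. \<rho> g (\<rho> (inv g \<otimes> d [^] j) f) S - \<rho> g f S)"
      unfolding Z_def by (rule lin(3)[OF g])
    also have "\<rho> g (\<rho> (inv g \<otimes> d [^] j) f) = \<rho> (d [^] j) f" using g d by (simp add: \<rho>_mult \<rho>_inv)
    finally have "\<rho> g (Z (inv g \<otimes> d [^] j) f) S = j * Z d f S - Z g f S" unfolding pow by (simp add: Z_def)
    then show "int m dvd j * Z d f S - Z g f S" using dv by (metis dvd_mult_left of_nat_mult)
  qed
  then show ?thesis using S unfolding dp by blast
qed

end

text \<open>Separating one element at a time suffices. For \<open>c\<close> of infinite order the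
  representation is chosen to detect the square of \<open>c\<close>, whose operator is unipotent and
  not the identity, as linear growth requires.\<close>

lemma power_filtered_signed_triangular:
  assumes A: "group A"
    and sep: "\<And>g. g \<in> carrier A \<Longrightarrow> g \<noteq> \<one>\<^bsub>A\<^esub> \<Longrightarrow> \<exists>k \<rho>. signed_triangular_rep A k \<rho> \<and> \<rho> g \<noteq> id"
  shows "power_filtered A"
  unfolding power_filtered_def
proof (intro conjI ballI impI)
  interpret A: group A by fact
  fix g assume g: "g \<in> carrier A" "g \<noteq> \<one>\<^bsub>A\<^esub>"
  then obtain k \<rho> where r: "signed_triangular_rep A k \<rho>" "\<rho> g \<noteq> id" using sep by blast
  then show "\<exists>N. power_filtration A N \<and> (\<exists>m>0. g \<notin> N m)"
    using signed_triangular_rep.N_power_filtration[OF r(1)] signed_triangular_rep.N_separates[OF r(1) g(1) r(2)] by blast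
next
  interpret A: group A by fact
  fix c assume c: "c \<in> carrier A" and inf: "\<forall>n>0. c [^]\<^bsub>A\<^esub> (n::nat) \<noteq> \<one>\<^bsub>A\<^esub>"
  obtain k \<rho> where r: "signed_triangular_rep A k \<rho>" "\<rho> (c [^]\<^bsub>A\<^esub> (2::nat)) \<noteq> id"
    using sep[of "c [^]\<^bsub>A\<^esub> (2::nat)"] c inf by auto
  from signed_triangular_rep.N_linear[OF r(1) c r(2)] obtain x :: int where
    "x \<noteq> 0" "\<forall>g\<in>carrier A. \<exists>a. \<forall>m>0. \<forall>j::int.
      inv\<^bsub>A\<^esub> g \<otimes>\<^bsub>A\<^esub> c [^]\<^bsub>A\<^esub> (int 2 * j) \<in> signed_triangular_rep.N A k \<rho> m \<longrightarrow> int m dvd j * x - a" by blast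
  then show "\<exists>N h x. power_filtration A N \<and> h > 0 \<and> x \<noteq> (0::int) \<and>
        (\<forall>g\<in>carrier A. \<exists>a. \<forall>m>0. \<forall>j::int.
          inv\<^bsub>A\<^esub> g \<otimes>\<^bsub>A\<^esub> c [^]\<^bsub>A\<^esub> (int h * j) \<in> N m \<longrightarrow> int m dvd j * x - a)"
    using signed_triangular_rep.N_power_filtration[OF r(1)]
    by (intro exI[of _ "signed_triangular_rep.N A k \<rho>"] exI[of _ "2::nat"] exI[of _ x]) simp
qed

section \<open>Right-angled Artin and Coxeter groups\<close>

text \<open>\<open>\<chi>\<close> and \<open>\<nu>\<close> encode a matrix representation \<open>x \<mapsto> [[\<chi> x ^ c, \<nu> x], [0, \<chi> x ^ (c + 1)]]\<close> of each
  vertex group, for every exponent \<open>c\<close>.\<close>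

locale triangular_graph_of_groups = graph_of_groups V E G
  for V :: "'v set" and E :: "('v \<times> 'v) set" and G :: "'v \<Rightarrow> ('g, 'm) monoid_scheme" +
  fixes \<chi> \<nu> :: "'v \<Rightarrow> 'g \<Rightarrow> int"
  assumes E_sym: "Relation.sym E" and E_irrefl: "irrefl E"
    and \<chi>_sign: "\<And>v x. v \<in> V \<Longrightarrow> x \<in> carrier (G v) \<Longrightarrow> \<chi> v x = 1 \<or> \<chi> v x = -1"
    and \<chi>_mult: "\<And>v x y. \<lbrakk>v \<in> V; x \<in> carrier (G v); y \<in> carrier (G v)\<rbrakk> \<Longrightarrow>
      \<chi> v (x \<otimes>\<^bsub>G v\<^esub> y) = \<chi> v x * \<chi> v y"
    and \<nu>_mult: "\<And>v x y c. \<lbrakk>v \<in> V; x \<in> carrier (G v); y \<in> carrier (G v)\<rbrakk> \<Longrightarrow>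
      \<nu> v (x \<otimes>\<^bsub>G v\<^esub> y) = \<chi> v x ^ c * \<nu> v y + \<chi> v y ^ Suc c * \<nu> v x"
    and \<nu>_zero: "\<And>v x. \<lbrakk>v \<in> V; x \<in> carrier (G v); \<nu> v x = 0\<rbrakk> \<Longrightarrow> x = \<one>\<^bsub>G v\<^esub>"
begin

lemma E_sym': "(u, v) \<in> E \<Longrightarrow> (v, u) \<in> E" using E_sym by (simp add: sym_def)
lemma E_irrefl': "(v, v) \<notin> E" using E_irrefl by (simp add: irrefl_def)

text \<open>A shortest word has no trivial letter, and two letters at the same vertex separated only
  by letters at adjacent vertices could be moved together and merged.\<close>

lemma minimal_word:
  assumes w: "w \<in> lists letters"
    and min: "\<And>w'. \<lbrakk>w' \<in> lists letters; word_eval \<Gamma> j w' = word_eval \<Gamma> j w\<rbrakk> \<Longrightarrow> length w \<le> length w'"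
  shows "i < length w \<Longrightarrow> snd (w ! i) \<noteq> \<one>\<^bsub>G (fst (w ! i))\<^esub>"
    and "\<lbrakk>i < i'; i' < length w; fst (w ! i) = fst (w ! i')\<rbrakk> \<Longrightarrow>
      \<exists>l. i < l \<and> l < i' \<and> (fst (w ! l), fst (w ! i)) \<notin> E"
proof -
  note app = \<Gamma>.word_eval_append[OF j_closed] and cl = \<Gamma>.word_eval_closed[OF j_closed]
  have jc: "j l \<in> carrier \<Gamma>" if "l \<in> letters" for l using j_closed that by (rule funcset_mem)
  have inL: "w ! i \<in> letters" if "i < length w" for i using w that by (simp add: in_lists_conv_set)
  show "snd (w ! i) \<noteq> \<one>\<^bsub>G (fst (w ! i))\<^esub>" if i: "i < length w"
  proof
    assume one: "snd (w ! i) = \<one>\<^bsub>G (fst (w ! i))\<^esub>"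
    let ?v = "fst (w ! i)"
    have v: "?v \<in> V" using inL[OF i] by (auto simp: free_product_letters_def)
    have "j (w ! i) = j (?v, \<one>\<^bsub>G ?v\<^esub>)" using one by (metis prod.collapse)
    also have "\<dots> = \<one>\<^bsub>\<Gamma>\<^esub>" using hom_one[OF j_hom[OF v] groups[OF v] \<Gamma>_group] .
    finally have j1: "j (w ! i) = \<one>\<^bsub>\<Gamma>\<^esub>" .
    have split: "w = take i w @ [w ! i] @ drop (Suc i) w" using id_take_nth_drop[OF i] by simp
    have t: "take i w \<in> lists letters" and d: "drop (Suc i) w \<in> lists letters"
      using w by (auto simp: in_lists_conv_set dest: in_set_takeD in_set_dropD)
    have "word_eval \<Gamma> j w = word_eval \<Gamma> j (take i w @ [w ! i] @ drop (Suc i) w)" using split by simp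
    also have "\<dots> = word_eval \<Gamma> j (take i w @ drop (Suc i) w)"
      using t d inL[OF i] j1 cl by (simp add: app)
    finally have "word_eval \<Gamma> j (take i w @ drop (Suc i) w) = word_eval \<Gamma> j w" by simp
    from min[OF _ this] have "length w \<le> length (take i w @ drop (Suc i) w)" using t d by simp
    then show False using i by simp
  qed
  show "\<exists>l. i < l \<and> l < i' \<and> (fst (w ! l), fst (w ! i)) \<notin> E"
    if ii: "i < i'" "i' < length w" and eq: "fst (w ! i) = fst (w ! i')"
  proof (rule ccontr)
    assume no: "\<nexists>l. i < l \<and> l < i' \<and> (fst (w ! l), fst (w ! i)) \<notin> E"
    define v x y where "v = fst (w ! i)" and "x = snd (w ! i)" and "y = snd (w ! i')"
    have wi: "w ! i = (v, x)" "w ! i' = (v, y)" using eq by (simp_all add: v_def x_def y_def prod_eq_iff)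
    have vL: "v \<in> V" "x \<in> carrier (G v)" "y \<in> carrier (G v)"
      using inL[of i] inL[of i'] ii wi by (auto simp: free_product_letters_def)
    define p q s where "p = take i w" and "q = drop (Suc i) (take i' w)" and "s = drop (Suc i') w"
    have split: "w = p @ [(v, x)] @ q @ [(v, y)] @ s"
    proof -
      have "w = take i' w @ [w ! i'] @ s" using id_take_nth_drop[OF ii(2)] by (simp add: s_def)
      also have "take i' w = p @ [w ! i] @ q"
        using id_take_nth_drop[of i "take i' w"] ii by (simp add: p_def q_def)
      finally show ?thesis using wi by simp
    qed
    have L: "p \<in> lists letters" "q \<in> lists letters" "s \<in> lists letters" "(v, x) \<in> letters" "(v, y) \<in> letters"
      using w unfolding split by simp_all
    have qE: "(fst l, v) \<in> E" if "l \<in> set q" for l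
    proof -
      obtain n where n: "n < length q" "l = q ! n" using \<open>l \<in> set q\<close> by (auto simp: in_set_conv_nth)
      then have "l = w ! (Suc i + n)" "Suc i + n < i'" using ii by (auto simp: q_def)
      then show ?thesis using no v_def by auto
    qed
    have comm: "word_eval \<Gamma> j q' \<otimes>\<^bsub>\<Gamma>\<^esub> j (v, y) = j (v, y) \<otimes>\<^bsub>\<Gamma>\<^esub> word_eval \<Gamma> j q'" if "set q' \<subseteq> set q" for q'
      using that
    proof (induction q')
      case (Cons l q')
      have lL: "l \<in> letters" "q' \<in> lists letters" using Cons.prems L(2) by auto
      have "(fst l, v) \<in> E" using qE Cons.prems by simp
      then have c: "j l \<otimes>\<^bsub>\<Gamma>\<^esub> j (v, y) = j (v, y) \<otimes>\<^bsub>\<Gamma>\<^esub> j l"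
        using j_commute[of "fst l" v "snd l" y] vL lL by (auto simp: free_product_letters_def)
      have "word_eval \<Gamma> j (l # q') \<otimes>\<^bsub>\<Gamma>\<^esub> j (v, y) = j l \<otimes>\<^bsub>\<Gamma>\<^esub> (word_eval \<Gamma> j q' \<otimes>\<^bsub>\<Gamma>\<^esub> j (v, y))"
        using jc lL L cl by (simp add: \<Gamma>.m_assoc)
      also have "word_eval \<Gamma> j q' \<otimes>\<^bsub>\<Gamma>\<^esub> j (v, y) = j (v, y) \<otimes>\<^bsub>\<Gamma>\<^esub> word_eval \<Gamma> j q'" using Cons by simp
      also have "j l \<otimes>\<^bsub>\<Gamma>\<^esub> (j (v, y) \<otimes>\<^bsub>\<Gamma>\<^esub> word_eval \<Gamma> j q') = (j l \<otimes>\<^bsub>\<Gamma>\<^esub> j (v, y)) \<otimes>\<^bsub>\<Gamma>\<^esub> word_eval \<Gamma> j q'"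
        using jc lL L cl by (simp add: \<Gamma>.m_assoc)
      finally show ?case unfolding c using jc lL L cl by (simp add: \<Gamma>.m_assoc)
    qed (use jc L in simp)
    have "(v, x \<otimes>\<^bsub>G v\<^esub> y) \<in> letters"
      using vL groups[OF vL(1)] by (simp add: free_product_letters_def group.is_monoid monoid.m_closed)
    then have L': "p @ [(v, x \<otimes>\<^bsub>G v\<^esub> y)] @ q @ s \<in> lists letters" using L by simp
    have "word_eval \<Gamma> j w = word_eval \<Gamma> j p \<otimes>\<^bsub>\<Gamma>\<^esub> (j (v, x) \<otimes>\<^bsub>\<Gamma>\<^esub> ((word_eval \<Gamma> j q \<otimes>\<^bsub>\<Gamma>\<^esub> j (v, y)) \<otimes>\<^bsub>\<Gamma>\<^esub> word_eval \<Gamma> j s))"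
      unfolding split using L jc cl by (simp add: app \<Gamma>.m_assoc)
    also have "\<dots> = word_eval \<Gamma> j p \<otimes>\<^bsub>\<Gamma>\<^esub> ((j (v, x) \<otimes>\<^bsub>\<Gamma>\<^esub> j (v, y)) \<otimes>\<^bsub>\<Gamma>\<^esub> (word_eval \<Gamma> j q \<otimes>\<^bsub>\<Gamma>\<^esub> word_eval \<Gamma> j s))"
      unfolding comm[OF subset_refl] using L jc cl by (simp add: \<Gamma>.m_assoc)
    also have "j (v, x) \<otimes>\<^bsub>\<Gamma>\<^esub> j (v, y) = j (v, x \<otimes>\<^bsub>G v\<^esub> y)" using hom_mult[OF j_hom[OF vL(1)]] vL by simp
    finally have "word_eval \<Gamma> j (p @ [(v, x \<otimes>\<^bsub>G v\<^esub> y)] @ q @ s) = word_eval \<Gamma> j w"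
      using L L' by (simp add: app)
    from min[OF L' this] show False using arg_cong[OF split, of length] by simp
  qed
qed

section \<open>Operators attached to a reduced sequence of vertices\<close>

context
  fixes vs :: "'v list"
  assumes vs: "set vs \<subseteq> V"
    and reduced: "\<And>i i'. \<lbrakk>i < i'; i' < length vs; vs ! i = vs ! i'\<rbrakk> \<Longrightarrow>
      \<exists>l. i < l \<and> l < i' \<and> (vs ! l, vs ! i) \<notin> E"
begin

text \<open>Subsets of \<open>{..<length vs}\<close> stand for sets of syllables already read; \<open>addable v S\<close> holds the
  next syllable at \<open>v\<close>, if it does not have to wait for a non-commuting one. The lower ideals of
  the word are the sets reachable from the empty one.\<close>

definition "addable v S = {i. i < length vs \<and> vs ! i = v \<and> i \<notin> S \<and>
  (\<forall>l<i. (vs ! l, v) \<notin> E \<longrightarrow> l \<in> S) \<and> (\<forall>l. i < l \<and> l < length vs \<and> (vs ! l, v) \<notin> E \<longrightarrow> l \<notin> S)}"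

text \<open>The exponent \<open>c\<close> of the matrix representation of the vertex group: reading
  a syllable at \<open>v\<close> raises it by one, which accounts for \<open>c\<close> and
  \<open>Suc c\<close> in \<open>\<nu>_mult\<close>.\<close>

definition "cnt v S = card {i \<in> S. i < length vs \<and> vs ! i = v}"

text \<open>The transpose of adding a syllable: the value at \<open>S\<close> receives the value at
  \<open>insert i S\<close>. Hence a function concentrated on the full set is carried down towards
  the empty set as the letters of the word act from last to first.\<close>

definition "op l f = (\<lambda>S. if S \<subseteq> {..<length vs}
  then \<chi> (fst l) (snd l) ^ cnt (fst l) S * f S
     + \<nu> (fst l) (snd l) * (\<Sum>i\<in>addable (fst l) S. f (insert i S :: nat set))
  else f S)"

lemma addable_less: "i \<in> addable v S \<Longrightarrow> i < length vs" "i \<in> addable v S \<Longrightarrow> vs ! i = v" "i \<in> addable v S \<Longrightarrow> i \<notin> S"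
  unfolding addable_def by auto

lemma cnt_insert:
  assumes "i \<in> addable u S"
  shows "cnt v (insert i S) = (if u = v then Suc (cnt v S) else cnt v S)"
proof (cases "u = v")
  case True
  have "{i' \<in> insert i S. i' < length vs \<and> vs ! i' = v} = insert i {i' \<in> S. i' < length vs \<and> vs ! i' = v}"
    using addable_less[OF assms] True by auto
  then show ?thesis unfolding cnt_def using True addable_less(3)[OF assms] by simp
next
  case False
  then have "{i' \<in> insert i S. i' < length vs \<and> vs ! i' = v} = {i' \<in> S. i' < length vs \<and> vs ! i' = v}"
    using addable_less[OF assms] by auto
  then show ?thesis unfolding cnt_def using False by simp
qed

text \<open>If the second position comes later, reducedness supplies a letter in between that does
  not commute with \<open>v\<close>; it must be unread for the first position and read for the
  second. If it comes earlier, it should have been read before the first, as \<open>v\<close> is not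
  adjacent to itself. So the off-diagonal part of \<open>op\<close> at one vertex squares to
  zero.\<close>

lemma addable_twice: "i \<in> addable v S \<Longrightarrow> addable v (insert i S) = {}"
proof (rule ccontr)
  assume i: "i \<in> addable v S" and "addable v (insert i S) \<noteq> {}"
  then obtain i' where i': "i' \<in> addable v (insert i S)" by auto
  have ne: "i \<noteq> i'" "i' \<notin> S" using i' unfolding addable_def by auto
  have vv: "vs ! i = v" "vs ! i' = v" "i < length vs" "i' < length vs"
    using addable_less[OF i] addable_less[OF i'] by auto
  show False
  proof (cases "i' < i")
    case True
    then have "i' \<in> S" using i vv E_irrefl' unfolding addable_def by auto
    then show False using ne by simp
  next
    case False
    then have "i < i'" using ne by simp
    then obtain l where l: "i < l" "l < i'" "(vs ! l, v) \<notin> E" using reduced[of i i'] vv by auto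
    then have "l \<in> S" using i' l unfolding addable_def by auto
    moreover have "l < length vs" using l vv by simp
    ultimately show False using i l unfolding addable_def by auto
  qed
qed

text \<open>The waiting conditions for \<open>v\<close> concern only positions at vertices not
  adjacent to \<open>v\<close>, and \<open>i\<close> is no position of \<open>v\<close>
  itself.\<close>

lemma addable_commute:
  assumes "(u, v) \<in> E" "i \<in> addable u S"
  shows "addable v (insert i S) = addable v S"
proof -
  have "vs ! i = u" "u \<noteq> v" using addable_less(2)[OF assms(2)] assms(1) E_irrefl' by auto
  then show ?thesis unfolding addable_def using assms(1) by auto
qed

text \<open>Between \<open>S\<close> and the sets \<open>insert i S\<close> the operator is the
  upper triangular 2 by 2 matrix with exponent \<open>cnt v S\<close>; by
  \<open>addable_twice\<close> no third level occurs, so composition is the product of these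
  matrices and \<open>\<nu>_mult\<close> applies.\<close>

lemma op_mult:
  assumes v: "v \<in> V" "x \<in> carrier (G v)" "y \<in> carrier (G v)"
  shows "op (v, x) (op (v, y) f) = op (v, x \<otimes>\<^bsub>G v\<^esub> y) f"
proof
  fix S
  show "op (v, x) (op (v, y) f) S = op (v, x \<otimes>\<^bsub>G v\<^esub> y) f S"
  proof (cases "S \<subseteq> {..<length vs}")
    case True
    let ?c = "cnt v S"
    have "op (v, y) f (insert i S) = \<chi> v y ^ Suc ?c * f (insert i S)" if i: "i \<in> addable v S" for i
      unfolding op_def using cnt_insert[OF i, of v] addable_twice[OF i] addable_less(1)[OF i] True by simp
    then have A: "(\<Sum>i\<in>addable v S. op (v, y) f (insert i S)) = \<chi> v y ^ Suc ?c * (\<Sum>i\<in>addable v S. f (insert i S))"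
      by (simp add: sum_distrib_left)
    have B: "op (v, y) f S = \<chi> v y ^ ?c * f S + \<nu> v y * (\<Sum>i\<in>addable v S. f (insert i S))"
      using True by (simp add: op_def)
    have "op (v, x) (op (v, y) f) S = \<chi> v x ^ ?c * (\<chi> v y ^ ?c * f S + \<nu> v y * (\<Sum>i\<in>addable v S. f (insert i S)))
       + \<nu> v x * (\<chi> v y ^ Suc ?c * (\<Sum>i\<in>addable v S. f (insert i S)))"
      using True by (simp add: op_def[of "(v, x)"] A B)
    also have "\<dots> = op (v, x \<otimes>\<^bsub>G v\<^esub> y) f S"
      unfolding op_def using True by (simp add: \<chi>_mult[OF v] \<nu>_mult[OF v, of ?c] power_mult_distrib algebra_simps)
    finally show ?thesis .
  qed (simp add: op_def)
qed

text \<open>Reading at \<open>u\<close> changes neither the count nor the readable positions of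
  \<open>v\<close>, and conversely, so the two expansions differ only by swapping a double
  sum.\<close>

lemma op_commute:
  assumes uv: "(u, v) \<in> E"
  shows "op (u, x) (op (v, y) f) = op (v, y) (op (u, x) f)"
proof
  fix S
  have ne: "u \<noteq> v" using uv E_irrefl' by auto
  show "op (u, x) (op (v, y) f) S = op (v, y) (op (u, x) f) S"
  proof (cases "S \<subseteq> {..<length vs}")
    case True
    have *: "op (u, x) (op (v, y) f) S = \<chi> u x ^ cnt u S * (\<chi> v y ^ cnt v S * f S + \<nu> v y * (\<Sum>i\<in>addable v S. f (insert i S)))
      + \<nu> u x * (\<chi> v y ^ cnt v S * (\<Sum>i\<in>addable u S. f (insert i S))
        + \<nu> v y * (\<Sum>i\<in>addable u S. \<Sum>i'\<in>addable v S. f (insert i' (insert i S))))"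
      if uv: "(u, v) \<in> E" for u v x y
    proof -
      have ne: "u \<noteq> v" using uv E_irrefl' by auto
      have "op (v, y) f (insert i S) = \<chi> v y ^ cnt v S * f (insert i S) + \<nu> v y * (\<Sum>i'\<in>addable v S. f (insert i' (insert i S)))"
        if i: "i \<in> addable u S" for i
        unfolding op_def using cnt_insert[OF i, of v] ne addable_commute[OF uv i] addable_less(1)[OF i] True by simp
      then have A: "(\<Sum>i\<in>addable u S. op (v, y) f (insert i S)) = \<chi> v y ^ cnt v S * (\<Sum>i\<in>addable u S. f (insert i S))
        + \<nu> v y * (\<Sum>i\<in>addable u S. \<Sum>i'\<in>addable v S. f (insert i' (insert i S)))"
        by (simp add: sum.distrib sum_distrib_left)
      have B: "op (v, y) f S = \<chi> v y ^ cnt v S * f S + \<nu> v y * (\<Sum>i\<in>addable v S. f (insert i S))"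
        using True by (simp add: op_def)
      show ?thesis using True by (simp add: op_def[of "(u, x)"] A B)
    qed
    have "(\<Sum>i\<in>addable u S. \<Sum>i'\<in>addable v S. f (insert i' (insert i S)))
      = (\<Sum>i\<in>addable v S. \<Sum>i'\<in>addable u S. f (insert i' (insert i S)))"
      by (subst sum.swap) (simp add: insert_commute)
    then show ?thesis unfolding *[OF uv] *[OF E_sym'[OF uv]] by (simp add: algebra_simps)
  qed (simp add: op_def)
qed

lemma op_one:
  assumes v: "v \<in> V"
  shows "op (v, \<one>\<^bsub>G v\<^esub>) f = f"
proof -
  interpret Gv: group "G v" by (rule groups[OF v])
  have "\<chi> v \<one>\<^bsub>G v\<^esub> = \<chi> v \<one>\<^bsub>G v\<^esub> * \<chi> v \<one>\<^bsub>G v\<^esub>" using \<chi>_mult[OF v Gv.one_closed Gv.one_closed] by simp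
  then have c: "\<chi> v \<one>\<^bsub>G v\<^esub> = 1" using \<chi>_sign[OF v Gv.one_closed] by auto
  have "\<nu> v \<one>\<^bsub>G v\<^esub> = 0" using \<nu>_mult[OF v Gv.one_closed Gv.one_closed, of 0] c by simp
  then show ?thesis using c by (simp add: op_def fun_eq_iff)
qed

lemma op_permutes: "l \<in> letters \<Longrightarrow> op l permutes UNIV"
proof -
  assume "l \<in> letters"
  then obtain v x where l: "l = (v, x)" "v \<in> V" "x \<in> carrier (G v)" by (auto simp: free_product_letters_def)
  interpret Gv: group "G v" by (rule groups[OF l(2)])
  have "op (v, inv\<^bsub>G v\<^esub> x) \<circ> op l = id" "op l \<circ> op (v, inv\<^bsub>G v\<^esub> x) = id"
    using l op_mult[OF l(2)] op_one[OF l(2)] by (auto simp: fun_eq_iff)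
  then have "bij (op l)" by (rule o_bij)
  then show ?thesis unfolding permutes_univ bij_iff .
qed

lemma op_signed_triangular:
  assumes l: "l \<in> letters"
  shows "signed_triangular (length vs) (op l)"
  unfolding signed_triangular_def
proof (intro conjI allI impI exI[of _ "\<lambda>S. \<chi> (fst l) (snd l) ^ cnt (fst l) S"])
  show "op l (\<lambda>S. f S + g S) = (\<lambda>S. op l f S + op l g S)" for f g
    by (simp add: op_def fun_eq_iff sum.distrib algebra_simps)
  show "op l (\<lambda>S. a * f S) = (\<lambda>S. a * op l f S)" for a f
    by (simp add: op_def fun_eq_iff algebra_simps flip: sum_distrib_left)
  show "op l f S = f S" if "\<not> S \<subseteq> {..<length vs}" for f S using that by (simp add: op_def)
  have "\<chi> (fst l) (snd l) = 1 \<or> \<chi> (fst l) (snd l) = -1"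
    using l \<chi>_sign[of "fst l" "snd l"] by (auto simp: free_product_letters_def)
  then show "\<chi> (fst l) (snd l) ^ n = 1 \<or> \<chi> (fst l) (snd l) ^ n = - 1" for n
    using neg_one_even_power neg_one_odd_power by (metis power_one)
  fix f S assume S: "S \<subseteq> {..<length vs}" and f: "\<forall>U. S \<subset> U \<longrightarrow> U \<subseteq> {..<length vs} \<longrightarrow> f U = (0::int)"
  have "f (insert i S) = 0" if "i \<in> addable (fst l) S" for i
    using addable_less[OF that] S f by auto
  then show "op l f S = \<chi> (fst l) (snd l) ^ cnt (fst l) S * f S" using S by (simp add: op_def)
qed

lemma op_rep:
  obtains \<rho> where "signed_triangular_rep \<Gamma> (length vs) \<rho>" "\<And>l. l \<in> letters \<Longrightarrow> \<rho> (j l) = op l"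
proof -
  let ?K = "permutation_group (UNIV :: (nat set \<Rightarrow> int) set)"
  have "(\<lambda>x. op (v, x)) \<in> hom (G v) ?K" if v: "v \<in> V" for v
    using op_permutes op_mult[OF v] v by (intro homI) (auto simp: free_product_letters_def fun_eq_iff)
  moreover have "op (u, x) \<otimes>\<^bsub>?K\<^esub> op (v, y) = op (v, y) \<otimes>\<^bsub>?K\<^esub> op (u, x)" if "(u, v) \<in> E" for u v x y
    using op_commute[OF that] by (simp add: fun_eq_iff)
  ultimately obtain \<rho> where \<rho>: "\<rho> \<in> hom \<Gamma> ?K" "\<And>l. l \<in> letters \<Longrightarrow> \<rho> (j l) = op l"
    using \<Gamma>_universal[OF group_permutation_group, of op UNIV] by metis
  have one: "\<rho> \<one>\<^bsub>\<Gamma>\<^esub> = id" using hom_one[OF \<rho>(1) \<Gamma>_group group_permutation_group] by simp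
  have mult: "\<rho> (x \<otimes>\<^bsub>\<Gamma>\<^esub> y) = \<rho> x \<circ> \<rho> y" if "x \<in> carrier \<Gamma>" "y \<in> carrier \<Gamma>" for x y
    using hom_mult[OF \<rho>(1) that] by simp
  have id_tri: "signed_triangular (length vs) id"
    unfolding signed_triangular_def by (intro conjI allI impI exI[of _ "\<lambda>_. 1"]) simp_all
  have "signed_triangular (length vs) (\<rho> (word_eval \<Gamma> j w))" if "w \<in> lists letters" for w
    using that
  proof (induction w)
    case Nil
    then show ?case using one id_tri by (simp add: id_def)
  next
    case (Cons l w)
    have "\<rho> (word_eval \<Gamma> j (l # w)) = op l \<circ> \<rho> (word_eval \<Gamma> j w)"
      using mult[OF funcset_mem[OF j_closed] \<Gamma>.word_eval_closed[OF j_closed], of l w] \<rho>(2)[of l] Cons.hyps by simp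
    then show ?case
      by (simp only: signed_triangular_comp[OF op_signed_triangular[OF Cons.hyps(1)] Cons.IH])
  qed
  then have "signed_triangular (length vs) (\<rho> x)" if "x \<in> carrier \<Gamma>" for x
    using j_generates[OF that] by metis
  then have "signed_triangular_rep \<Gamma> (length vs) \<rho>"
    by unfold_locales (simp_all add: one mult)
  then show ?thesis using that \<rho>(2) by blast
qed

text \<open>A later position with the same vertex has to wait for \<open>n\<close>, a vertex not
  being adjacent to itself.\<close>

lemma addable_initial:
  assumes "n < length vs"
  shows "addable (vs ! n) {..<n} = {n}"
proof (intro equalityI subsetI)
  fix i assume i: "i \<in> addable (vs ! n) {..<n}"
  then have "\<not> n < i" using E_irrefl' unfolding addable_def by auto
  then show "i \<in> {n}" using addable_less(3)[OF i] by auto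
qed (use assms in \<open>auto simp: addable_def\<close>)

text \<open>A letter removes at most one position from a set, so after the letters from
  \<open>n\<close> on have acted, only sets with at least \<open>n\<close> elements carry a value.
  At \<open>{..<n}\<close> the diagonal term therefore drops out, and the single readable position
  contributes the value at \<open>{..<Suc n}\<close> times a non-zero \<open>\<nu>\<close>.
  Descending to \<open>n = 0\<close> gives a non-zero value at the empty set.\<close>

lemma op_word_nonzero:
  assumes w: "w \<in> lists letters" and wvs: "map fst w = vs" and nz: "\<And>l. l \<in> set w \<Longrightarrow> \<nu> (fst l) (snd l) \<noteq> 0"
    and \<rho>: "signed_triangular_rep \<Gamma> k \<rho>" "\<And>l. l \<in> letters \<Longrightarrow> \<rho> (j l) = op l"
    and ne: "w \<noteq> []"
  shows "\<rho> (word_eval \<Gamma> j w) \<noteq> id"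
proof -
  interpret signed_triangular_rep \<Gamma> k \<rho> by (rule \<rho>(1))
  have len: "length w = length vs" using wvs by auto
  define \<delta> where "\<delta> = (\<lambda>S. if S = {..<length vs} then 1 else (0::int))"
  define h where "h n = \<rho> (word_eval \<Gamma> j (drop n w)) \<delta>" for n
  have hSuc: "h n = op (w ! n) (h (Suc n))" if n: "n < length w" for n
  proof -
    have L: "w ! n \<in> letters" "drop (Suc n) w \<in> lists letters"
      using w n by (auto simp: in_lists_conv_set dest: in_set_dropD)
    have "drop n w = w ! n # drop (Suc n) w" by (rule Cons_nth_drop_Suc[OF n, symmetric])
    then show ?thesis unfolding h_def
      using \<rho>_mult[OF funcset_mem[OF j_closed] \<Gamma>.word_eval_closed[OF j_closed], of "w ! n" "drop (Suc n) w"] L \<rho>(2)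
      by simp
  qed
  have hlen: "h (length w) = \<delta>" unfolding h_def by (simp add: \<rho>_one)
  have zero: "h n S = 0" if "n \<le> length w" "S \<subseteq> {..<length vs}" "card S < n" for n S
    using that
  proof (induction n arbitrary: S rule: inc_induct)
    case base
    then have "S \<noteq> {..<length vs}" using len by auto
    then show ?case unfolding hlen \<delta>_def by simp
  next
    case (step n)
    have "h (Suc n) S = 0" using step by simp
    moreover have "h (Suc n) (insert i S) = 0" if "i \<in> addable (fst (w ! n)) S" for i
    proof (rule step.IH)
      show "insert i S \<subseteq> {..<length vs}" using addable_less(1)[OF that] step.prems by simp
      show "card (insert i S) < Suc n" using step.prems by (simp add: card_insert_if finite_subset[OF step.prems(1)])
    qed
    ultimately show ?case using step.hyps hSuc[of n] by (simp add: op_def)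
  qed
  have "h n {..<n} \<noteq> 0" if "n \<le> length w" for n
    using that
  proof (induction n rule: inc_induct)
    case base
    show ?case using hlen len by (simp add: \<delta>_def)
  next
    case (step n)
    have v: "fst (w ! n) = vs ! n" using wvs step.hyps by auto
    have "h n {..<n} = \<nu> (vs ! n) (snd (w ! n)) * h (Suc n) (insert n {..<n})"
      using hSuc[of n] zero[of "Suc n" "{..<n}"] step.hyps addable_initial[of n] v len by (auto simp: op_def)
    moreover have "insert n {..<n} = {..<Suc n}" by auto
    moreover have "\<nu> (vs ! n) (snd (w ! n)) \<noteq> 0" using nz[of "w ! n"] v step.hyps by simp
    ultimately show ?case using step.IH by simp
  qed
  from this[of 0] have "\<rho> (word_eval \<Gamma> j w) \<delta> {} \<noteq> 0" unfolding h_def by simp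
  moreover have "0 \<in> {..<length vs}" using ne len by auto
  then have "\<delta> {} = 0" unfolding \<delta>_def by auto
  ultimately show ?thesis by auto
qed

end

section \<open>Power filtrations of right-angled Artin and Coxeter groups\<close>

lemma \<Gamma>_power_filtered: "power_filtered \<Gamma>"
proof (rule power_filtered_signed_triangular[OF \<Gamma>_group])
  fix g assume g: "g \<in> carrier \<Gamma>" "g \<noteq> \<one>\<^bsub>\<Gamma>\<^esub>"
  let ?P = "\<lambda>w. w \<in> lists letters \<and> word_eval \<Gamma> j w = g"
  obtain w0 where "?P w0" using j_generates[OF g(1)] by metis
  then obtain w where "?P w" and least: "\<forall>w'. ?P w' \<longrightarrow> length w \<le> length w'"
    using ex_has_least_nat[of ?P w0 length] by blast
  then have w: "w \<in> lists letters" "word_eval \<Gamma> j w = g"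
    and min: "\<And>w'. \<lbrakk>w' \<in> lists letters; word_eval \<Gamma> j w' = word_eval \<Gamma> j w\<rbrakk> \<Longrightarrow> length w \<le> length w'"
    by auto
  have V: "set (map fst w) \<subseteq> V" using w(1) by (auto simp: free_product_letters_def)
  have red: "\<exists>l. i < l \<and> l < i' \<and> (map fst w ! l, map fst w ! i) \<notin> E"
    if "i < i'" "i' < length (map fst w)" "map fst w ! i = map fst w ! i'" for i i'
  proof -
    have "\<exists>l. i < l \<and> l < i' \<and> (fst (w ! l), fst (w ! i)) \<notin> E"
      by (rule minimal_word(2)[OF w(1) min]) (use that in auto)
    then show ?thesis using that by auto
  qed
  obtain \<rho> where \<rho>: "signed_triangular_rep \<Gamma> (length (map fst w)) \<rho>"
    "\<And>l. l \<in> letters \<Longrightarrow> \<rho> (j l) = op (map fst w) l"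
    using op_rep[OF V red] by metis
  have nz: "\<nu> (fst l) (snd l) \<noteq> 0" if l: "l \<in> set w" for l
  proof -
    obtain i where i: "i < length w" "l = w ! i" using l by (auto simp: in_set_conv_nth)
    have "snd l \<noteq> \<one>\<^bsub>G (fst l)\<^esub>" using minimal_word(1)[OF w(1) min i(1)] i(2) by simp
    moreover have "fst l \<in> V" "snd l \<in> carrier (G (fst l))" using w(1) l by (auto simp: free_product_letters_def)
    ultimately show ?thesis using \<nu>_zero by blast
  qed
  have "w \<noteq> []" using g(2) w(2) by auto
  from op_word_nonzero[OF V red w(1) HOL.refl nz \<rho> this] have "\<rho> g \<noteq> id" using w(2) by simp
  then show "\<exists>k \<rho>. signed_triangular_rep \<Gamma> k \<rho> \<and> \<rho> g \<noteq> id" using \<rho>(1) by blast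
qed

end

text \<open>The vertex matrices are \<open>[[1, n], [0, 1]]\<close>, with \<open>n\<close> the
  integer corresponding to the element.\<close>

lemma right_angled_Artin_power_filtered:
  assumes "right_angled_Artin V E G"
  shows "group (graph_product V E G)" "power_filtered (graph_product V E G)"
proof -
  have s: "simplicial_graph V E" and g: "\<And>v. v \<in> V \<Longrightarrow> group (G v)" and i: "\<And>v. v \<in> V \<Longrightarrow> G v \<cong> integer_group"
    using assms unfolding right_angled_Artin_def by auto
  define \<nu> where "\<nu> v = (SOME f. f \<in> iso (G v) integer_group)" for v
  have \<nu>: "\<nu> v \<in> iso (G v) integer_group" if "v \<in> V" for v
    unfolding \<nu>_def using i[OF that] unfolding is_iso_def by (metis some_in_eq)
  interpret triangular_graph_of_groups V E G "\<lambda>v x. 1" \<nu>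
  proof (intro triangular_graph_of_groups.intro graph_of_groups.intro triangular_graph_of_groups_axioms.intro)
    show "E \<subseteq> V \<times> V" "Relation.sym E" "irrefl E" using s by (auto simp: simplicial_graph_def)
    fix v x y and c :: nat assume v: "v \<in> V" and x: "x \<in> carrier (G v)" and y: "y \<in> carrier (G v)"
    have "\<nu> v (x \<otimes>\<^bsub>G v\<^esub> y) = \<nu> v x + \<nu> v y" using \<nu>[OF v] x y by (auto simp: iso_def hom_def)
    then show "\<nu> v (x \<otimes>\<^bsub>G v\<^esub> y) = 1 ^ c * \<nu> v y + 1 ^ Suc c * \<nu> v x" by simp
  next
    fix v x assume v: "v \<in> V" and x: "x \<in> carrier (G v)"
    assume "\<nu> v x = 0"
    moreover have "\<nu> v \<one>\<^bsub>G v\<^esub> = 0" using hom_one[of "\<nu> v" "G v" integer_group] \<nu>[OF v] g[OF v] by (simp add: iso_def)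
    moreover have "\<one>\<^bsub>G v\<^esub> \<in> carrier (G v)" using g[OF v] by (simp add: group.is_monoid monoid.one_closed)
    ultimately show "x = \<one>\<^bsub>G v\<^esub>" using \<nu>[OF v] x by (auto simp: iso_def bij_betw_def inj_on_def)
  qed (auto intro: g)
  show "group (graph_product V E G)" by (rule \<Gamma>_group)
  show "power_filtered (graph_product V E G)" by (rule \<Gamma>_power_filtered)
qed

text \<open>The generator of a vertex group becomes \<open>[[s, 1], [0, -s]]\<close> with
  \<open>s\<close> a sign. This matrix squares to the identity because its diagonal entries are
  opposite, which is why the sign has to alternate with the number of syllables read.\<close>

lemma right_angled_Coxeter_power_filtered:
  assumes "right_angled_Coxeter V E G"
  shows "group (graph_product V E G)" "power_filtered (graph_product V E G)"
proof -
  have s: "simplicial_graph V E" and g: "\<And>v. v \<in> V \<Longrightarrow> group (G v)" and i: "\<And>v. v \<in> V \<Longrightarrow> G v \<cong> integer_mod_group 2"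
    using assms unfolding right_angled_Coxeter_def by auto
  define \<nu> where "\<nu> v = (SOME f. f \<in> iso (G v) (integer_mod_group 2))" for v
  have \<nu>: "\<nu> v \<in> iso (G v) (integer_mod_group 2)" if "v \<in> V" for v
    unfolding \<nu>_def using i[OF that] unfolding is_iso_def by (metis some_in_eq)
  have \<nu>01: "\<nu> v x = 0 \<or> \<nu> v x = 1" if "v \<in> V" "x \<in> carrier (G v)" for v x
  proof -
    have "\<nu> v x \<in> carrier (integer_mod_group 2)" using \<nu>[OF that(1)] that(2) by (auto simp: iso_def hom_def)
    then show ?thesis by (auto simp: carrier_integer_mod_group)
  qed
  have \<nu>m: "\<nu> v (x \<otimes>\<^bsub>G v\<^esub> y) = (\<nu> v x + \<nu> v y) mod 2" if "v \<in> V" "x \<in> carrier (G v)" "y \<in> carrier (G v)" for v x y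
    using \<nu>[OF that(1)] that(2,3) by (auto simp: iso_def hom_def)
  interpret triangular_graph_of_groups V E G "\<lambda>v x. if \<nu> v x = 0 then 1 else -1" \<nu>
  proof (intro triangular_graph_of_groups.intro graph_of_groups.intro triangular_graph_of_groups_axioms.intro)
    show "E \<subseteq> V \<times> V" "Relation.sym E" "irrefl E" using s by (auto simp: simplicial_graph_def)
    fix v x y and c :: nat assume v: "v \<in> V" and x: "x \<in> carrier (G v)" and y: "y \<in> carrier (G v)"
    show "(if \<nu> v (x \<otimes>\<^bsub>G v\<^esub> y) = 0 then 1 else -1) = (if \<nu> v x = 0 then 1 else -1) * (if \<nu> v y = 0 then 1 else (-1::int))"
      using \<nu>m[OF v x y] \<nu>01[OF v x] \<nu>01[OF v y] by auto
    show "\<nu> v (x \<otimes>\<^bsub>G v\<^esub> y) = (if \<nu> v x = 0 then 1 else -1) ^ c * \<nu> v y + (if \<nu> v y = 0 then 1 else -1) ^ Suc c * \<nu> v x"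
      using \<nu>m[OF v x y] \<nu>01[OF v x] \<nu>01[OF v y] by auto
  next
    fix v x assume v: "v \<in> V" and x: "x \<in> carrier (G v)"
    assume "\<nu> v x = 0"
    moreover have "\<nu> v \<one>\<^bsub>G v\<^esub> = 0" using hom_one[of "\<nu> v" "G v" "integer_mod_group 2"] \<nu>[OF v] g[OF v] by (simp add: iso_def)
    moreover have "\<one>\<^bsub>G v\<^esub> \<in> carrier (G v)" using g[OF v] by (simp add: group.is_monoid monoid.one_closed)
    ultimately show "x = \<one>\<^bsub>G v\<^esub>" using \<nu>[OF v] x by (auto simp: iso_def bij_betw_def inj_on_def)
  qed (auto intro: g)
  show "group (graph_product V E G)" by (rule \<Gamma>_group)
  show "power_filtered (graph_product V E G)" by (rule \<Gamma>_power_filtered)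
qed

section \<open>Amalgams\<close>

definition sum_left :: "('a, 'm) monoid_scheme \<Rightarrow> ('a + 'b) monoid"
  where "sum_left P = \<lparr>carrier = Inl ` carrier P, monoid.mult = \<lambda>x y. Inl (projl x \<otimes>\<^bsub>P\<^esub> projl y), one = Inl \<one>\<^bsub>P\<^esub>\<rparr>"

definition sum_right :: "('b, 'm) monoid_scheme \<Rightarrow> ('a + 'b) monoid"
  where "sum_right Q = \<lparr>carrier = Inr ` carrier Q, monoid.mult = \<lambda>x y. Inr (projr x \<otimes>\<^bsub>Q\<^esub> projr y), one = Inr \<one>\<^bsub>Q\<^esub>\<rparr>"

lemma group_sum_left: "group P \<Longrightarrow> group (sum_left P)"
proof -
  assume "group P"
  then interpret group P .
  show ?thesis
  proof (rule groupI)
    fix x assume "x \<in> carrier (sum_left P)"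
    then show "\<exists>y\<in>carrier (sum_left P). y \<otimes>\<^bsub>sum_left P\<^esub> x = \<one>\<^bsub>sum_left P\<^esub>"
      by (intro bexI[of _ "Inl (inv\<^bsub>P\<^esub> (projl x))"]) (auto simp: sum_left_def)
  qed (auto simp: sum_left_def m_assoc)
qed

lemma group_sum_right: "group Q \<Longrightarrow> group (sum_right Q)"
proof -
  assume "group Q"
  then interpret group Q .
  show ?thesis
  proof (rule groupI)
    fix x assume "x \<in> carrier (sum_right Q)"
    then show "\<exists>y\<in>carrier (sum_right Q). y \<otimes>\<^bsub>sum_right Q\<^esub> x = \<one>\<^bsub>sum_right Q\<^esub>"
      by (intro bexI[of _ "Inr (inv\<^bsub>Q\<^esub> (projr x))"]) (auto simp: sum_right_def)
  qed (auto simp: sum_right_def m_assoc)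
qed

definition amalgam_incl ::
    "('a, 'm) monoid_scheme \<Rightarrow> ('b, 'n) monoid_scheme \<Rightarrow> 'a set \<Rightarrow> ('a \<Rightarrow> 'b) \<Rightarrow> 'a + 'b \<Rightarrow> ('a + 'b) list set set"
  where "amalgam_incl P Q R \<phi> l =
    (let F = free_product2 P Q
     in normal_closure F
          {free_product2_inl P Q r \<otimes>\<^bsub>F\<^esub> inv\<^bsub>F\<^esub> (free_product2_inr P Q (\<phi> r)) | r. r \<in> R}
        #>\<^bsub>F\<^esub> word_class (carrier P <+> carrier Q) (free_product2_rels P Q) [l])"

text \<open>The two factors are treated uniformly as groups \<open>H b\<close> on the disjoint sum, with \<open>H True\<close> the
  copy of \<open>P\<close>; a letter \<open>l\<close> lies in \<open>H (isl l)\<close>.\<close>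

locale amalgam = P: group P + Q: group Q
  for P :: "('a, 'm) monoid_scheme" and Q :: "('b, 'n) monoid_scheme" +
  fixes R :: "'a set" and \<phi> :: "'a \<Rightarrow> 'b"
  assumes R: "subgroup R P" and \<phi>: "\<phi> \<in> hom (P\<lparr>carrier := R\<rparr>) Q" and \<phi>_inj: "inj_on \<phi> R"
begin

abbreviation "letters \<equiv> carrier P <+> carrier Q"
abbreviation "rels \<equiv> free_product2_rels P Q"
abbreviation "F \<equiv> free_product2 P Q"
abbreviation "\<Gamma> \<equiv> amalgamated_product P Q R \<phi>"
abbreviation "j \<equiv> amalgam_incl P Q R \<phi>"

definition "T = {free_product2_inl P Q r \<otimes>\<^bsub>F\<^esub> inv\<^bsub>F\<^esub> (free_product2_inr P Q (\<phi> r)) | r. r \<in> R}"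
definition "H b = (if b then sum_left P else sum_right Q)"
definition "emb b r = (if b then Inl r else Inr (\<phi> r))"
abbreviation "core b \<equiv> emb b ` R"

lemma \<Gamma>_eq: "\<Gamma> = F Mod normal_closure F T"
  and j_eq: "j l = normal_closure F T #>\<^bsub>F\<^esub> word_class letters rels [l]"
  unfolding T_def amalgamated_product_def amalgam_incl_def by (simp_all add: Let_def)

lemma H_group: "group (H b)"
  unfolding H_def by (simp add: group_sum_left[OF P.is_group] group_sum_right[OF Q.is_group])

sublocale H: group "H b" for b by (rule H_group)

lemma H_carrier: "carrier (H b) = {l \<in> letters. isl l = b}"
  by (auto simp: H_def sum_left_def sum_right_def)

lemma R_sub: "r \<in> R \<Longrightarrow> r \<in> carrier P" using subgroup.subset[OF R] by blast
lemma \<phi>_closed: "r \<in> R \<Longrightarrow> \<phi> r \<in> carrier Q" using \<phi> by (auto simp: hom_def)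
lemma \<phi>_mult: "r \<in> R \<Longrightarrow> r' \<in> R \<Longrightarrow> \<phi> (r \<otimes>\<^bsub>P\<^esub> r') = \<phi> r \<otimes>\<^bsub>Q\<^esub> \<phi> r'" using \<phi> by (auto simp: hom_def)

lemma R_group: "group (P\<lparr>carrier := R\<rparr>)" by (rule subgroup.subgroup_is_group[OF R P.is_group])
lemma R_closed: "\<one>\<^bsub>P\<^esub> \<in> R" "r \<in> R \<Longrightarrow> r' \<in> R \<Longrightarrow> r \<otimes>\<^bsub>P\<^esub> r' \<in> R" "r \<in> R \<Longrightarrow> inv\<^bsub>P\<^esub> r \<in> R"
  using subgroup.one_closed[OF R] subgroup.m_closed[OF R] subgroup.m_inv_closed[OF R] by blast+

lemma \<phi>_one: "\<phi> \<one>\<^bsub>P\<^esub> = \<one>\<^bsub>Q\<^esub>"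
  using hom_one[OF \<phi> R_group Q.is_group] by simp

lemma emb_isl [simp]: "isl (emb b r) = b" by (simp add: emb_def)
lemma emb_closed: "r \<in> R \<Longrightarrow> emb b r \<in> carrier (H b)"
  by (auto simp: H_def sum_left_def sum_right_def emb_def R_sub \<phi>_closed)
lemma emb_letters: "r \<in> R \<Longrightarrow> emb b r \<in> letters" using emb_closed H_carrier by blast
lemma emb_mult: "r \<in> R \<Longrightarrow> r' \<in> R \<Longrightarrow> emb b (r \<otimes>\<^bsub>P\<^esub> r') = emb b r \<otimes>\<^bsub>H b\<^esub> emb b r'"
  by (auto simp: H_def sum_left_def sum_right_def emb_def \<phi>_mult)
lemma emb_one: "emb b \<one>\<^bsub>P\<^esub> = \<one>\<^bsub>H b\<^esub>"
  by (auto simp: H_def sum_left_def sum_right_def emb_def \<phi>_one)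
lemma emb_inj: "inj_on (emb b) R"
  using \<phi>_inj by (auto simp: emb_def inj_on_def)

lemma core_subgroup: "subgroup (core b) (H b)"
proof -
  have "emb b \<in> hom (P\<lparr>carrier := R\<rparr>) (H b)" by (rule homI) (simp_all add: emb_closed emb_mult)
  then interpret e: group_hom "P\<lparr>carrier := R\<rparr>" "H b" "emb b"
    by (simp add: group_hom_def group_hom_axioms_def R_group H_group)
  show ?thesis using e.img_is_subgroup by simp
qed

lemma rels: "rels \<subseteq> lists letters \<times> lists letters"
  by (auto simp: free_product2_rels_def)

lemma F_group: "group F"
  unfolding free_product2_def
proof (rule word_monoid_group[OF rels])
  fix l assume l: "l \<in> letters"
  then obtain l' m e where l': "l' \<in> letters" and m: "([l', l], [m]) \<in> rels" "([m], []) \<in> rels"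
  proof (cases l)
    case (Inl x)
    then show ?thesis using l by (intro that[of "Inl (inv\<^bsub>P\<^esub> x)" "Inl \<one>\<^bsub>P\<^esub>"]) (auto simp: free_product2_rels_def intro!: exI[of _ "inv\<^bsub>P\<^esub> x"])
  next
    case (Inr x)
    then show ?thesis using l by (intro that[of "Inr (inv\<^bsub>Q\<^esub> x)" "Inr \<one>\<^bsub>Q\<^esub>"]) (auto simp: free_product2_rels_def intro!: exI[of _ "inv\<^bsub>Q\<^esub> x"])
  qed
  have "word_cong letters rels ([] @ [l', l] @ []) ([] @ [m] @ [])" by (rule word_cong.rel[OF m(1)]) auto
  moreover have "word_cong letters rels ([] @ [m] @ []) ([] @ [] @ [])" by (rule word_cong.rel[OF m(2)]) auto
  ultimately have "word_cong letters rels ([] @ [l', l] @ []) ([] @ [] @ [])" by (rule word_cong.trans)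
  then show "\<exists>l'\<in>letters. word_cong letters rels [l', l] []" using l' by auto
qed

sublocale F: group F by (rule F_group)

lemma class_closed: "w \<in> lists letters \<Longrightarrow> word_class letters rels w \<in> carrier F"
  unfolding free_product2_def word_monoid_carrier[OF rels] by (rule imageI)

lemma class_hom: "(\<lambda>l. word_class letters rels [l]) \<in> hom (H b) F"
proof (rule homI)
  fix x assume x: "x \<in> carrier (H b)"
  then show "word_class letters rels [x] \<in> carrier F" by (intro class_closed) (simp add: H_carrier)
  fix y assume y: "y \<in> carrier (H b)"
  have "([x, y], [x \<otimes>\<^bsub>H b\<^esub> y]) \<in> rels"
    using x y by (auto simp: H_def sum_left_def sum_right_def free_product2_rels_def split: if_splits)
  from word_monoid_rel[OF rels this]
  show "word_class letters rels [x \<otimes>\<^bsub>H b\<^esub> y] = word_class letters rels [x] \<otimes>\<^bsub>F\<^esub> word_class letters rels [y]"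
    using word_monoid_mult[OF rels, of "[x]" "[y]"] x y by (simp add: free_product2_def H_carrier)
qed

lemma T_eq: "T = {word_class letters rels [emb True r] \<otimes>\<^bsub>F\<^esub> inv\<^bsub>F\<^esub> (word_class letters rels [emb False r]) | r. r \<in> R}"
  unfolding T_def free_product2_inl_def free_product2_inr_def emb_def by simp

lemma T: "T \<subseteq> carrier F"
  unfolding T_eq using class_closed emb_letters by (auto intro!: F.m_closed F.inv_closed)

lemmas normal_NT = F.normal_closure(1)[OF T]

lemma \<Gamma>_group: "group \<Gamma>"
  unfolding \<Gamma>_eq by (rule normal.factorgroup_is_group[OF normal_NT])

sublocale \<Gamma>: group \<Gamma> by (rule \<Gamma>_group)

lemma j_hom: "j \<in> hom (H b) \<Gamma>"
  using hom_compose[OF class_hom[of b] normal.r_coset_hom_Mod[OF normal_NT]]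
  unfolding \<Gamma>_eq j_eq[abs_def] by (simp add: o_def)

lemma j_closed: "j \<in> letters \<rightarrow> carrier \<Gamma>"
proof
  fix l assume "l \<in> letters"
  then have "l \<in> carrier (H (isl l))" by (simp add: H_carrier)
  then show "j l \<in> carrier \<Gamma>" using j_hom[of "isl l"] by (auto simp: hom_def)
qed

lemma j_emb: assumes r: "r \<in> R" shows "j (emb b r) = j (emb b' r)"
proof -
  let ?N = "normal_closure F T"
  have c: "word_class letters rels [emb b r] \<in> carrier F" for b
    using class_closed emb_letters[OF r] by simp
  have "word_class letters rels [emb True r] \<otimes>\<^bsub>F\<^esub> inv\<^bsub>F\<^esub> (word_class letters rels [emb False r]) \<in> ?N"
    using F.normal_closure(2)[OF T] r unfolding T_eq by blast
  then have "j (emb True r) = j (emb False r)"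
    unfolding j_eq using F.r_coset_eq_iff[OF normal_imp_subgroup[OF normal_NT] c c] by blast
  then show ?thesis by (cases b; cases b') simp_all
qed

lemma j_generates:
  assumes "x \<in> carrier \<Gamma>"
  obtains w where "w \<in> lists letters" "x = word_eval \<Gamma> j w"
proof -
  let ?N = "normal_closure F T"
  from assms obtain y where y: "y \<in> carrier F" "x = ?N #>\<^bsub>F\<^esub> y" unfolding \<Gamma>_eq carrier_FactGroup by blast
  then obtain w where w: "w \<in> lists letters" "y = word_class letters rels w"
    by (auto simp: free_product2_def word_monoid_carrier[OF rels])
  have "y = word_eval F (\<lambda>l. word_class letters rels [l]) w"
    using word_monoid_generated[OF rels w(1)] w(2) unfolding free_product2_def by simp
  moreover have "(\<lambda>l. word_class letters rels [l]) \<in> letters \<rightarrow> carrier F"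
    using class_closed by auto
  ultimately have "x = word_eval \<Gamma> j w"
    using FactGroup_generated[OF F_group normal_NT _ w(1)] y(2) unfolding \<Gamma>_eq j_eq[abs_def] by simp
  then show ?thesis using that w(1) by blast
qed

lemma \<Gamma>_universal:
  assumes K: "group K" and h: "\<And>b. h \<in> hom (H b) K"
    and e: "\<And>r. r \<in> R \<Longrightarrow> h (emb True r) = h (emb False r)"
  obtains f where "f \<in> hom \<Gamma> K" "\<And>l. l \<in> letters \<Longrightarrow> f (j l) = h l"
proof -
  interpret K: group K by fact
  have hc: "h \<in> letters \<rightarrow> carrier K"
  proof
    fix l assume "l \<in> letters"
    then have "l \<in> carrier (H (isl l))" by (simp add: H_carrier)
    then show "h l \<in> carrier K" using h[of "isl l"] by (auto simp: hom_def)
  qed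
  have hrel: "word_eval K h u = word_eval K h v" if uv: "(u, v) \<in> rels" for u v
  proof -
    consider b x y where "x \<in> carrier (H b)" "y \<in> carrier (H b)" "u = [x, y]" "v = [x \<otimes>\<^bsub>H b\<^esub> y]"
      | b where "u = [\<one>\<^bsub>H b\<^esub>]" "v = []"
    proof -
      have "(\<exists>b x y. x \<in> carrier (H b) \<and> y \<in> carrier (H b) \<and> u = [x, y] \<and> v = [x \<otimes>\<^bsub>H b\<^esub> y]) \<or> (\<exists>b. u = [\<one>\<^bsub>H b\<^esub>] \<and> v = [])"
        using uv unfolding free_product2_rels_def H_def sum_left_def sum_right_def
        by (elim UnE CollectE exE conjE) (auto intro: exI[of _ True] exI[of _ False])
      then show ?thesis using that by blast
    qed
    then show ?thesis
    proof cases
      case 1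
      then have "h x \<in> carrier K" "h y \<in> carrier K" using h[of b] by (auto simp: hom_def)
      then show ?thesis using 1 hom_mult[OF h[of b]] by (simp add: K.m_assoc)
    next
      case 2
      then show ?thesis using hom_one[OF h[of b] H_group K] by simp
    qed
  qed
  obtain f0 where f0: "f0 \<in> hom F K" "\<And>w. w \<in> lists letters \<Longrightarrow> f0 (word_class letters rels w) = word_eval K h w"
    using word_monoid_universal[OF rels K hc hrel] unfolding free_product2_def by metis
  interpret f0: group_hom F K f0 using f0(1) by unfold_locales
  have f0l: "f0 (word_class letters rels [l]) = h l" if "l \<in> letters" for l
    using f0(2)[of "[l]"] funcset_mem[OF hc that] that by simp
  have "f0 t = \<one>\<^bsub>K\<^esub>" if tT: "t \<in> T" for t
  proof -
    obtain r where r: "r \<in> R" "t = word_class letters rels [emb True r] \<otimes>\<^bsub>F\<^esub> inv\<^bsub>F\<^esub> (word_class letters rels [emb False r])"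
      using tT unfolding T_eq by blast
    have c: "word_class letters rels [emb b r] \<in> carrier F" for b
      using class_closed emb_letters[OF r(1)] by simp
    show ?thesis unfolding r(2) using c f0l emb_letters[OF r(1)] e[OF r(1)] funcset_mem[OF hc] by simp
  qed
  from normal_closure_universal[OF F_group K f0(1) T this] obtain f where f: "f \<in> hom \<Gamma> K"
    "\<And>x. x \<in> carrier F \<Longrightarrow> f (normal_closure F T #>\<^bsub>F\<^esub> x) = f0 x"
    unfolding \<Gamma>_eq by metis
  have "f (j l) = h l" if "l \<in> letters" for l
    using that f(2) class_closed f0l unfolding j_eq by simp
  then show ?thesis using that f(1) by blast
qed

end

context amalgam
begin

subsection \<open>Normal forms\<close>

text \<open>The representative depends on the coset of \<open>x\<close> only, so left multiplication
  by the core leaves it unchanged; the core itself is represented by the identity, so that core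
  elements leave no syllable in a normal form. The remaining factor is recorded by
  \<open>\<rho>\<close> as an element of \<open>R\<close>, which makes it meaningful in both
  factors.\<close>

definition "\<tau> b x = (if x \<in> core b then \<one>\<^bsub>H b\<^esub> else SOME y. y \<in> core b #>\<^bsub>H b\<^esub> x)"
definition "\<rho> b x = inv_into R (emb b) (x \<otimes>\<^bsub>H b\<^esub> inv\<^bsub>H b\<^esub> (\<tau> b x))"

lemma core_sub: "y \<in> core b \<Longrightarrow> y \<in> carrier (H b)" using emb_closed by blast

lemma core_mult_iff:
  assumes r: "r \<in> R" and x: "x \<in> carrier (H b)"
  shows "emb b r \<otimes>\<^bsub>H b\<^esub> x \<in> core b \<longleftrightarrow> x \<in> core b" "x \<otimes>\<^bsub>H b\<^esub> emb b r \<in> core b \<longleftrightarrow> x \<in> core b"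
proof -
  note c = emb_closed[OF r, of b]
  have rc: "emb b r \<in> core b" using r by blast
  note m = subgroup.m_closed[OF core_subgroup[of b]] and i = subgroup.m_inv_closed[OF core_subgroup rc]
  have "inv\<^bsub>H b\<^esub> (emb b r) \<otimes>\<^bsub>H b\<^esub> (emb b r \<otimes>\<^bsub>H b\<^esub> x) = x" using c x by simp
  then show "emb b r \<otimes>\<^bsub>H b\<^esub> x \<in> core b \<longleftrightarrow> x \<in> core b" using m[OF rc, of x] m[OF i, of "emb b r \<otimes>\<^bsub>H b\<^esub> x"] by auto
  have "(x \<otimes>\<^bsub>H b\<^esub> emb b r) \<otimes>\<^bsub>H b\<^esub> inv\<^bsub>H b\<^esub> (emb b r) = x" using c x by (simp add: H.m_assoc)
  then show "x \<otimes>\<^bsub>H b\<^esub> emb b r \<in> core b \<longleftrightarrow> x \<in> core b" using m[OF _ rc, of x] m[OF _ i, of "x \<otimes>\<^bsub>H b\<^esub> emb b r"] by auto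
qed

lemma \<tau>:
  assumes x: "x \<in> carrier (H b)"
  shows "\<tau> b x \<in> carrier (H b)" "x \<otimes>\<^bsub>H b\<^esub> inv\<^bsub>H b\<^esub> (\<tau> b x) \<in> core b"
proof -
  have "\<tau> b x \<in> carrier (H b) \<and> x \<otimes>\<^bsub>H b\<^esub> inv\<^bsub>H b\<^esub> (\<tau> b x) \<in> core b"
  proof (cases "x \<in> core b")
    case True
    then show ?thesis using x by (simp add: \<tau>_def)
  next
    case False
    have "x \<in> core b #>\<^bsub>H b\<^esub> x" by (rule H.rcos_self[OF x core_subgroup])
    then have "(SOME y. y \<in> core b #>\<^bsub>H b\<^esub> x) \<in> core b #>\<^bsub>H b\<^esub> x" by (rule someI)
    then obtain c where c: "c \<in> core b" "\<tau> b x = c \<otimes>\<^bsub>H b\<^esub> x" using False unfolding \<tau>_def r_coset_def by auto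
    have "x \<otimes>\<^bsub>H b\<^esub> inv\<^bsub>H b\<^esub> (c \<otimes>\<^bsub>H b\<^esub> x) = inv\<^bsub>H b\<^esub> c" using core_sub[OF c(1)] x by (simp add: H.inv_mult_group)
    then show ?thesis using c core_sub[OF c(1)] x subgroup.m_inv_closed[OF core_subgroup c(1)] by simp
  qed
  then show "\<tau> b x \<in> carrier (H b)" "x \<otimes>\<^bsub>H b\<^esub> inv\<^bsub>H b\<^esub> (\<tau> b x) \<in> core b" by blast+
qed

lemma \<rho>:
  assumes x: "x \<in> carrier (H b)"
  shows "\<rho> b x \<in> R" "emb b (\<rho> b x) \<otimes>\<^bsub>H b\<^esub> \<tau> b x = x"
proof -
  show "\<rho> b x \<in> R" unfolding \<rho>_def by (rule inv_into_into[OF \<tau>(2)[OF x]])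
  have "emb b (\<rho> b x) = x \<otimes>\<^bsub>H b\<^esub> inv\<^bsub>H b\<^esub> (\<tau> b x)" unfolding \<rho>_def by (rule f_inv_into_f[OF \<tau>(2)[OF x]])
  then show "emb b (\<rho> b x) \<otimes>\<^bsub>H b\<^esub> \<tau> b x = x" using x \<tau>(1)[OF x] by (simp add: H.m_assoc)
qed

lemma \<rho>_unique:
  assumes x: "x \<in> carrier (H b)" and r: "r \<in> R" and e: "x = emb b r \<otimes>\<^bsub>H b\<^esub> \<tau> b x"
  shows "\<rho> b x = r"
proof -
  have "x \<otimes>\<^bsub>H b\<^esub> inv\<^bsub>H b\<^esub> (\<tau> b x) = emb b r \<otimes>\<^bsub>H b\<^esub> \<tau> b x \<otimes>\<^bsub>H b\<^esub> inv\<^bsub>H b\<^esub> (\<tau> b x)" using e by simp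
  also have "\<dots> = emb b r" using emb_closed[OF r] \<tau>(1)[OF x] by (simp add: H.m_assoc)
  finally show ?thesis unfolding \<rho>_def using inv_into_f_f[OF emb_inj r] by simp
qed

lemma \<tau>_emb_mult:
  assumes r: "r \<in> R" and x: "x \<in> carrier (H b)"
  shows "\<tau> b (emb b r \<otimes>\<^bsub>H b\<^esub> x) = \<tau> b x" "\<rho> b (emb b r \<otimes>\<^bsub>H b\<^esub> x) = r \<otimes>\<^bsub>P\<^esub> \<rho> b x"
proof -
  note c = emb_closed[OF r, of b]
  have "core b #>\<^bsub>H b\<^esub> (emb b r \<otimes>\<^bsub>H b\<^esub> x) = core b #>\<^bsub>H b\<^esub> x"
    by (rule iffD2[OF H.r_coset_eq_iff[OF core_subgroup]]) (use c x r in \<open>simp_all add: H.m_assoc\<close>)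
  then show t: "\<tau> b (emb b r \<otimes>\<^bsub>H b\<^esub> x) = \<tau> b x" unfolding \<tau>_def core_mult_iff(1)[OF r x] by simp
  show "\<rho> b (emb b r \<otimes>\<^bsub>H b\<^esub> x) = r \<otimes>\<^bsub>P\<^esub> \<rho> b x"
  proof (rule \<rho>_unique)
    show "emb b r \<otimes>\<^bsub>H b\<^esub> x \<in> carrier (H b)" using c x by simp
    show "r \<otimes>\<^bsub>P\<^esub> \<rho> b x \<in> R" by (rule R_closed(2)[OF r \<rho>(1)[OF x]])
    have "emb b (r \<otimes>\<^bsub>P\<^esub> \<rho> b x) \<otimes>\<^bsub>H b\<^esub> \<tau> b x = emb b r \<otimes>\<^bsub>H b\<^esub> (emb b (\<rho> b x) \<otimes>\<^bsub>H b\<^esub> \<tau> b x)"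
      unfolding emb_mult[OF r \<rho>(1)[OF x]] using c emb_closed[OF \<rho>(1)[OF x]] \<tau>(1)[OF x] by (simp add: H.m_assoc)
    then show "emb b r \<otimes>\<^bsub>H b\<^esub> x = emb b (r \<otimes>\<^bsub>P\<^esub> \<rho> b x) \<otimes>\<^bsub>H b\<^esub> \<tau> b (emb b r \<otimes>\<^bsub>H b\<^esub> x)"
      unfolding t \<rho>(2)[OF x] by simp
  qed
qed

lemma \<rho>_emb: assumes r: "r \<in> R" shows "\<rho> b (emb b r) = r" "\<tau> b (emb b r) = \<one>\<^bsub>H b\<^esub>"
proof -
  show t: "\<tau> b (emb b r) = \<one>\<^bsub>H b\<^esub>" unfolding \<tau>_def using r by simp
  show "\<rho> b (emb b r) = r" by (rule \<rho>_unique[OF emb_closed[OF r] r]) (use t emb_closed[OF r] in simp)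
qed

definition "transversal b = {t \<in> carrier (H b). t \<notin> core b \<and> \<tau> b t = t}"

lemma \<tau>_transversal:
  assumes x: "x \<in> carrier (H b)" "x \<notin> core b"
  shows "\<tau> b x \<in> transversal b"
proof -
  have "\<tau> b x \<notin> core b"
    using core_mult_iff(1)[OF \<rho>(1)[OF x(1)] \<tau>(1)[OF x(1)]] \<rho>(2)[OF x(1)] x(2) by simp
  moreover have "\<tau> b (\<tau> b x) = \<tau> b x"
    using \<tau>_emb_mult(1)[OF \<rho>(1)[OF x(1)] \<tau>(1)[OF x(1)]] \<rho>(2)[OF x(1)] by simp
  ultimately show ?thesis unfolding transversal_def using \<tau>(1)[OF x(1)] by blast
qed

lemma transversal:
  assumes "t \<in> transversal b"
  shows "t \<in> carrier (H b)" "t \<notin> core b" "\<tau> b t = t" "\<rho> b t = \<one>\<^bsub>P\<^esub>" "isl t = b"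
proof -
  show t: "t \<in> carrier (H b)" "t \<notin> core b" "\<tau> b t = t" using assms unfolding transversal_def by auto
  show "isl t = b" using t(1) by (simp add: H_carrier)
  show "\<rho> b t = \<one>\<^bsub>P\<^esub>" by (rule \<rho>_unique[OF t(1) R_closed(1)]) (use t in \<open>simp add: emb_one\<close>)
qed

definition "alternating = successively (\<lambda>x y :: 'a + 'b. isl x \<noteq> isl y)"
definition "tails = {ts. (\<forall>t\<in>set ts. t \<in> transversal (isl t)) \<and> alternating ts}"
definition "tails' b = {ts \<in> tails. ts \<noteq> [] \<longrightarrow> isl (hd ts) \<noteq> b}"
text \<open>\<open>\<theta> b\<close> and \<open>dec b\<close> are inverse bijections between normal
  forms and pairs of an element of \<open>H b\<close> and a tail that does not begin in
  \<open>H b\<close>: \<open>dec\<close> absorbs a leading syllable of the factor,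
  \<open>\<theta>\<close> splits it off again.\<close>

definition "\<theta> b x ts = (if x \<in> core b then (\<rho> b x, ts) else (\<rho> b x, \<tau> b x # ts))"
definition "dec b z = (case z of (r, []) \<Rightarrow> (emb b r, [])
  | (r, t # ts) \<Rightarrow> if isl t = b then (emb b r \<otimes>\<^bsub>H b\<^esub> t, ts) else (emb b r, t # ts))"
definition "NF = R \<times> tails"

lemma alternating_simps: "alternating []" "alternating (t # ts) \<longleftrightarrow> (ts \<noteq> [] \<longrightarrow> isl t \<noteq> isl (hd ts)) \<and> alternating ts"
  by (auto simp: alternating_def successively_Cons)

lemma \<theta>_NF:
  assumes x: "x \<in> carrier (H b)" and ts: "ts \<in> tails' b"
  shows "\<theta> b x ts \<in> NF" "dec b (\<theta> b x ts) = (x, ts)"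
proof -
  have "\<theta> b x ts \<in> NF \<and> dec b (\<theta> b x ts) = (x, ts)"
  proof (cases "x \<in> core b")
    case True
    have "emb b (\<rho> b x) = x" using \<rho>(2)[OF x] True emb_closed[OF \<rho>(1)[OF x]] by (simp add: \<tau>_def)
    then show ?thesis using True ts \<rho>(1)[OF x]
      by (cases ts) (auto simp: \<theta>_def dec_def NF_def tails'_def)
  next
    case False
    note t = transversal[OF \<tau>_transversal[OF x False]]
    have "\<tau> b x # ts \<in> tails" using ts t(5) \<tau>_transversal[OF x False]
      by (auto simp: tails_def tails'_def alternating_simps)
    then show ?thesis using False \<rho>[OF x] t(5) by (simp add: \<theta>_def dec_def NF_def)
  qed
  then show "\<theta> b x ts \<in> NF" "dec b (\<theta> b x ts) = (x, ts)" by blast+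
qed

lemma dec_NF:
  assumes z: "z \<in> NF"
  shows "fst (dec b z) \<in> carrier (H b)" "snd (dec b z) \<in> tails' b" "\<theta> b (fst (dec b z)) (snd (dec b z)) = z"
proof -
  obtain r ts where rts: "z = (r, ts)" "r \<in> R" "ts \<in> tails" using z unfolding NF_def by auto
  have "fst (dec b z) \<in> carrier (H b) \<and> snd (dec b z) \<in> tails' b \<and> \<theta> b (fst (dec b z)) (snd (dec b z)) = z"
  proof (cases "\<exists>t ts'. ts = t # ts' \<and> isl t = b")
    case True
    then obtain t ts' where t: "ts = t # ts'" "isl t = b" by blast
    have tt: "t \<in> transversal b" using rts(3) t by (auto simp: tails_def)
    note t' = transversal[OF tt]
    have "ts' \<in> tails' b" using rts(3) t by (auto simp: tails'_def tails_def alternating_simps)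
    moreover have "\<theta> b (emb b r \<otimes>\<^bsub>H b\<^esub> t) ts' = (r, ts)"
      unfolding \<theta>_def core_mult_iff(1)[OF rts(2) t'(1)] \<tau>_emb_mult[OF rts(2) t'(1)]
      using t t' R_sub[OF rts(2)] by simp
    ultimately show ?thesis using rts t emb_closed[OF rts(2)] t'(1) by (simp add: dec_def)
  next
    case False
    then have "dec b z = (emb b r, ts)" unfolding rts(1) dec_def by (cases ts) auto
    moreover have "ts \<in> tails' b" using False rts(3) by (cases ts) (auto simp: tails'_def)
    ultimately show ?thesis using rts emb_closed[OF rts(2)] \<rho>_emb[OF rts(2)] by (simp add: \<theta>_def)
  qed
  then show "fst (dec b z) \<in> carrier (H b)" "snd (dec b z) \<in> tails' b" "\<theta> b (fst (dec b z)) (snd (dec b z)) = z"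
    by blast+
qed

text \<open>Van der Waerden's trick: left multiplication on the first component of the pair is
  transported to normal forms, so the action laws within a factor hold at once and no case analysis
  of reductions arises. Outside \<open>NF\<close> the identity is chosen to obtain permutations of
  the whole type.\<close>

definition "act a z = (if z \<in> NF then \<theta> (isl a) (a \<otimes>\<^bsub>H (isl a)\<^esub> fst (dec (isl a) z)) (snd (dec (isl a) z)) else z)"

lemma act_NF:
  assumes a: "a \<in> carrier (H b)" and z: "z \<in> NF"
  shows "act a z \<in> NF" "dec b (act a z) = (a \<otimes>\<^bsub>H b\<^esub> fst (dec b z), snd (dec b z))"
proof -
  have ab: "isl a = b" using a by (simp add: H_carrier)
  have "a \<otimes>\<^bsub>H b\<^esub> fst (dec b z) \<in> carrier (H b)" using a dec_NF(1)[OF z] by simp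
  from \<theta>_NF[OF this dec_NF(2)[OF z]] show "act a z \<in> NF" "dec b (act a z) = (a \<otimes>\<^bsub>H b\<^esub> fst (dec b z), snd (dec b z))"
    unfolding act_def ab using z by simp_all
qed

lemma act_mult:
  assumes a: "a \<in> carrier (H b)" and a': "a' \<in> carrier (H b)"
  shows "act (a \<otimes>\<^bsub>H b\<^esub> a') z = act a (act a' z)"
proof (cases "z \<in> NF")
  case True
  have "isl a = b" "isl (a \<otimes>\<^bsub>H b\<^esub> a') = b" using a a' H.m_closed[OF a a'] by (simp_all add: H_carrier)
  then show ?thesis
    unfolding act_def[of "a \<otimes>\<^bsub>H b\<^esub> a'"] act_def[of a] using True act_NF[OF a' True] a a' dec_NF(1)[OF True, of b]
    by (simp add: H.m_assoc)
qed (simp add: act_def)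

lemma act_one: "act \<one>\<^bsub>H b\<^esub> z = z"
proof -
  have "isl \<one>\<^bsub>H b\<^esub> = b" using H.one_closed[of b] unfolding H_carrier by blast
  then show ?thesis unfolding act_def using dec_NF[of z b] by simp
qed

lemma act_permutes: assumes a: "a \<in> carrier (H b)" shows "act a permutes NF"
proof -
  have "act (inv\<^bsub>H b\<^esub> a) \<circ> act a = id" "act a \<circ> act (inv\<^bsub>H b\<^esub> a) = id"
    using act_mult[OF H.inv_closed[OF a] a] act_mult[OF a H.inv_closed[OF a]] act_one a by (auto simp: fun_eq_iff)
  then have "bij (act a)" by (rule o_bij)
  then show ?thesis unfolding permutes_def bij_iff by (simp add: act_def)
qed

text \<open>The result does not mention \<open>b\<close>, so the two copies of \<open>R\<close> act
  alike; this is the condition under which the actions of the factors combine to one of the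
  amalgam.\<close>

lemma act_emb: assumes r: "r \<in> R" and z: "z \<in> NF" shows "act (emb b r) z = (r \<otimes>\<^bsub>P\<^esub> fst z, snd z)"
proof -
  note d = dec_NF[OF z, of b]
  have "act (emb b r) z = \<theta> b (emb b r \<otimes>\<^bsub>H b\<^esub> fst (dec b z)) (snd (dec b z))"
    unfolding act_def using z by simp
  also have "\<dots> = (r \<otimes>\<^bsub>P\<^esub> fst (\<theta> b (fst (dec b z)) (snd (dec b z))), snd (\<theta> b (fst (dec b z)) (snd (dec b z))))"
    unfolding \<theta>_def core_mult_iff(1)[OF r d(1)] \<tau>_emb_mult[OF r d(1)] by simp
  finally show ?thesis unfolding d(3) .
qed

definition "reduced w \<longleftrightarrow> w \<in> lists letters \<and> (\<forall>l\<in>set w. l \<notin> core (isl l)) \<and> alternating w"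

lemma reduced_simps: "reduced []" "reduced (l # w) \<longleftrightarrow>
   l \<in> letters \<and> l \<notin> core (isl l) \<and> (w \<noteq> [] \<longrightarrow> isl l \<noteq> isl (hd w)) \<and> reduced w"
  by (auto simp: reduced_def alternating_simps)

lemma act_representation:
  obtains \<Phi> where "\<Phi> \<in> hom \<Gamma> (permutation_group NF)" "\<And>l. l \<in> letters \<Longrightarrow> \<Phi> (j l) = act l"
proof (rule \<Gamma>_universal[OF group_permutation_group, of act NF])
  show "act \<in> hom (H b) (permutation_group NF)" for b
    by (rule homI) (auto simp: act_permutes act_mult fun_eq_iff)
  show "act (emb True r) = act (emb False r)" if r: "r \<in> R" for r
  proof
    show "act (emb True r) z = act (emb False r) z" for z
      using act_emb[OF r] by (cases "z \<in> NF") (simp_all add: act_def)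
  qed
qed (use that in blast)

text \<open>\<open>nf x\<close> is the tail obtained when \<open>x\<close> acts on the empty normal form.\<close>

lemma normal_form:
  obtains nf where "\<And>w. w \<in> lists letters \<Longrightarrow> length (nf (word_eval \<Gamma> j w)) \<le> length w"
    "\<And>w. reduced w \<Longrightarrow> length (nf (word_eval \<Gamma> j w)) = length w"
    "\<And>w. reduced w \<Longrightarrow> w \<noteq> [] \<Longrightarrow> isl (hd (nf (word_eval \<Gamma> j w)) :: 'a + 'b) = isl (hd w)"
    "\<And>r b. r \<in> R \<Longrightarrow> nf (j (emb b r)) = []"
    "\<And>l b. l \<in> carrier (H b) \<Longrightarrow> j l = \<one>\<^bsub>\<Gamma>\<^esub> \<Longrightarrow> l = \<one>\<^bsub>H b\<^esub>"
proof -
  obtain \<Phi> where \<Phi>: "\<Phi> \<in> hom \<Gamma> (permutation_group NF)" "\<And>l. l \<in> letters \<Longrightarrow> \<Phi> (j l) = act l"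
    using act_representation by metis
  let ?o = "(\<one>\<^bsub>P\<^esub>, [])"
  have o: "?o \<in> NF" unfolding NF_def tails_def using R_closed(1) by (simp add: alternating_simps)
  have \<Phi>1: "\<Phi> \<one>\<^bsub>\<Gamma>\<^esub> = id" using hom_one[OF \<Phi>(1) \<Gamma>_group group_permutation_group] by simp
  have \<Phi>m: "\<Phi> (j l \<otimes>\<^bsub>\<Gamma>\<^esub> word_eval \<Gamma> j w) z = act l (\<Phi> (word_eval \<Gamma> j w) z)" if "l \<in> letters" "w \<in> lists letters" for l w z
    using hom_mult[OF \<Phi>(1) funcset_mem[OF j_closed that(1)] \<Gamma>.word_eval_closed[OF j_closed that(2)]] \<Phi>(2)[OF that(1)] by simp
  define nf where "nf x = snd (\<Phi> x ?o)" for x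
  have \<Phi>l: "\<Phi> (j l) z = act l z" if "l \<in> letters" for l z using \<Phi>(2)[OF that] by simp
  \<comment> \<open>\<open>dec\<close> never lengthens the tail and \<open>\<theta>\<close> adds at
    most one syllable.\<close>
  have len: "\<Phi> (word_eval \<Gamma> j w) ?o \<in> NF \<and> length (nf (word_eval \<Gamma> j w)) \<le> length w" if "w \<in> lists letters" for w
    using that
  proof (induction w)
    case Nil
    then show ?case unfolding nf_def using \<Phi>1 o by simp
  next
    case (Cons l w)
    let ?z = "\<Phi> (word_eval \<Gamma> j w) ?o"
    have lH: "l \<in> carrier (H (isl l))" using Cons.hyps by (simp add: H_carrier)
    have z: "?z \<in> NF" using Cons.IH by blast
    have "length (snd (dec (isl l) ?z)) \<le> length (snd ?z)" by (auto simp: dec_def split: prod.split list.split)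
    then have "length (snd (act l ?z)) \<le> Suc (length (snd ?z))" unfolding act_def \<theta>_def using z by simp
    then show ?case using \<Phi>m[OF Cons.hyps] Cons.IH act_NF(1)[OF lH z] unfolding nf_def by simp
  qed
  have red: "\<Phi> (word_eval \<Gamma> j w) ?o \<in> NF \<and> length (nf (word_eval \<Gamma> j w)) = length w \<and>
      (w \<noteq> [] \<longrightarrow> isl (hd (nf (word_eval \<Gamma> j w))) = isl (hd w))" if "reduced w" for w
    using that
  proof (induction w)
    case Nil
    then show ?case unfolding nf_def using \<Phi>1 o by simp
  next
    case (Cons l w)
    have L: "l \<in> letters" "w \<in> lists letters" "reduced w" "l \<notin> core (isl l)" "w \<noteq> [] \<Longrightarrow> isl l \<noteq> isl (hd w)"
      using Cons.prems unfolding reduced_def by (auto simp: alternating_simps)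
    let ?z = "\<Phi> (word_eval \<Gamma> j w) ?o"
    have lH: "l \<in> carrier (H (isl l))" using L(1) by (simp add: H_carrier)
    have z: "?z \<in> NF" using Cons.IH[OF L(3)] by blast
    obtain r ts where rts: "?z = (r, ts)" by (cases ?z) auto
    have r: "r \<in> R" using z rts unfolding NF_def by simp
    have ts: "length ts = length w" "w \<noteq> [] \<Longrightarrow> isl (hd ts) = isl (hd w)"
      using Cons.IH[OF L(3)] rts unfolding nf_def by auto
    \<comment> \<open>The tail starts in the other factor, so nothing is absorbed; and
      \<open>l\<close> times an element of the core is still outside the core, so exactly one
      syllable is added.\<close>
    have "dec (isl l) ?z = (emb (isl l) r, ts)"
    proof (cases ts)
      case (Cons t ts')
      then have "w \<noteq> []" using ts by auto
      then have "isl t \<noteq> isl l" using ts(2) L(5) Cons by auto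
      then show ?thesis using rts Cons by (simp add: dec_def)
    qed (simp add: rts dec_def)
    then have "act l ?z = (\<rho> (isl l) (l \<otimes>\<^bsub>H (isl l)\<^esub> emb (isl l) r), \<tau> (isl l) (l \<otimes>\<^bsub>H (isl l)\<^esub> emb (isl l) r) # ts)"
      unfolding act_def \<theta>_def using z core_mult_iff(2)[OF r lH] L(4) by simp
    moreover have "l \<otimes>\<^bsub>H (isl l)\<^esub> emb (isl l) r \<in> carrier (H (isl l))" using lH emb_closed[OF r] by simp
    then have "isl (\<tau> (isl l) (l \<otimes>\<^bsub>H (isl l)\<^esub> emb (isl l) r)) = isl l" using \<tau>(1) H_carrier by blast
    ultimately show ?case using \<Phi>m[OF L(1,2)] act_NF(1)[OF lH z] ts(1) unfolding nf_def by simp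
  qed
  show ?thesis
  proof (rule that[of nf])
    show "nf (j (emb b r)) = []" if r: "r \<in> R" for r b
      unfolding nf_def \<Phi>l[OF emb_letters[OF r]] act_emb[OF r o] by simp
    show "l = \<one>\<^bsub>H b\<^esub>" if l: "l \<in> carrier (H b)" and j1: "j l = \<one>\<^bsub>\<Gamma>\<^esub>" for l b
    proof -
      have ab: "isl l = b" and lL: "l \<in> letters" using l by (simp_all add: H_carrier)
      \<comment> \<open>A letter acting on the trivial normal form can be read off from the result,
        so the factors embed.\<close>
      have "dec b ?o = (emb b \<one>\<^bsub>P\<^esub>, [])" by (simp add: dec_def)
      then have "act l ?o = \<theta> b l []" unfolding act_def ab using o l by (simp add: emb_one)
      moreover have "act l ?o = ?o" using \<Phi>l[OF lL, of ?o] \<Phi>1 j1 by simp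
      ultimately have "l \<in> core b" "\<rho> b l = \<one>\<^bsub>P\<^esub>" unfolding \<theta>_def by (auto split: if_splits)
      then show ?thesis using \<rho>_emb(1) emb_one by (metis imageE)
    qed
  qed (use len red in blast)+
qed

lemma j_one_iff: "l \<in> carrier (H b) \<Longrightarrow> j l = \<one>\<^bsub>\<Gamma>\<^esub> \<longleftrightarrow> l = \<one>\<^bsub>H b\<^esub>"
  using normal_form hom_one[OF j_hom H_group \<Gamma>_group] by metis

subsection \<open>Minimal words\<close>

text \<open>A letter of the core has a twin in the other factor with the same image, so it can be
  multiplied with a neighbour from either factor.\<close>

lemma merge_letters:
  assumes a: "a \<in> letters" and b: "b \<in> letters"
    and m: "isl a = isl b \<or> a \<in> core (isl a) \<or> b \<in> core (isl b)"
  shows "\<exists>c\<in>letters. j a \<otimes>\<^bsub>\<Gamma>\<^esub> j b = j c"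
proof -
  have aH: "a \<in> carrier (H (isl a))" and bH: "b \<in> carrier (H (isl b))" using a b by (simp_all add: H_carrier)
  have same: "\<exists>c\<in>letters. j x \<otimes>\<^bsub>\<Gamma>\<^esub> j y = j c" if "x \<in> carrier (H i)" "y \<in> carrier (H i)" for x y i
  proof -
    have "x \<otimes>\<^bsub>H i\<^esub> y \<in> letters" using H.m_closed[OF that] H_carrier by blast
    then show ?thesis using hom_mult[OF j_hom that] by metis
  qed
  from m show ?thesis
  proof (elim disjE)
    assume "isl a = isl b"
    then show ?thesis using same[OF aH] bH by simp
  next
    assume "a \<in> core (isl a)"
    then obtain r where r: "r \<in> R" "a = emb (isl a) r" by blast
    then have "j a = j (emb (isl b) r)" using j_emb by metis
    then show ?thesis using same[OF emb_closed[OF r(1)] bH] by simp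
  next
    assume "b \<in> core (isl b)"
    then obtain r where r: "r \<in> R" "b = emb (isl b) r" by blast
    then have "j b = j (emb (isl a) r)" using j_emb by metis
    then show ?thesis using same[OF aH emb_closed[OF r(1)]] by simp
  qed
qed

text \<open>Any neighbouring pair that violates reducedness could be merged. The length bound is
  there because a single letter of the core has no neighbour to be merged with.\<close>

lemma minimal_word_reduced:
  assumes w: "w \<in> lists letters" and len: "length w \<ge> 2"
    and min: "\<And>w'. \<lbrakk>w' \<in> lists letters; word_eval \<Gamma> j w' = word_eval \<Gamma> j w\<rbrakk> \<Longrightarrow> length w \<le> length w'"
  shows "reduced w"
proof -
  note app = \<Gamma>.word_eval_append[OF j_closed] and cl = \<Gamma>.word_eval_closed[OF j_closed]
  have pair: "isl a \<noteq> isl b \<and> a \<notin> core (isl a) \<and> b \<notin> core (isl b)" if s: "w = p @ [a, b] @ s" for p a b s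
  proof (rule ccontr)
    assume no: "\<not> ?thesis"
    have L: "p \<in> lists letters" "a \<in> letters" "b \<in> letters" "s \<in> lists letters" using w unfolding s by auto
    obtain c where c: "c \<in> letters" "j a \<otimes>\<^bsub>\<Gamma>\<^esub> j b = j c" using merge_letters[OF L(2,3)] no by blast
    have L': "p @ [c] @ s \<in> lists letters" using L c by simp
    have "word_eval \<Gamma> j w = word_eval \<Gamma> j p \<otimes>\<^bsub>\<Gamma>\<^esub> ((j a \<otimes>\<^bsub>\<Gamma>\<^esub> j b) \<otimes>\<^bsub>\<Gamma>\<^esub> word_eval \<Gamma> j s)"
      unfolding s using L funcset_mem[OF j_closed] cl by (simp add: app \<Gamma>.m_assoc)
    also have "\<dots> = word_eval \<Gamma> j (p @ [c] @ s)" unfolding c(2) using L c app by simp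
    finally show False using min[OF L'] by (simp add: s)
  qed
  have nth: "isl (w ! i) \<noteq> isl (w ! Suc i) \<and> w ! i \<notin> core (isl (w ! i)) \<and> w ! Suc i \<notin> core (isl (w ! Suc i))"
    if i: "Suc i < length w" for i
  proof (rule pair)
    show "w = take i w @ [w ! i, w ! Suc i] @ drop (Suc (Suc i)) w"
      using id_take_nth_drop[of i w] Cons_nth_drop_Suc[OF i] i by simp
  qed
  have "l \<notin> core (isl l)" if lw: "l \<in> set w" for l
  proof -
    obtain i where i: "i < length w" "l = w ! i" using lw by (auto simp: in_set_conv_nth)
    show ?thesis
    proof (cases "Suc i < length w")
      case True
      then show ?thesis using nth i by blast
    next
      case False
      then obtain i' where "i = Suc i'" using i len by (cases i) auto
      then show ?thesis using nth[of i'] i by blast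
    qed
  qed
  moreover have "alternating w" unfolding alternating_def successively_conv_nth using nth by blast
  ultimately show ?thesis unfolding reduced_def using w by blast
qed

end

section \<open>Amalgams of finite groups\<close>

text \<open>A free action of a subgroup on a finite set is a disjoint union of regular orbits, so it
  extends to the whole group as soon as the number of orbits is right.\<close>

lemma extend_free_action:
  fixes \<beta> :: "'x \<Rightarrow> 'z \<Rightarrow> 'z"
  assumes A: "group A" and fA: "finite (carrier A)" and C: "subgroup C A" and fZ: "finite Z"
    and closed: "\<And>c z. c \<in> C \<Longrightarrow> z \<in> Z \<Longrightarrow> \<beta> c z \<in> Z"
    and one: "\<And>z. z \<in> Z \<Longrightarrow> \<beta> \<one>\<^bsub>A\<^esub> z = z"
    and mult: "\<And>c c' z. \<lbrakk>c \<in> C; c' \<in> C; z \<in> Z\<rbrakk> \<Longrightarrow> \<beta> (c \<otimes>\<^bsub>A\<^esub> c') z = \<beta> c (\<beta> c' z)"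
    and free: "\<And>c z. \<lbrakk>c \<in> C; z \<in> Z; \<beta> c z = z\<rbrakk> \<Longrightarrow> c = \<one>\<^bsub>A\<^esub>"
    and dvd: "card (carrier A) dvd card Z"
  obtains \<alpha> where "\<And>a z. a \<in> carrier A \<Longrightarrow> z \<in> Z \<Longrightarrow> \<alpha> a z \<in> Z"
    "\<And>z. z \<in> Z \<Longrightarrow> \<alpha> \<one>\<^bsub>A\<^esub> z = z"
    "\<And>a a' z. \<lbrakk>a \<in> carrier A; a' \<in> carrier A; z \<in> Z\<rbrakk> \<Longrightarrow> \<alpha> (a \<otimes>\<^bsub>A\<^esub> a') z = \<alpha> a (\<alpha> a' z)"
    "\<And>c z. c \<in> C \<Longrightarrow> z \<in> Z \<Longrightarrow> \<alpha> c z = \<beta> c z"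
proof -
  interpret A: group A by fact
  have CA: "c \<in> carrier A" if "c \<in> C" for c using subgroup.subset[OF C] that by blast
  note C1 = subgroup.one_closed[OF C] and Cm = subgroup.m_closed[OF C] and Ci = subgroup.m_inv_closed[OF C]
  have fC: "finite C" by (rule finite_subset[OF subgroup.subset[OF C] fA])
  define orb where "orb z = (\<lambda>c. \<beta> c z) ` C" for z
  have cancel: "c = c'" if "c \<in> C" "c' \<in> C" "z \<in> Z" "\<beta> c z = \<beta> c' z" for c c' z
  proof -
    have "\<beta> (inv\<^bsub>A\<^esub> c \<otimes>\<^bsub>A\<^esub> c') z = \<beta> (inv\<^bsub>A\<^esub> c) (\<beta> c z)" using that mult[OF Ci] by simp
    also have "\<dots> = \<beta> (inv\<^bsub>A\<^esub> c \<otimes>\<^bsub>A\<^esub> c) z" using mult[OF Ci[OF that(1)] that(1,3)] by simp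
    also have "\<dots> = z" using CA[OF that(1)] one[OF that(3)] by simp
    finally have "inv\<^bsub>A\<^esub> c \<otimes>\<^bsub>A\<^esub> c' = \<one>\<^bsub>A\<^esub>" using free[OF Cm[OF Ci[OF that(1)] that(2)] that(3)] by blast
    then have "c \<otimes>\<^bsub>A\<^esub> (inv\<^bsub>A\<^esub> c \<otimes>\<^bsub>A\<^esub> c') = c" using CA[OF that(1)] by simp
    then show ?thesis using CA[OF that(1)] CA[OF that(2)] by simp
  qed
  have orb_eq: "orb (\<beta> c z) = orb z" if c: "c \<in> C" and z: "z \<in> Z" for c z
  proof (intro equalityI subsetI)
    fix y assume "y \<in> orb (\<beta> c z)"
    then obtain c' where "c' \<in> C" "y = \<beta> c' (\<beta> c z)" unfolding orb_def by blast
    then have "y = \<beta> (c' \<otimes>\<^bsub>A\<^esub> c) z" "c' \<otimes>\<^bsub>A\<^esub> c \<in> C" using mult c z Cm by auto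
    then show "y \<in> orb z" unfolding orb_def by blast
  next
    fix y assume "y \<in> orb z"
    then obtain c' where c': "c' \<in> C" "y = \<beta> c' z" unfolding orb_def by blast
    have "\<beta> (c' \<otimes>\<^bsub>A\<^esub> inv\<^bsub>A\<^esub> c) (\<beta> c z) = \<beta> (c' \<otimes>\<^bsub>A\<^esub> inv\<^bsub>A\<^esub> c \<otimes>\<^bsub>A\<^esub> c) z"
      using mult[OF Cm[OF c'(1) Ci[OF c]] c z] by simp
    also have "\<dots> = y" using c' CA[OF c] CA[OF c'(1)] by (simp add: A.m_assoc)
    finally show "y \<in> orb (\<beta> c z)" unfolding orb_def using Cm[OF c'(1) Ci[OF c]] by (metis imageI)
  qed
  have orb_self: "z \<in> orb z" if "z \<in> Z" for z unfolding orb_def using one[OF that] C1 by (metis imageI)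
  have orb_sub: "orb z \<subseteq> Z" if "z \<in> Z" for z unfolding orb_def using closed that by blast
  have orb_mem: "orb y = orb z" if "y \<in> orb z" "z \<in> Z" for y z
  proof -
    obtain c where "c \<in> C" "y = \<beta> c z" using \<open>y \<in> orb z\<close> unfolding orb_def by blast
    then show ?thesis using orb_eq[OF _ \<open>z \<in> Z\<close>] by simp
  qed
  \<comment> \<open>Freeness makes all orbits as large as \<open>C\<close>; comparison with
    Lagrange's theorem shows that there are exactly \<open>q\<close> orbits for each coset of
    \<open>C\<close> in \<open>A\<close>, as in \<open>q\<close> copies of \<open>A\<close>.\<close>
  have "card C * card (orb ` Z) = card (\<Union> (orb ` Z))"
  proof (rule card_partition)
    show "finite (orb ` Z)" using fZ by simp
    show "finite (\<Union> (orb ` Z))" using fC fZ unfolding orb_def by simp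
    show "card X = card C" if "X \<in> orb ` Z" for X
    proof -
      obtain z where z: "z \<in> Z" "X = orb z" using \<open>X \<in> orb ` Z\<close> by blast
      have "inj_on (\<lambda>c. \<beta> c z) C" using cancel z(1) by (auto intro: inj_onI)
      then show ?thesis unfolding z(2) orb_def by (rule card_image)
    qed
    show "X \<inter> X' = {}" if "X \<in> orb ` Z" "X' \<in> orb ` Z" "X \<noteq> X'" for X X'
      using that orb_mem by (metis disjoint_iff imageE)
  qed
  moreover have "\<Union> (orb ` Z) = Z" using orb_self orb_sub by blast
  ultimately have c1: "card C * card (orb ` Z) = card Z" by simp
  obtain q where q: "card Z = card (carrier A) * q" using dvd by blast
  have "card (rcosets\<^bsub>A\<^esub> C) * card C = card (carrier A)" using A.lagrange[OF C] by (simp add: order_def)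
  then have "card C * card (orb ` Z) = card C * (card (rcosets\<^bsub>A\<^esub> C) * q)"
    unfolding c1 q by (metis mult.assoc mult.commute)
  moreover have "card C > 0" using fC C1 by (auto simp: card_gt_0_iff)
  ultimately have cards: "card (orb ` Z) = card ((rcosets\<^bsub>A\<^esub> C) \<times> {..<q})"
    by (simp add: card_cartesian_product)
  have frc: "finite (rcosets\<^bsub>A\<^esub> C)" using fA by (simp add: RCOSETS_def)
  then obtain \<psi> where \<psi>: "bij_betw \<psi> ((rcosets\<^bsub>A\<^esub> C) \<times> {..<q}) (orb ` Z)"
    using finite_same_card_bij[OF _ _ cards[symmetric]] fZ by auto
  define t where "t U = (SOME a. a \<in> U)" for U :: "'x set"
  define s where "s X = (SOME z. z \<in> X)" for X :: "'z set"
  have rc: "C #>\<^bsub>A\<^esub> a \<in> rcosets\<^bsub>A\<^esub> C" if "a \<in> carrier A" for a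
    using A.rcosetsI[OF subgroup.subset[OF C] that] .
  have t: "t (C #>\<^bsub>A\<^esub> a) \<in> carrier A \<and> a \<otimes>\<^bsub>A\<^esub> inv\<^bsub>A\<^esub> (t (C #>\<^bsub>A\<^esub> a)) \<in> C" if a: "a \<in> carrier A" for a
  proof -
    have "a \<in> C #>\<^bsub>A\<^esub> a" by (rule A.rcos_self[OF a C])
    then have "t (C #>\<^bsub>A\<^esub> a) \<in> C #>\<^bsub>A\<^esub> a" unfolding t_def by (rule someI)
    then obtain c where c: "c \<in> C" "t (C #>\<^bsub>A\<^esub> a) = c \<otimes>\<^bsub>A\<^esub> a" unfolding r_coset_def by blast
    have "a \<otimes>\<^bsub>A\<^esub> inv\<^bsub>A\<^esub> (c \<otimes>\<^bsub>A\<^esub> a) = inv\<^bsub>A\<^esub> c" using CA[OF c(1)] a by (simp add: A.inv_mult_group)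
    then show ?thesis using c CA[OF c(1)] a Ci[OF c(1)] by simp
  qed
  have s: "s X \<in> Z \<and> orb (s X) = X" if X: "X \<in> orb ` Z" for X
  proof -
    obtain z where z: "z \<in> Z" "X = orb z" using X by blast
    then have "s X \<in> X" unfolding s_def using orb_self[OF z(1)] by (metis someI)
    then show ?thesis using z orb_mem orb_sub by blast
  qed
  \<comment> \<open>A bijection from \<open>q\<close> copies of \<open>A\<close> onto
    \<open>Z\<close>: the point for \<open>(a, i)\<close> is reached from the chosen base point of
    its orbit by the element of \<open>C\<close> that takes the coset representative to
    \<open>a\<close>. It is equivariant under \<open>C\<close>, so left multiplication in
    \<open>A\<close>, transported to \<open>Z\<close>, extends \<open>\<beta>\<close>.\<close>
  define \<kappa> where "\<kappa> = (\<lambda>(a, i). \<beta> (a \<otimes>\<^bsub>A\<^esub> inv\<^bsub>A\<^esub> (t (C #>\<^bsub>A\<^esub> a))) (s (\<psi> (C #>\<^bsub>A\<^esub> a, i))))"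
  have \<psi>_in: "\<psi> (C #>\<^bsub>A\<^esub> a, i) \<in> orb ` Z" if "a \<in> carrier A" "i < q" for a i
    using bij_betwE[OF \<psi>] rc[OF that(1)] that(2) by blast
  have \<kappa>_Z: "\<kappa> (a, i) \<in> Z" "orb (\<kappa> (a, i)) = \<psi> (C #>\<^bsub>A\<^esub> a, i)" if "a \<in> carrier A" "i < q" for a i
    using s[OF \<psi>_in[OF that]] t[OF that(1)] closed orb_eq by (auto simp: \<kappa>_def)
  have \<kappa>_C: "\<kappa> (c \<otimes>\<^bsub>A\<^esub> a, i) = \<beta> c (\<kappa> (a, i))" if c: "c \<in> C" and a: "a \<in> carrier A" "i < q" for c a i
  proof -
    have "C #>\<^bsub>A\<^esub> (c \<otimes>\<^bsub>A\<^esub> a) = C #>\<^bsub>A\<^esub> a"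
      by (rule iffD2[OF A.r_coset_eq_iff[OF C]]) (use CA[OF c] a c in \<open>simp_all add: A.m_assoc\<close>)
    moreover have "c \<otimes>\<^bsub>A\<^esub> a \<otimes>\<^bsub>A\<^esub> inv\<^bsub>A\<^esub> (t (C #>\<^bsub>A\<^esub> a)) = c \<otimes>\<^bsub>A\<^esub> (a \<otimes>\<^bsub>A\<^esub> inv\<^bsub>A\<^esub> (t (C #>\<^bsub>A\<^esub> a)))"
      using CA[OF c] a t[OF a(1)] by (simp add: A.m_assoc)
    ultimately show ?thesis unfolding \<kappa>_def using mult[OF c] t[OF a(1)] s[OF \<psi>_in[OF a]] by simp
  qed
  have inj: "inj_on \<kappa> (carrier A \<times> {..<q})"
  proof (rule inj_onI, clarsimp)
    fix a i a' i' assume a: "a \<in> carrier A" "i < q" and a': "a' \<in> carrier A" "i' < q" and e: "\<kappa> (a, i) = \<kappa> (a', i')"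
    have "\<psi> (C #>\<^bsub>A\<^esub> a, i) = \<psi> (C #>\<^bsub>A\<^esub> a', i')" using \<kappa>_Z(2)[OF a] \<kappa>_Z(2)[OF a'] e by simp
    then have eq: "C #>\<^bsub>A\<^esub> a = C #>\<^bsub>A\<^esub> a'" "i = i'"
      using bij_betw_imp_inj_on[OF \<psi>] rc[OF a(1)] rc[OF a'(1)] a(2) a'(2) by (auto dest: inj_onD)
    have "a \<otimes>\<^bsub>A\<^esub> inv\<^bsub>A\<^esub> (t (C #>\<^bsub>A\<^esub> a)) = a' \<otimes>\<^bsub>A\<^esub> inv\<^bsub>A\<^esub> (t (C #>\<^bsub>A\<^esub> a))"
      by (rule cancel[of _ _ "s (\<psi> (C #>\<^bsub>A\<^esub> a, i))"])
        (use t[OF a(1)] t[OF a'(1)] s[OF \<psi>_in[OF a]] e eq in \<open>auto simp: \<kappa>_def\<close>)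
    then show "a = a' \<and> i = i'" using a(1) a'(1) t[OF a(1)] eq(2) by simp
  qed
  have "\<kappa> ` (carrier A \<times> {..<q}) = Z"
  proof (rule card_subset_eq[OF fZ])
    show "\<kappa> ` (carrier A \<times> {..<q}) \<subseteq> Z" using \<kappa>_Z(1) by auto
    show "card (\<kappa> ` (carrier A \<times> {..<q})) = card Z" using card_image[OF inj] q by (simp add: card_cartesian_product)
  qed
  with inj have bij: "bij_betw \<kappa> (carrier A \<times> {..<q}) Z" unfolding bij_betw_def by blast
  define \<kappa>' where "\<kappa>' = inv_into (carrier A \<times> {..<q}) \<kappa>"
  define \<alpha> where "\<alpha> a z = \<kappa> (a \<otimes>\<^bsub>A\<^esub> fst (\<kappa>' z), snd (\<kappa>' z))" for a z
  have \<kappa>': "fst (\<kappa>' z) \<in> carrier A" "snd (\<kappa>' z) < q" "\<kappa> (fst (\<kappa>' z), snd (\<kappa>' z)) = z" if "z \<in> Z" for z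
    using bij_betwE[OF bij_betw_inv_into[OF bij]] that bij_betw_inv_into_right[OF bij that] unfolding \<kappa>'_def by auto
  have \<kappa>'\<kappa>: "\<kappa>' (\<kappa> (a, i)) = (a, i)" if "a \<in> carrier A" "i < q" for a i
    unfolding \<kappa>'_def using bij_betw_inv_into_left[OF bij] that by simp
  show ?thesis
  proof (rule that[of \<alpha>])
    fix z assume z: "z \<in> Z"
    note k = \<kappa>'[OF z]
    show "\<alpha> a z \<in> Z" if "a \<in> carrier A" for a unfolding \<alpha>_def using \<kappa>_Z(1) k that by simp
    show "\<alpha> \<one>\<^bsub>A\<^esub> z = z" unfolding \<alpha>_def using k by simp
    show "\<alpha> (a \<otimes>\<^bsub>A\<^esub> a') z = \<alpha> a (\<alpha> a' z)" if "a \<in> carrier A" "a' \<in> carrier A" for a a'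
      unfolding \<alpha>_def using \<kappa>'\<kappa>[of "a' \<otimes>\<^bsub>A\<^esub> fst (\<kappa>' z)" "snd (\<kappa>' z)"] k that by (simp add: A.m_assoc)
    show "\<alpha> c z = \<beta> c z" if "c \<in> C" for c unfolding \<alpha>_def using \<kappa>_C[OF that k(1,2)] k(3) by simp
  qed
qed

lemma (in group) l_coset_eq_iff:
  assumes D: "subgroup D G" and x: "x \<in> carrier G" and y: "y \<in> carrier G"
  shows "x <# D = y <# D \<longleftrightarrow> inv x \<otimes> y \<in> D"
proof
  assume e: "x <# D = y <# D"
  have "y \<in> y <# D" unfolding l_coset_def using subgroup.one_closed[OF D] y by force
  then have "y \<in> x <# D" by (simp only: e)
  then obtain d where "d \<in> D" "y = x \<otimes> d" unfolding l_coset_def by blast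
  then show "inv x \<otimes> y \<in> D" using x subgroup.subset[OF D] by auto
next
  assume d: "inv x \<otimes> y \<in> D"
  have "x <# D = x <# ((inv x \<otimes> y) <# D)"
  proof -
    have "(inv x \<otimes> y) <# D = D"
    proof (intro equalityI subsetI)
      fix z assume "z \<in> (inv x \<otimes> y) <# D"
      then show "z \<in> D" unfolding l_coset_def using d subgroup.m_closed[OF D] by blast
    next
      fix z assume z: "z \<in> D"
      have "inv (inv x \<otimes> y) \<otimes> z \<in> D" using d z subgroup.m_closed[OF D] subgroup.m_inv_closed[OF D] by blast
      moreover have "z = (inv x \<otimes> y) \<otimes> (inv (inv x \<otimes> y) \<otimes> z)" using x y z subgroup.subset[OF D] by auto
      ultimately show "z \<in> (inv x \<otimes> y) <# D" unfolding l_coset_def by blast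
    qed
    then show ?thesis by simp
  qed
  also have "\<dots> = y <# D" using x y by (simp add: lcos_m_assoc[OF subgroup.subset[OF D]])
  finally show "x <# D = y <# D" .
qed

locale finite_amalgam = amalgam P Q R \<phi>
  for P :: "('a, 'm) monoid_scheme" and Q :: "('b, 'n) monoid_scheme" and R and \<phi> +
  assumes fP: "finite (carrier P)" and fQ: "finite (carrier Q)"
begin

lemma H_finite: "finite (carrier (H b))"
  using fP fQ by (simp add: H_def sum_left_def sum_right_def)

text \<open>\<open>Y b\<close> is the finite piece on which the factor \<open>H b\<close> acts as on
  the cosets of \<open>D\<close>. On the remaining points of \<open>YY\<close> only the amalgamated
  subgroup acts, freely but with a number of orbits that need not fit; taking \<open>N\<close>
  copies of everything makes the count divisible by the orders of both factors. \<open>K\<close> is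
  the stabiliser of one copy of the coset \<open>D\<close> in the resulting finite action.\<close>

lemma torsion_free_separated:
  assumes D: "subgroup D \<Gamma>" and tf: "\<And>x n. \<lbrakk>x \<in> D; n > 0; x [^]\<^bsub>\<Gamma>\<^esub> (n::nat) = \<one>\<^bsub>\<Gamma>\<^esub>\<rbrakk> \<Longrightarrow> x = \<one>\<^bsub>\<Gamma>\<^esub>"
    and c: "c \<in> D" and g: "g \<in> carrier \<Gamma>" "g \<notin> D"
  shows "\<exists>K. finite_index_subgroup K \<Gamma> \<and> c \<in> K \<and> g \<notin> K"
proof -
  note DG = subgroup.subset[OF D]
  have cG: "c \<in> carrier \<Gamma>" using c DG by blast
  define pt where "pt x = x <#\<^bsub>\<Gamma>\<^esub> D" for x
  have jc: "j l \<in> carrier \<Gamma>" if "l \<in> carrier (H b)" for l b using j_hom[of b] that by (auto simp: hom_def)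
  have pt_mult: "y <#\<^bsub>\<Gamma>\<^esub> pt x = pt (y \<otimes>\<^bsub>\<Gamma>\<^esub> x)" if "x \<in> carrier \<Gamma>" "y \<in> carrier \<Gamma>" for x y
    unfolding pt_def using \<Gamma>.lcos_m_assoc[OF DG] that by simp
  obtain wc wg where wc: "wc \<in> lists letters" "c = word_eval \<Gamma> j wc" and wg: "wg \<in> lists letters" "g = word_eval \<Gamma> j wg"
    using j_generates[OF cG] j_generates[OF g(1)] by metis
  \<comment> \<open>The path of a word: the cosets passed when its letters act on \<open>D\<close>
    one after the other, from the last to the first.\<close>
  define F0 where "F0 w = (\<lambda>i. pt (word_eval \<Gamma> j (drop i w))) ` {..length w}" for w
  define F where "F = F0 wc \<union> F0 wg"
  have ev: "word_eval \<Gamma> j (drop i w) \<in> carrier \<Gamma>" if "w \<in> lists letters" for i w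
    by (rule \<Gamma>.word_eval_closed[OF j_closed]) (use that in \<open>auto simp: in_lists_conv_set dest: in_set_dropD\<close>)
  have F_pt: "\<exists>x\<in>carrier \<Gamma>. X = pt x" if "X \<in> F" for X
    using that ev[OF wc(1)] ev[OF wg(1)] unfolding F_def F0_def by blast
  have fF: "finite F" unfolding F_def F0_def by simp
  define Y where "Y b = (\<lambda>(a, X). j a <#\<^bsub>\<Gamma>\<^esub> X) ` (carrier (H b) \<times> F)" for b
  have fY: "finite (Y b)" for b unfolding Y_def using H_finite fF by simp
  have Y_pt: "\<exists>x\<in>carrier \<Gamma>. X = pt x" if XY: "X \<in> Y b" for X b
  proof -
    obtain a X' where a: "a \<in> carrier (H b)" "X' \<in> F" "X = j a <#\<^bsub>\<Gamma>\<^esub> X'" using XY unfolding Y_def by auto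
    obtain x where "x \<in> carrier \<Gamma>" "X' = pt x" using F_pt[OF a(2)] by blast
    then show ?thesis using a pt_mult jc[OF a(1)] by (metis \<Gamma>.m_closed)
  qed
  have one_pt: "j \<one>\<^bsub>H b\<^esub> <#\<^bsub>\<Gamma>\<^esub> X = X" if "\<exists>x\<in>carrier \<Gamma>. X = pt x" for b X
    using that pt_mult[OF _ \<Gamma>.one_closed] hom_one[OF j_hom[of b] H_group \<Gamma>_group] by auto
  have mult_pt: "j (a \<otimes>\<^bsub>H b\<^esub> a') <#\<^bsub>\<Gamma>\<^esub> X = j a <#\<^bsub>\<Gamma>\<^esub> (j a' <#\<^bsub>\<Gamma>\<^esub> X)"
    if "\<exists>x\<in>carrier \<Gamma>. X = pt x" "a \<in> carrier (H b)" "a' \<in> carrier (H b)" for a a' b X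
    using that pt_mult jc[OF that(2)] jc[OF that(3)] hom_mult[OF j_hom[of b] that(2,3)]
    by (auto simp: \<Gamma>.m_assoc)
  have F_Y: "F \<subseteq> Y b" for b
  proof
    fix X assume X: "X \<in> F"
    then have "X = (\<lambda>(a, X). j a <#\<^bsub>\<Gamma>\<^esub> X) (\<one>\<^bsub>H b\<^esub>, X)" using one_pt[OF F_pt] by simp
    then show "X \<in> Y b" unfolding Y_def using X by (intro image_eqI[where x = "(\<one>\<^bsub>H b\<^esub>, X)"]) auto
  qed
  have Y_inv: "j a <#\<^bsub>\<Gamma>\<^esub> X \<in> Y b" if XY: "X \<in> Y b" and a: "a \<in> carrier (H b)" for a X b
  proof -
    obtain a' X' where a': "a' \<in> carrier (H b)" "X' \<in> F" "X = j a' <#\<^bsub>\<Gamma>\<^esub> X'" using XY unfolding Y_def by auto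
    have "j a <#\<^bsub>\<Gamma>\<^esub> X = j (a \<otimes>\<^bsub>H b\<^esub> a') <#\<^bsub>\<Gamma>\<^esub> X'" unfolding a'(3) using mult_pt[OF F_pt[OF a'(2)] a a'(1)] by simp
    then show ?thesis unfolding Y_def using a a' by force
  qed
  have free: "a = \<one>\<^bsub>H b\<^esub>" if Xp: "\<exists>x\<in>carrier \<Gamma>. X = pt x" and a: "a \<in> carrier (H b)" and e: "j a <#\<^bsub>\<Gamma>\<^esub> X = X" for a b X
  proof -
    obtain x where x: "x \<in> carrier \<Gamma>" "X = pt x" using Xp by blast
    \<comment> \<open>If \<open>j a\<close> fixes the coset of \<open>x\<close>, this conjugate of
      \<open>j a\<close> lies in \<open>D\<close>; like \<open>a\<close> it has finite order, hence
      it is trivial.\<close>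
    let ?y = "inv\<^bsub>\<Gamma>\<^esub> x \<otimes>\<^bsub>\<Gamma>\<^esub> j a \<otimes>\<^bsub>\<Gamma>\<^esub> inv\<^bsub>\<Gamma>\<^esub> (inv\<^bsub>\<Gamma>\<^esub> x)"
    have "pt x = pt (j a \<otimes>\<^bsub>\<Gamma>\<^esub> x)" using e x pt_mult jc[OF a] by simp
    then have "inv\<^bsub>\<Gamma>\<^esub> x \<otimes>\<^bsub>\<Gamma>\<^esub> (j a \<otimes>\<^bsub>\<Gamma>\<^esub> x) \<in> D" unfolding pt_def using \<Gamma>.l_coset_eq_iff[OF D] x jc[OF a] by simp
    then have y: "?y \<in> D" using x jc[OF a] by (simp add: \<Gamma>.m_assoc)
    have "finite_index_normal {\<one>\<^bsub>H b\<^esub>} (H b)"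
      unfolding finite_index_normal_def using H.one_is_normal H_finite by (simp add: RCOSETS_def)
    then obtain n where n: "n > 0" "a [^]\<^bsub>H b\<^esub> (n::nat) = \<one>\<^bsub>H b\<^esub>"
      using H.finite_index_normal_pow[OF _ a] by blast
    have "j a [^]\<^bsub>\<Gamma>\<^esub> n = j (a [^]\<^bsub>H b\<^esub> n)" using hom_nat_pow[OF j_hom[of b] a H_group \<Gamma>_group] by simp
    also have "\<dots> = \<one>\<^bsub>\<Gamma>\<^esub>" using n(2) hom_one[OF j_hom[of b] H_group \<Gamma>_group] by simp
    finally have "?y [^]\<^bsub>\<Gamma>\<^esub> n = \<one>\<^bsub>\<Gamma>\<^esub>" using \<Gamma>.nat_pow_conj[OF jc[OF a] \<Gamma>.inv_closed[OF x(1)]] x by simp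
    then have "?y = \<one>\<^bsub>\<Gamma>\<^esub>" using tf[OF y n(1)] by blast
    then have "x \<otimes>\<^bsub>\<Gamma>\<^esub> ?y \<otimes>\<^bsub>\<Gamma>\<^esub> inv\<^bsub>\<Gamma>\<^esub> x = \<one>\<^bsub>\<Gamma>\<^esub>" using x by simp
    then have "j a = \<one>\<^bsub>\<Gamma>\<^esub>" using x jc[OF a] by (simp add: \<Gamma>.m_assoc)
    then show ?thesis using j_one_iff[OF a] by blast
  qed
  define YY where "YY = Y True \<union> Y False"
  have YY_pt: "\<exists>x\<in>carrier \<Gamma>. X = pt x" if "X \<in> YY" for X using that Y_pt unfolding YY_def by blast
  have Y_YY: "Y b \<subseteq> YY" for b unfolding YY_def by (cases b) auto
  \<comment> \<open>The amalgamated subgroup lies in both factors, so it preserves each of the two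
    pieces and therefore also their complements in \<open>YY\<close>.\<close>
  have core_Y: "j (emb b r) <#\<^bsub>\<Gamma>\<^esub> X \<in> Y b' \<longleftrightarrow> X \<in> Y b'" if r: "r \<in> R" and X: "\<exists>x\<in>carrier \<Gamma>. X = pt x" for r b b' X
  proof -
    have e: "emb b' r \<in> carrier (H b')" by (rule emb_closed[OF r])
    have "j (inv\<^bsub>H b'\<^esub> (emb b' r)) <#\<^bsub>\<Gamma>\<^esub> (j (emb b' r) <#\<^bsub>\<Gamma>\<^esub> X) = X"
      using mult_pt[OF X H.inv_closed[OF e] e] one_pt[OF X, of b'] e by simp
    then show ?thesis unfolding j_emb[OF r, of b b'] using Y_inv[OF _ e] Y_inv[OF _ H.inv_closed[OF e]] by metis
  qed
  define N where "N = card (carrier (H True)) * card (carrier (H False))"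
  have N: "N > 0" unfolding N_def using H_finite H.one_closed by (auto simp: card_gt_0_iff)
  have dvdN: "card (carrier (H b)) dvd N" for b unfolding N_def by (cases b) auto
  define Z where "Z b = (YY - Y b) \<times> {..<N}" for b
  define \<Omega> where "\<Omega> = YY \<times> {..<N}"
  have f\<Omega>: "finite \<Omega>" unfolding \<Omega>_def YY_def using fY by simp
  have "\<forall>b. \<exists>\<alpha>. (\<forall>a\<in>carrier (H b). \<forall>z\<in>Z b. \<alpha> a z \<in> Z b) \<and> (\<forall>z\<in>Z b. \<alpha> \<one>\<^bsub>H b\<^esub> z = z) \<and>
     (\<forall>a\<in>carrier (H b). \<forall>a'\<in>carrier (H b). \<forall>z\<in>Z b. \<alpha> (a \<otimes>\<^bsub>H b\<^esub> a') z = \<alpha> a (\<alpha> a' z)) \<and>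
     (\<forall>c\<in>core b. \<forall>z\<in>Z b. \<alpha> c z = (j c <#\<^bsub>\<Gamma>\<^esub> fst z, snd z))"
  proof (rule allI)
    fix b
    show "\<exists>\<alpha>. (\<forall>a\<in>carrier (H b). \<forall>z\<in>Z b. \<alpha> a z \<in> Z b) \<and> (\<forall>z\<in>Z b. \<alpha> \<one>\<^bsub>H b\<^esub> z = z) \<and>
     (\<forall>a\<in>carrier (H b). \<forall>a'\<in>carrier (H b). \<forall>z\<in>Z b. \<alpha> (a \<otimes>\<^bsub>H b\<^esub> a') z = \<alpha> a (\<alpha> a' z)) \<and>
     (\<forall>c\<in>core b. \<forall>z\<in>Z b. \<alpha> c z = (j c <#\<^bsub>\<Gamma>\<^esub> fst z, snd z))"
    proof (rule extend_free_action[OF H_group H_finite core_subgroup, where Z = "Z b" and \<beta> = "\<lambda>c z. (j c <#\<^bsub>\<Gamma>\<^esub> fst z, snd z)"])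
    show "finite (Z b)" unfolding Z_def YY_def using fY by simp
    have Z_pt: "\<exists>x\<in>carrier \<Gamma>. fst z = pt x" if "z \<in> Z b" for z using that YY_pt unfolding Z_def by auto
    show "(j c <#\<^bsub>\<Gamma>\<^esub> fst z, snd z) \<in> Z b" if "c \<in> core b" "z \<in> Z b" for c z
    proof -
      obtain r where r: "r \<in> R" "c = emb b r" using \<open>c \<in> core b\<close> by blast
      show ?thesis using that(2) core_Y[OF r(1) Z_pt[OF that(2)]] unfolding r(2) Z_def YY_def by auto
    qed
    show "(j \<one>\<^bsub>H b\<^esub> <#\<^bsub>\<Gamma>\<^esub> fst z, snd z) = z" if "z \<in> Z b" for z using one_pt[OF Z_pt[OF that]] by simp
    show "(j (c \<otimes>\<^bsub>H b\<^esub> c') <#\<^bsub>\<Gamma>\<^esub> fst z, snd z) = (j c <#\<^bsub>\<Gamma>\<^esub> fst (j c' <#\<^bsub>\<Gamma>\<^esub> fst z, snd z), snd (j c' <#\<^bsub>\<Gamma>\<^esub> fst z, snd z))"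
      if "c \<in> core b" "c' \<in> core b" "z \<in> Z b" for c c' z
      using mult_pt[OF Z_pt[OF that(3)] core_sub[OF that(1)] core_sub[OF that(2)]] by simp
    show "c = \<one>\<^bsub>H b\<^esub>" if "c \<in> core b" "z \<in> Z b" "(j c <#\<^bsub>\<Gamma>\<^esub> fst z, snd z) = z" for c z
      using free[OF Z_pt[OF that(2)] core_sub[OF that(1)]] that(3) by (metis fst_conv)
    show "card (carrier (H b)) dvd card (Z b)" unfolding Z_def card_cartesian_product using dvdN by simp
    qed blast
  qed
  from choice[OF this] obtain \<alpha> where "\<forall>b. (\<forall>a\<in>carrier (H b). \<forall>z\<in>Z b. \<alpha> b a z \<in> Z b) \<and> (\<forall>z\<in>Z b. \<alpha> b \<one>\<^bsub>H b\<^esub> z = z) \<and>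
     (\<forall>a\<in>carrier (H b). \<forall>a'\<in>carrier (H b). \<forall>z\<in>Z b. \<alpha> b (a \<otimes>\<^bsub>H b\<^esub> a') z = \<alpha> b a (\<alpha> b a' z)) \<and>
     (\<forall>c\<in>core b. \<forall>z\<in>Z b. \<alpha> b c z = (j c <#\<^bsub>\<Gamma>\<^esub> fst z, snd z))" by (rule exE)
  then have \<alpha>: "\<And>b a z. a \<in> carrier (H b) \<Longrightarrow> z \<in> Z b \<Longrightarrow> \<alpha> b a z \<in> Z b"
    "\<And>b z. z \<in> Z b \<Longrightarrow> \<alpha> b \<one>\<^bsub>H b\<^esub> z = z"
    "\<And>b a a' z. a \<in> carrier (H b) \<Longrightarrow> a' \<in> carrier (H b) \<Longrightarrow> z \<in> Z b \<Longrightarrow> \<alpha> b (a \<otimes>\<^bsub>H b\<^esub> a') z = \<alpha> b a (\<alpha> b a' z)"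
    "\<And>b c z. c \<in> core b \<Longrightarrow> z \<in> Z b \<Longrightarrow> \<alpha> b c z = (j c <#\<^bsub>\<Gamma>\<^esub> fst z, snd z)"
    by (simp, simp, simp, auto)
  \<comment> \<open>On its own piece a factor acts as before, elsewhere by the extension; on the
    amalgamated subgroup both are the original action, so the two factors agree there.\<close>
  define op where "op l z = (if z \<notin> \<Omega> then z else if fst z \<in> Y (isl l) then (j l <#\<^bsub>\<Gamma>\<^esub> fst z, snd z) else \<alpha> (isl l) l z)" for l z
  have isl: "isl a = b" if "a \<in> carrier (H b)" for a b using that by (simp add: H_carrier)
  have op_Y: "op a z = (j a <#\<^bsub>\<Gamma>\<^esub> fst z, snd z)" "op a z \<in> \<Omega>" "fst (op a z) \<in> Y b"
    if "a \<in> carrier (H b)" "z \<in> \<Omega>" "fst z \<in> Y b" for a b z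
    using that Y_inv[OF that(3,1)] Y_YY[of b] unfolding op_def isl[OF that(1)] \<Omega>_def by auto
  have op_Z: "op a z = \<alpha> b a z" "op a z \<in> \<Omega>" "fst (op a z) \<notin> Y b"
    if "a \<in> carrier (H b)" "z \<in> \<Omega>" "fst z \<notin> Y b" for a b z
  proof -
    have "z \<in> Z b" using that(2,3) unfolding Z_def \<Omega>_def by auto
    then have "\<alpha> b a z \<in> Z b" by (rule \<alpha>(1)[OF that(1)])
    moreover show "op a z = \<alpha> b a z" using that unfolding op_def isl[OF that(1)] by simp
    ultimately show "op a z \<in> \<Omega>" "fst (op a z) \<notin> Y b" unfolding Z_def \<Omega>_def by auto
  qed
  have op_mult: "op (a \<otimes>\<^bsub>H b\<^esub> a') z = op a (op a' z)" if a: "a \<in> carrier (H b)" "a' \<in> carrier (H b)" for a a' b z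
  proof (cases "z \<in> \<Omega>")
    case True
    show ?thesis
    proof (cases "fst z \<in> Y b")
      case Y: True
      show ?thesis
        using op_Y(1)[OF H.m_closed[OF a] True Y] op_Y[OF a(2) True Y] op_Y(1)[OF a(1) op_Y(2,3)[OF a(2) True Y]]
          mult_pt[OF Y_pt[OF Y] a] by simp
    next
      case Y: False
      then have "z \<in> Z b" using True unfolding Z_def \<Omega>_def by auto
      then show ?thesis
        using op_Z(1)[OF H.m_closed[OF a] True Y] op_Z(1)[OF a(2) True Y] op_Z(1)[OF a(1) op_Z(2,3)[OF a(2) True Y]]
          \<alpha>(3)[OF a] by simp
    qed
  qed (simp add: op_def)
  have op_one: "op \<one>\<^bsub>H b\<^esub> z = z" for b z
  proof (cases "z \<in> \<Omega>")
    case True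
    show ?thesis
    proof (cases "fst z \<in> Y b")
      case Y: True
      show ?thesis using op_Y(1)[OF H.one_closed True Y] one_pt[OF Y_pt[OF Y]] by simp
    next
      case Y: False
      then have "z \<in> Z b" using True unfolding Z_def \<Omega>_def by auto
      then show ?thesis using op_Z(1)[OF H.one_closed True Y] \<alpha>(2) by simp
    qed
  qed (simp add: op_def)
  have op_permutes: "op a permutes \<Omega>" if a: "a \<in> carrier (H b)" for a b
  proof -
    have "op (inv\<^bsub>H b\<^esub> a) \<circ> op a = id" "op a \<circ> op (inv\<^bsub>H b\<^esub> a) = id"
      using op_mult[OF H.inv_closed[OF a] a] op_mult[OF a H.inv_closed[OF a]] op_one a by (auto simp: fun_eq_iff)
    then have "bij (op a)" by (rule o_bij)
    then show ?thesis unfolding permutes_def bij_iff by (simp add: op_def)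
  qed
  have op_emb: "op (emb b r) z = (j (emb b r) <#\<^bsub>\<Gamma>\<^esub> fst z, snd z)" if r: "r \<in> R" and z: "z \<in> \<Omega>" for b r z
  proof (cases "fst z \<in> Y b")
    case True
    then show ?thesis using op_Y(1)[OF emb_closed[OF r] z] by simp
  next
    case False
    then have "z \<in> Z b" using z unfolding Z_def \<Omega>_def by auto
    then show ?thesis using op_Z(1)[OF emb_closed[OF r] z False] \<alpha>(4) r by simp
  qed
  obtain \<Phi> where \<Phi>: "\<Phi> \<in> hom \<Gamma> (permutation_group \<Omega>)" "\<And>l. l \<in> letters \<Longrightarrow> \<Phi> (j l) = op l"
  proof (rule \<Gamma>_universal[OF group_permutation_group, of op \<Omega>])
    show "op \<in> hom (H b) (permutation_group \<Omega>)" for b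
      by (rule homI) (auto simp: op_permutes op_mult fun_eq_iff)
    show "op (emb True r) = op (emb False r)" if r: "r \<in> R" for r
    proof
      show "op (emb True r) z = op (emb False r) z" for z
        using op_emb[OF r] j_emb[OF r, of True False] by (cases "z \<in> \<Omega>") (simp_all add: op_def)
    qed
  qed blast
  have \<Phi>1: "\<Phi> \<one>\<^bsub>\<Gamma>\<^esub> = id" using hom_one[OF \<Phi>(1) \<Gamma>_group group_permutation_group] by simp
  have \<Phi>m: "\<Phi> (x \<otimes>\<^bsub>\<Gamma>\<^esub> y) z = \<Phi> x (\<Phi> y z)" if "x \<in> carrier \<Gamma>" "y \<in> carrier \<Gamma>" for x y z
    using hom_mult[OF \<Phi>(1) that] by simp
  define p where "p = (pt \<one>\<^bsub>\<Gamma>\<^esub>, 0 :: nat)"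
  have "pt \<one>\<^bsub>\<Gamma>\<^esub> \<in> F" unfolding F_def F0_def by (intro UnI1 image_eqI[of _ _ "length wc"]) auto
  then have p\<Omega>: "p \<in> \<Omega>" unfolding p_def \<Omega>_def using N F_Y Y_YY by auto
  have trace: "\<Phi> (word_eval \<Gamma> j (drop i w)) p = (pt (word_eval \<Gamma> j (drop i w)), 0)"
    if i: "i \<le> length w" and w: "w \<in> lists letters" "F0 w \<subseteq> F" for i w
    using i
  proof (induction i rule: inc_induct)
    case base
    then show ?case using \<Phi>1 by (simp add: p_def)
  next
    case (step i)
    let ?x = "word_eval \<Gamma> j (drop (Suc i) w)"
    have l: "w ! i \<in> letters" using w(1) step.hyps by (simp add: in_lists_conv_set)
    have lH: "w ! i \<in> carrier (H (isl (w ! i)))" using l by (simp add: H_carrier)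
    have x: "?x \<in> carrier \<Gamma>" by (rule ev[OF w(1)])
    have e: "word_eval \<Gamma> j (drop i w) = j (w ! i) \<otimes>\<^bsub>\<Gamma>\<^esub> ?x" using Cons_nth_drop_Suc[OF step.hyps(2)] by (metis word_eval_simps(2))
    have "pt ?x \<in> F" using w(2) step.hyps unfolding F0_def by auto
    then have y: "pt ?x \<in> Y (isl (w ! i))" "(pt ?x, 0) \<in> \<Omega>" using F_Y Y_YY N unfolding \<Omega>_def by auto
    have "\<Phi> (word_eval \<Gamma> j (drop i w)) p = op (w ! i) (pt ?x, 0)"
      unfolding e \<Phi>m[OF jc[OF lH] x] step.IH \<Phi>(2)[OF l] ..
    also have "\<dots> = (pt (j (w ! i) \<otimes>\<^bsub>\<Gamma>\<^esub> ?x), 0)" using op_Y(1)[OF lH y(2)] y(1) pt_mult[OF x jc[OF lH]] by simp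
    finally show ?case unfolding e .
  qed
  have \<Phi>c: "\<Phi> c p = (pt c, 0)" "\<Phi> g p = (pt g, 0)"
    using trace[of 0 wc] trace[of 0 wg] wc wg unfolding F_def by auto
  have ptD: "pt x = pt \<one>\<^bsub>\<Gamma>\<^esub> \<longleftrightarrow> x \<in> D" if "x \<in> carrier \<Gamma>" for x
    using \<Gamma>.l_coset_eq_iff[OF D \<Gamma>.one_closed that] that unfolding pt_def by auto
  define K where "K = {x \<in> carrier \<Gamma>. \<Phi> x p = p}"
  have \<Phi>inv: "\<Phi> (inv\<^bsub>\<Gamma>\<^esub> x) (\<Phi> x z) = z" "\<Phi> x (\<Phi> (inv\<^bsub>\<Gamma>\<^esub> x) z) = z" if "x \<in> carrier \<Gamma>" for x z
    using \<Phi>m[of "inv\<^bsub>\<Gamma>\<^esub> x" x] \<Phi>m[of x "inv\<^bsub>\<Gamma>\<^esub> x"] \<Phi>1 that by simp_all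
  have sK: "subgroup K \<Gamma>"
  proof (rule \<Gamma>.subgroupI)
    show "K \<noteq> {}" unfolding K_def using \<Phi>1 by (auto intro!: exI[of _ "\<one>\<^bsub>\<Gamma>\<^esub>"])
    show "inv\<^bsub>\<Gamma>\<^esub> x \<in> K" if "x \<in> K" for x using that \<Phi>inv(1)[of x p] unfolding K_def by auto
    show "x \<otimes>\<^bsub>\<Gamma>\<^esub> y \<in> K" if "x \<in> K" "y \<in> K" for x y using that \<Phi>m unfolding K_def by auto
  qed (auto simp: K_def)
  have "finite (rcosets\<^bsub>\<Gamma>\<^esub> K)"
  \<comment> \<open>Right cosets of a stabiliser correspond to the points
    \<open>\<Phi> (inv x) p\<close>, and \<open>\<Omega>\<close> is finite.\<close>
  proof (rule \<Gamma>.finite_rcosets_by_map[OF sK])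
    have "\<Phi> (inv\<^bsub>\<Gamma>\<^esub> x) p \<in> \<Omega>" if "x \<in> carrier \<Gamma>" for x
    proof -
      have "\<Phi> (inv\<^bsub>\<Gamma>\<^esub> x) permutes \<Omega>" using \<Phi>(1) that by (auto simp: hom_def)
      then show ?thesis using permutes_in_image p\<Omega> by metis
    qed
    then show "finite ((\<lambda>x. \<Phi> (inv\<^bsub>\<Gamma>\<^esub> x) p) ` carrier \<Gamma>)" by (intro finite_subset[OF _ f\<Omega>]) auto
    fix x y assume x: "x \<in> carrier \<Gamma>" and y: "y \<in> carrier \<Gamma>" and e: "\<Phi> (inv\<^bsub>\<Gamma>\<^esub> x) p = \<Phi> (inv\<^bsub>\<Gamma>\<^esub> y) p"
    then show "x \<otimes>\<^bsub>\<Gamma>\<^esub> inv\<^bsub>\<Gamma>\<^esub> y \<in> K" unfolding K_def using \<Phi>m[OF x \<Gamma>.inv_closed[OF y]] \<Phi>inv(2)[OF x, of p] by simp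
  qed
  then have "finite_index_subgroup K \<Gamma>" unfolding finite_index_subgroup_def using sK by blast
  moreover have "c \<in> K" unfolding K_def using \<Phi>c(1) ptD[OF cG] c cG by (simp add: p_def)
  moreover have "g \<notin> K" unfolding K_def using \<Phi>c(2) ptD[OF g(1)] g(2) by (simp add: p_def)
  ultimately show ?thesis by blast
qed

text \<open>\<open>D\<close> is taken trivial, hence torsion-free, and \<open>c\<close> is the
  identity; the normal core of the subgroup obtained still omits \<open>g\<close>.\<close>

lemma \<Gamma>_residually_finite: "residually_finite \<Gamma>"
  unfolding residually_finite_def
proof (intro ballI impI)
  fix g assume g: "g \<in> carrier \<Gamma>" "g \<noteq> \<one>\<^bsub>\<Gamma>\<^esub>"
  have "\<exists>K. finite_index_subgroup K \<Gamma> \<and> \<one>\<^bsub>\<Gamma>\<^esub> \<in> K \<and> g \<notin> K"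
    by (rule torsion_free_separated[of "{\<one>\<^bsub>\<Gamma>\<^esub>}"]) (use g \<Gamma>.triv_subgroup in auto)
  then obtain K where K: "finite_index_subgroup K \<Gamma>" "g \<notin> K" by blast
  let ?N = "{x \<in> carrier \<Gamma>. \<forall>y\<in>carrier \<Gamma>. y \<otimes>\<^bsub>\<Gamma>\<^esub> x \<otimes>\<^bsub>\<Gamma>\<^esub> inv\<^bsub>\<Gamma>\<^esub> y \<in> K}"
  have "g \<notin> ?N"
  proof
    assume "g \<in> ?N"
    then have "\<one>\<^bsub>\<Gamma>\<^esub> \<otimes>\<^bsub>\<Gamma>\<^esub> g \<otimes>\<^bsub>\<Gamma>\<^esub> inv\<^bsub>\<Gamma>\<^esub> \<one>\<^bsub>\<Gamma>\<^esub> \<in> K" by blast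
    then show False using g K by simp
  qed
  then show "\<exists>N. finite_index_normal N \<Gamma> \<and> g \<notin> N" using \<Gamma>.finite_index_normal_core[OF K(1)] by blast
qed

text \<open>For infinite order the cyclic group of \<open>c\<close> is torsion-free. The subgroup
  \<open>K\<close> then contains all powers of \<open>c\<close> but not \<open>g\<close>, so it
  contains no \<open>g \<otimes> inv (c [^] i)\<close> either, and its core serves as
  \<open>N\<close>.\<close>

lemma \<Gamma>_cyclically_separable: "cyclically_separable \<Gamma>"
  unfolding cyclically_separable_def
proof (intro ballI impI)
  fix c g assume c: "c \<in> carrier \<Gamma>" and g: "g \<in> carrier \<Gamma>" and gc: "\<forall>i::int. g \<noteq> c [^]\<^bsub>\<Gamma>\<^esub> i"
  show "\<exists>N. finite_index_normal N \<Gamma> \<and> (\<forall>i::int. g \<otimes>\<^bsub>\<Gamma>\<^esub> inv\<^bsub>\<Gamma>\<^esub> (c [^]\<^bsub>\<Gamma>\<^esub> i) \<notin> N)"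
  proof (cases "\<exists>n>0. c [^]\<^bsub>\<Gamma>\<^esub> (n::nat) = \<one>\<^bsub>\<Gamma>\<^esub>")
    case True
    then show ?thesis
      using \<Gamma>.residually_finite_separates_torsion[OF \<Gamma>_residually_finite c g] gc by blast
  next
    case False
    let ?D = "range (\<lambda>i::int. c [^]\<^bsub>\<Gamma>\<^esub> i)"
    have D: "subgroup ?D \<Gamma>"
    proof (rule \<Gamma>.subgroupI)
      show "inv\<^bsub>\<Gamma>\<^esub> x \<in> ?D" if "x \<in> ?D" for x
      proof -
        obtain i :: int where "x = c [^]\<^bsub>\<Gamma>\<^esub> i" using \<open>x \<in> ?D\<close> by blast
        then have "inv\<^bsub>\<Gamma>\<^esub> x = c [^]\<^bsub>\<Gamma>\<^esub> (- i)" using c by (simp add: \<Gamma>.int_pow_neg)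
        then show ?thesis by blast
      qed
      show "x \<otimes>\<^bsub>\<Gamma>\<^esub> y \<in> ?D" if "x \<in> ?D" "y \<in> ?D" for x y
      proof -
        obtain i k :: int where "x = c [^]\<^bsub>\<Gamma>\<^esub> i" "y = c [^]\<^bsub>\<Gamma>\<^esub> k" using \<open>x \<in> ?D\<close> \<open>y \<in> ?D\<close> by blast
        then have "x \<otimes>\<^bsub>\<Gamma>\<^esub> y = c [^]\<^bsub>\<Gamma>\<^esub> (i + k)" using c by (simp add: \<Gamma>.int_pow_mult)
        then show ?thesis by blast
      qed
    qed (use c in auto)
    have tf: "x = \<one>\<^bsub>\<Gamma>\<^esub>" if x: "x \<in> ?D" and n: "n > 0" "x [^]\<^bsub>\<Gamma>\<^esub> (n::nat) = \<one>\<^bsub>\<Gamma>\<^esub>" for x n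
    proof -
      obtain i :: int where i: "x = c [^]\<^bsub>\<Gamma>\<^esub> i" using x by blast
      define m where "m = i * int n"
      have m: "c [^]\<^bsub>\<Gamma>\<^esub> m = \<one>\<^bsub>\<Gamma>\<^esub>"
        using n(2) c \<Gamma>.int_pow_pow[of c i "int n"] unfolding i m_def by (simp add: int_pow_int)
      then have m': "c [^]\<^bsub>\<Gamma>\<^esub> (- m) = \<one>\<^bsub>\<Gamma>\<^esub>" using c by (simp add: \<Gamma>.int_pow_neg)
      have "\<bar>m\<bar> = m \<or> \<bar>m\<bar> = - m" by linarith
      then have "c [^]\<^bsub>\<Gamma>\<^esub> \<bar>m\<bar> = \<one>\<^bsub>\<Gamma>\<^esub>" using m m' by (elim disjE) (simp_all only:)
      then have "c [^]\<^bsub>\<Gamma>\<^esub> int (nat \<bar>m\<bar>) = \<one>\<^bsub>\<Gamma>\<^esub>" by simp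
      then have mn: "c [^]\<^bsub>\<Gamma>\<^esub> (nat \<bar>m\<bar>) = \<one>\<^bsub>\<Gamma>\<^esub>" by (simp only: int_pow_int)
      have "\<not> nat \<bar>m\<bar> > 0"
      proof
        assume "nat \<bar>m\<bar> > 0"
        with mn have "\<exists>n>0. c [^]\<^bsub>\<Gamma>\<^esub> (n::nat) = \<one>\<^bsub>\<Gamma>\<^esub>" by (intro exI conjI)
        with False show False by (rule notE)
      qed
      then have "i = 0" using n(1) by (simp add: m_def)
      then show ?thesis using i by simp
    qed
    have "c \<in> ?D" using c by (intro image_eqI[of _ _ 1]) auto
    moreover have "g \<notin> ?D" using gc by blast
    ultimately have "\<exists>K. finite_index_subgroup K \<Gamma> \<and> c \<in> K \<and> g \<notin> K"
      by (intro torsion_free_separated[OF D tf _ g])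
    then obtain K where K: "finite_index_subgroup K \<Gamma>" "c \<in> K" "g \<notin> K" by blast
    have sK: "subgroup K \<Gamma>" using K(1) unfolding finite_index_subgroup_def by blast
    let ?N = "{x \<in> carrier \<Gamma>. \<forall>y\<in>carrier \<Gamma>. y \<otimes>\<^bsub>\<Gamma>\<^esub> x \<otimes>\<^bsub>\<Gamma>\<^esub> inv\<^bsub>\<Gamma>\<^esub> y \<in> K}"
    have "g \<otimes>\<^bsub>\<Gamma>\<^esub> inv\<^bsub>\<Gamma>\<^esub> (c [^]\<^bsub>\<Gamma>\<^esub> i) \<notin> ?N" for i :: int
    proof
      assume "g \<otimes>\<^bsub>\<Gamma>\<^esub> inv\<^bsub>\<Gamma>\<^esub> (c [^]\<^bsub>\<Gamma>\<^esub> i) \<in> ?N"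
      then have "\<one>\<^bsub>\<Gamma>\<^esub> \<otimes>\<^bsub>\<Gamma>\<^esub> (g \<otimes>\<^bsub>\<Gamma>\<^esub> inv\<^bsub>\<Gamma>\<^esub> (c [^]\<^bsub>\<Gamma>\<^esub> i)) \<otimes>\<^bsub>\<Gamma>\<^esub> inv\<^bsub>\<Gamma>\<^esub> \<one>\<^bsub>\<Gamma>\<^esub> \<in> K" by blast
      then have "g \<otimes>\<^bsub>\<Gamma>\<^esub> inv\<^bsub>\<Gamma>\<^esub> (c [^]\<^bsub>\<Gamma>\<^esub> i) \<in> K" using g c by simp
      then have "g \<otimes>\<^bsub>\<Gamma>\<^esub> inv\<^bsub>\<Gamma>\<^esub> (c [^]\<^bsub>\<Gamma>\<^esub> i) \<otimes>\<^bsub>\<Gamma>\<^esub> c [^]\<^bsub>\<Gamma>\<^esub> i \<in> K"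
        using subgroup.m_closed[OF sK] \<Gamma>.subgroup_int_pow_closed[OF sK K(2)] by blast
      then show False using g c K(3) by (simp add: \<Gamma>.m_assoc)
    qed
    then show ?thesis using \<Gamma>.finite_index_normal_core[OF K(1)] by blast
  qed
qed

end

section \<open>Separation in finite quotient amalgams\<close>

lemma (in group) int_pow_conj:
  assumes "x \<in> carrier G" "y \<in> carrier G"
  shows "(y \<otimes> x \<otimes> inv y) [^] (i::int) = y \<otimes> x [^] i \<otimes> inv y"
proof -
  have "inv (y \<otimes> x [^] n \<otimes> inv y) = y \<otimes> inv (x [^] n) \<otimes> inv y" for n :: nat
    using assms by (simp add: inv_mult_group m_assoc)
  then have neg: "inv ((y \<otimes> x \<otimes> inv y) [^] n) = y \<otimes> inv (x [^] n) \<otimes> inv y" for n :: nat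
    by (simp only: nat_pow_conj[OF assms])
  show ?thesis
  proof (cases i rule: int_cases2)
    case (nonneg n)
    then show ?thesis using nat_pow_conj[OF assms] by (simp only: int_pow_int)
  next
    case (nonpos n)
    have "y \<otimes> x \<otimes> inv y \<in> carrier G" using assms by simp
    then show ?thesis unfolding nonpos using neg assms(1) by (simp only: int_pow_neg_int)
  qed
qed

section \<open>Word length and powers in amalgams\<close>

context amalgam
begin

lemma Inl_hom: "Inl \<in> hom P (H True)" by (rule homI) (auto simp: H_def sum_left_def)
lemma Inr_hom: "Inr \<in> hom Q (H False)" by (rule homI) (auto simp: H_def sum_right_def)

lemma alternating_map: "(\<And>l. isl (f l) = isl l) \<Longrightarrow> alternating (map f w) \<longleftrightarrow> successively (\<lambda>x y. isl x \<noteq> isl y) w"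
  by (simp add: alternating_def successively_map)

lemma alternating_append:
  "alternating (u @ v) \<longleftrightarrow> alternating u \<and> alternating v \<and> (u = [] \<or> v = [] \<or> isl (last u) \<noteq> isl (hd v))"
  unfolding alternating_def successively_append_iff by auto

lemma reduced_power:
  assumes w: "reduced w" "w \<noteq> []" "isl (last w) \<noteq> isl (hd w)"
  shows "reduced (concat (replicate n w))" "word_eval \<Gamma> j (concat (replicate n w)) = word_eval \<Gamma> j w [^]\<^bsub>\<Gamma>\<^esub> n"
proof -
  have hd: "hd (concat (replicate (Suc n) w)) = hd w" for n using w(2) by simp
  have alt: "alternating (concat (replicate n w))" for n
  proof (induction n)
    case (Suc n)
    have c: "isl (last w) \<noteq> isl (hd (concat (replicate n w)))" if "concat (replicate n w) \<noteq> []"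
    proof -
      from that obtain n' where "n = Suc n'" by (cases n) auto
      then show ?thesis using w(3) hd[of n'] by simp
    qed
    have "alternating w" using w(1) by (simp only: reduced_def)
    then have "alternating (w @ concat (replicate n w))"
      unfolding alternating_append using Suc c by metis
    then show ?case by simp
  qed (simp add: alternating_simps)
  have L: "concat (replicate n w) \<in> lists letters" for n using w(1) by (auto simp: reduced_def)
  show "reduced (concat (replicate n w))"
    using alt[of n] L[of n] w(1) by (auto simp: reduced_def)
  have wL: "w \<in> lists letters" using w(1) by (simp add: reduced_def)
  have wG: "word_eval \<Gamma> j w \<in> carrier \<Gamma>" by (rule \<Gamma>.word_eval_closed[OF j_closed wL])
  show "word_eval \<Gamma> j (concat (replicate n w)) = word_eval \<Gamma> j w [^]\<^bsub>\<Gamma>\<^esub> n"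
  proof (induction n)
    case (Suc n)
    have "word_eval \<Gamma> j (concat (replicate (Suc n) w)) = word_eval \<Gamma> j w \<otimes>\<^bsub>\<Gamma>\<^esub> word_eval \<Gamma> j w [^]\<^bsub>\<Gamma>\<^esub> n"
      using \<Gamma>.word_eval_append[OF j_closed wL L] Suc by simp
    also have "\<dots> = word_eval \<Gamma> j w [^]\<^bsub>\<Gamma>\<^esub> Suc n" by (rule \<Gamma>.nat_pow_Suc2[OF wG, symmetric])
    finally show ?case .
  qed simp
qed

text \<open>The \<open>n\<close>-th power has at least \<open>n\<close> syllables, while
  \<open>v\<close> represents an element with at most \<open>length v\<close>. The threshold depends
  on the length of \<open>v\<close> alone, so it is the same in all quotients in which
  \<open>w\<close> stays reduced.\<close>

lemma hyperbolic_power_neq: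
  assumes w: "reduced w" "w \<noteq> []" "isl (last w) \<noteq> isl (hd w)" and v: "v \<in> lists letters" and n: "length v < n"
  shows "word_eval \<Gamma> j v \<noteq> word_eval \<Gamma> j w [^]\<^bsub>\<Gamma>\<^esub> n"
proof
  assume e: "word_eval \<Gamma> j v = word_eval \<Gamma> j w [^]\<^bsub>\<Gamma>\<^esub> n"
  obtain nf where nf: "\<And>w. w \<in> lists letters \<Longrightarrow> length (nf (word_eval \<Gamma> j w) :: ('a + 'b) list) \<le> length w"
    "\<And>w. reduced w \<Longrightarrow> length (nf (word_eval \<Gamma> j w)) = length w" using normal_form by metis
  have "length (concat (replicate n w)) \<le> length v"
    using nf(1)[OF v] nf(2)[OF reduced_power(1)[OF w, of n]] reduced_power(2)[OF w, of n] e by simp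
  moreover have "length (concat (replicate n w)) = n * length w" by (simp add: length_concat sum_list_replicate)
  moreover have "n * 1 \<le> n * length w" using w(2) by (intro mult_le_mono2) (simp add: Suc_leI)
  ultimately show False using n by linarith
qed

lemma reduced_neq_one: assumes "reduced w" "w \<noteq> []" shows "word_eval \<Gamma> j w \<noteq> \<one>\<^bsub>\<Gamma>\<^esub>"
proof
  assume e: "word_eval \<Gamma> j w = \<one>\<^bsub>\<Gamma>\<^esub>"
  obtain nf where nf: "\<And>w. reduced w \<Longrightarrow> length (nf (word_eval \<Gamma> j w) :: ('a + 'b) list) = length w"
    using normal_form by metis
  show False using nf[OF assms(1)] nf[of "[]"] assms(2) e by (simp add: reduced_simps)
qed

text \<open>The normal form of \<open>j a\<close> has at most one syllable, and that one lies in the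
  factor \<open>b\<close>.\<close>

lemma reduced_neq_letter:
  assumes w: "reduced w" "w \<noteq> []" and a: "a \<in> carrier (H b)" and lw: "length w \<ge> 2 \<or> isl (hd w) \<noteq> b"
  shows "word_eval \<Gamma> j w \<noteq> j a"
proof
  assume e: "word_eval \<Gamma> j w = j a"
  obtain nf where nf: "\<And>w. reduced w \<Longrightarrow> length (nf (word_eval \<Gamma> j w) :: ('a + 'b) list) = length w"
    "\<And>w. reduced w \<Longrightarrow> w \<noteq> [] \<Longrightarrow> isl (hd (nf (word_eval \<Gamma> j w))) = isl (hd w)"
    "\<And>r b. r \<in> R \<Longrightarrow> nf (j (emb b r)) = []" using normal_form by metis
  have aL: "a \<in> letters" "isl a = b" using a by (auto simp: H_carrier)
  show False
  proof (cases "a \<in> core b")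
    case True
    then have "nf (j a) = []" using nf(3) by blast
    then show False using nf(1)[OF w(1)] w(2) e by simp
  next
    case False
    then have r: "reduced [a]" using aL by (simp add: reduced_simps)
    have "word_eval \<Gamma> j [a] = j a" using funcset_mem[OF j_closed aL(1)] by simp
    then show False using nf(1,2)[OF r] nf(1,2)[OF w(1)] w(2) e lw aL(2) by auto
  qed
qed

lemma j_eq_iff:
  assumes "a \<in> carrier (H b)" "a' \<in> carrier (H b)"
  shows "j a = j a' \<longleftrightarrow> a = a'"
proof
  assume e: "j a = j a'"
  interpret jb: group_hom "H b" \<Gamma> j by (simp add: group_hom_def group_hom_axioms_def H_group \<Gamma>_group j_hom)
  have "j (a \<otimes>\<^bsub>H b\<^esub> inv\<^bsub>H b\<^esub> a') = \<one>\<^bsub>\<Gamma>\<^esub>" using assms e by simp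
  moreover have "a \<otimes>\<^bsub>H b\<^esub> inv\<^bsub>H b\<^esub> a' \<in> carrier (H b)" using assms by simp
  ultimately have "a \<otimes>\<^bsub>H b\<^esub> inv\<^bsub>H b\<^esub> a' = \<one>\<^bsub>H b\<^esub>" using j_one_iff by blast
  then show "a = a'" using H.mult_inv_eq_one_iff[OF assms] by simp
qed simp

end

subsection \<open>Quotients of amalgams\<close>

text \<open>Compatibility makes \<open>\<phi>\<close> induce an injection from the image of
  \<open>R\<close> in \<open>P Mod N\<close> into \<open>Q Mod M\<close>. The finite quotients are
  therefore again amalgamated along a common subgroup and embed into the new amalgam instead of
  collapsing.\<close>

locale amalgam_quotient = amalgam P Q R \<phi>
  for P :: "('a, 'm) monoid_scheme" and Q :: "('b, 'n) monoid_scheme" and R and \<phi> +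
  fixes N :: "'a set" and M :: "'b set"
  assumes N: "finite_index_normal N P" and M: "finite_index_normal M Q"
    and compatible: "\<phi> ` (N \<inter> R) = M \<inter> \<phi> ` R"
begin

definition "R' = (\<lambda>r. N #>\<^bsub>P\<^esub> r) ` R"
text \<open>Defined through a representative in \<open>R\<close>; by \<open>\<phi>_mod_iff\<close>
  its choice does not matter.\<close>

definition "\<phi>' U = M #>\<^bsub>Q\<^esub> \<phi> (SOME r. r \<in> R \<and> U = N #>\<^bsub>P\<^esub> r)"
definition "md = map_sum (\<lambda>p. N #>\<^bsub>P\<^esub> p) (\<lambda>q. M #>\<^bsub>Q\<^esub> q)"
definition "ker b = (if b then Inl ` N else Inr ` M)"

lemmas nN = finite_index_normalD(1)[OF N] and nM = finite_index_normalD(1)[OF M]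

lemma \<phi>_mod_iff:
  assumes r: "r \<in> R" "r' \<in> R"
  shows "M #>\<^bsub>Q\<^esub> \<phi> r = M #>\<^bsub>Q\<^esub> \<phi> r' \<longleftrightarrow> N #>\<^bsub>P\<^esub> r = N #>\<^bsub>P\<^esub> r'"
proof -
  have x: "r \<otimes>\<^bsub>P\<^esub> inv\<^bsub>P\<^esub> r' \<in> R" using R_closed r by blast
  interpret \<phi>: group_hom "P\<lparr>carrier := R\<rparr>" Q \<phi> by (simp add: group_hom_def group_hom_axioms_def R_group Q.is_group \<phi>)
  have "\<phi> (inv\<^bsub>P\<^esub> r') = inv\<^bsub>Q\<^esub> (\<phi> r')"
    using \<phi>.hom_inv[of r'] r P.m_inv_consistent[OF R r(2)] by simp
  then have e: "\<phi> (r \<otimes>\<^bsub>P\<^esub> inv\<^bsub>P\<^esub> r') = \<phi> r \<otimes>\<^bsub>Q\<^esub> inv\<^bsub>Q\<^esub> (\<phi> r')"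
    using \<phi>_mult[OF r(1) R_closed(3)[OF r(2)]] by simp
  have "\<phi> (r \<otimes>\<^bsub>P\<^esub> inv\<^bsub>P\<^esub> r') \<in> M \<longleftrightarrow> r \<otimes>\<^bsub>P\<^esub> inv\<^bsub>P\<^esub> r' \<in> N"
  proof
    assume "\<phi> (r \<otimes>\<^bsub>P\<^esub> inv\<^bsub>P\<^esub> r') \<in> M"
    then have "\<phi> (r \<otimes>\<^bsub>P\<^esub> inv\<^bsub>P\<^esub> r') \<in> \<phi> ` (N \<inter> R)" using compatible x by blast
    then obtain y where "y \<in> N" "y \<in> R" "\<phi> (r \<otimes>\<^bsub>P\<^esub> inv\<^bsub>P\<^esub> r') = \<phi> y" by blast
    then show "r \<otimes>\<^bsub>P\<^esub> inv\<^bsub>P\<^esub> r' \<in> N" using \<phi>_inj x by (metis inj_onD)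
  next
    assume "r \<otimes>\<^bsub>P\<^esub> inv\<^bsub>P\<^esub> r' \<in> N"
    then show "\<phi> (r \<otimes>\<^bsub>P\<^esub> inv\<^bsub>P\<^esub> r') \<in> M" using compatible x by blast
  qed
  then show ?thesis
    unfolding e Q.r_coset_eq_iff[OF normal_imp_subgroup[OF nM] \<phi>_closed[OF r(1)] \<phi>_closed[OF r(2)]]
      P.r_coset_eq_iff[OF normal_imp_subgroup[OF nN] R_sub[OF r(1)] R_sub[OF r(2)]] .
qed

lemma \<phi>'_eq: assumes r: "r \<in> R" shows "\<phi>' (N #>\<^bsub>P\<^esub> r) = M #>\<^bsub>Q\<^esub> \<phi> r"
proof -
  let ?s = "SOME s. s \<in> R \<and> N #>\<^bsub>P\<^esub> r = N #>\<^bsub>P\<^esub> s"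
  have s: "?s \<in> R \<and> N #>\<^bsub>P\<^esub> r = N #>\<^bsub>P\<^esub> ?s" by (rule someI_ex) (use r in blast)
  then have "M #>\<^bsub>Q\<^esub> \<phi> ?s = M #>\<^bsub>Q\<^esub> \<phi> r" using \<phi>_mod_iff[OF _ r, of ?s] by simp
  then show ?thesis unfolding \<phi>'_def .
qed

lemma modP: "group_hom P (P Mod N) (\<lambda>p. N #>\<^bsub>P\<^esub> p)"
  by (simp add: group_hom_def group_hom_axioms_def P.is_group normal.factorgroup_is_group[OF nN] normal.r_coset_hom_Mod[OF nN])

lemma modQ: "group_hom Q (Q Mod M) (\<lambda>q. M #>\<^bsub>Q\<^esub> q)"
  by (simp add: group_hom_def group_hom_axioms_def Q.is_group normal.factorgroup_is_group[OF nM] normal.r_coset_hom_Mod[OF nM])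

lemma quotient_amalgam: "finite_amalgam (P Mod N) (Q Mod M) R' \<phi>'"
proof (intro finite_amalgam.intro amalgam.intro amalgam_axioms.intro finite_amalgam_axioms.intro)
  show "group (P Mod N)" "group (Q Mod M)"
    by (rule normal.factorgroup_is_group[OF nN], rule normal.factorgroup_is_group[OF nM])
  show "subgroup R' (P Mod N)" unfolding R'_def by (rule group_hom.subgroup_img_is_subgroup[OF modP R])
  show "\<phi>' \<in> hom ((P Mod N)\<lparr>carrier := R'\<rparr>) (Q Mod M)"
  proof (rule homI)
    fix U assume "U \<in> carrier ((P Mod N)\<lparr>carrier := R'\<rparr>)"
    then obtain r where r: "r \<in> R" "U = N #>\<^bsub>P\<^esub> r" unfolding R'_def by auto
    show "\<phi>' U \<in> carrier (Q Mod M)" unfolding r(2) \<phi>'_eq[OF r(1)] using \<phi>_closed[OF r(1)] by (simp add: carrier_FactGroup)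
    fix W assume "W \<in> carrier ((P Mod N)\<lparr>carrier := R'\<rparr>)"
    then obtain s where s: "s \<in> R" "W = N #>\<^bsub>P\<^esub> s" unfolding R'_def by auto
    have "U \<otimes>\<^bsub>P Mod N\<^esub> W = N #>\<^bsub>P\<^esub> (r \<otimes>\<^bsub>P\<^esub> s)"
      unfolding r(2) s(2) using normal.rcos_sum[OF nN R_sub[OF r(1)] R_sub[OF s(1)]] by simp
    moreover have "\<phi>' U \<otimes>\<^bsub>Q Mod M\<^esub> \<phi>' W = M #>\<^bsub>Q\<^esub> (\<phi> r \<otimes>\<^bsub>Q\<^esub> \<phi> s)"
      unfolding r(2) s(2) \<phi>'_eq[OF r(1)] \<phi>'_eq[OF s(1)] using normal.rcos_sum[OF nM \<phi>_closed[OF r(1)] \<phi>_closed[OF s(1)]] by simp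
    ultimately show "\<phi>' (U \<otimes>\<^bsub>(P Mod N)\<lparr>carrier := R'\<rparr>\<^esub> W) = \<phi>' U \<otimes>\<^bsub>Q Mod M\<^esub> \<phi>' W"
      using \<phi>'_eq[OF R_closed(2)[OF r(1) s(1)]] \<phi>_mult[OF r(1) s(1)] by simp
  qed
  show "inj_on \<phi>' R'"
  proof (rule inj_onI)
    fix U W assume "U \<in> R'" "W \<in> R'" and e: "\<phi>' U = \<phi>' W"
    then obtain r s where r: "r \<in> R" "U = N #>\<^bsub>P\<^esub> r" and s: "s \<in> R" "W = N #>\<^bsub>P\<^esub> s" unfolding R'_def by auto
    show "U = W" using e \<phi>_mod_iff[OF r(1) s(1)] unfolding r(2) s(2) \<phi>'_eq[OF r(1)] \<phi>'_eq[OF s(1)] by blast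
  qed
  show "finite (carrier (P Mod N))" using finite_index_normalD(4)[OF N] by (simp add: FactGroup_def)
  show "finite (carrier (Q Mod M))" using finite_index_normalD(4)[OF M] by (simp add: FactGroup_def)
qed

sublocale X: finite_amalgam "P Mod N" "Q Mod M" R' \<phi>' by (rule quotient_amalgam)

lemma isl_md [simp]: "isl (md l) = isl l" by (cases l) (simp_all add: md_def)

lemma md_hom: "md \<in> hom (H b) (X.H b)"
proof (cases b)
  case True
  interpret m: group_hom P "P Mod N" "\<lambda>p. N #>\<^bsub>P\<^esub> p" by (rule modP)
  show ?thesis unfolding H_def X.H_def using True m.hom_closed m.hom_mult
    by (intro homI) (auto simp: sum_left_def md_def simp del: mult_FactGroup)
next
  case False
  interpret m: group_hom Q "Q Mod M" "\<lambda>q. M #>\<^bsub>Q\<^esub> q" by (rule modQ)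
  show ?thesis unfolding H_def X.H_def using False m.hom_closed m.hom_mult
    by (intro homI) (auto simp: sum_right_def md_def simp del: mult_FactGroup)
qed

lemma md_closed: "l \<in> carrier (H b) \<Longrightarrow> md l \<in> carrier (X.H b)"
  using md_hom by (auto simp: hom_def)

lemma md_letters: "l \<in> letters \<Longrightarrow> md l \<in> X.letters"
  using md_closed[of l "isl l"] by (simp add: H_carrier X.H_carrier)

lemma md_emb: "r \<in> R \<Longrightarrow> md (emb b r) = X.emb b (N #>\<^bsub>P\<^esub> r)"
  by (simp add: emb_def X.emb_def md_def \<phi>'_eq)

lemma md_eq_iff:
  assumes "l \<in> carrier (H b)" "l' \<in> carrier (H b)"
  shows "md l = md l' \<longleftrightarrow> l \<otimes>\<^bsub>H b\<^esub> inv\<^bsub>H b\<^esub> l' \<in> ker b"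
proof (cases b)
  case True
  then obtain p p' where p: "l = Inl p" "p \<in> carrier P" "l' = Inl p'" "p' \<in> carrier P"
    using assms by (auto simp: H_def sum_left_def)
  have e: "l \<otimes>\<^bsub>H b\<^esub> inv\<^bsub>H b\<^esub> l' = Inl (p \<otimes>\<^bsub>P\<^esub> inv\<^bsub>P\<^esub> p')"
  proof -
    interpret i: group_hom P "H True" Inl by (simp add: group_hom_def group_hom_axioms_def H_group P.is_group Inl_hom)
    show ?thesis using p True by simp
  qed
  show ?thesis unfolding e
    using p True P.r_coset_eq_iff[OF normal_imp_subgroup[OF nN]] by (auto simp: ker_def md_def)
next
  case False
  then obtain p p' where p: "l = Inr p" "p \<in> carrier Q" "l' = Inr p'" "p' \<in> carrier Q"
    using assms by (auto simp: H_def sum_right_def)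
  have e: "l \<otimes>\<^bsub>H b\<^esub> inv\<^bsub>H b\<^esub> l' = Inr (p \<otimes>\<^bsub>Q\<^esub> inv\<^bsub>Q\<^esub> p')"
  proof -
    interpret i: group_hom Q "H False" Inr by (simp add: group_hom_def group_hom_axioms_def H_group Q.is_group Inr_hom)
    show ?thesis using p False by simp
  qed
  show ?thesis unfolding e
    using p False Q.r_coset_eq_iff[OF normal_imp_subgroup[OF nM]] by (auto simp: ker_def md_def)
qed

lemma md_core:
  assumes l: "l \<in> carrier (H b)" and c: "md l \<in> X.core b"
  shows "\<exists>r\<in>R. l \<otimes>\<^bsub>H b\<^esub> inv\<^bsub>H b\<^esub> (emb b r) \<in> ker b"
proof -
  obtain r where r: "r \<in> R" "md l = X.emb b (N #>\<^bsub>P\<^esub> r)" using c unfolding R'_def by blast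
  then have "md l = md (emb b r)" using md_emb by simp
  then show ?thesis using md_eq_iff[OF l emb_closed[OF r(1)]] r(1) by blast
qed

lemma \<pi>_exists: "\<exists>\<pi>. \<pi> \<in> hom \<Gamma> X.\<Gamma> \<and> (\<forall>l\<in>letters. \<pi> (j l) = X.j (md l))"
proof (rule \<Gamma>_universal[OF X.\<Gamma>_group, of "\<lambda>l. X.j (md l)"])
  show "(\<lambda>l. X.j (md l)) \<in> hom (H b) X.\<Gamma>" for b
    using hom_compose[OF md_hom X.j_hom[of b]] by (simp add: o_def)
  show "X.j (md (emb True r)) = X.j (md (emb False r))" if "r \<in> R" for r
    unfolding md_emb[OF that] by (rule X.j_emb) (simp add: R'_def that)
qed blast

definition "\<pi> = (SOME \<pi>. \<pi> \<in> hom \<Gamma> X.\<Gamma> \<and> (\<forall>l\<in>letters. \<pi> (j l) = X.j (md l)))"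

lemma \<pi>: "\<pi> \<in> hom \<Gamma> X.\<Gamma>" "l \<in> letters \<Longrightarrow> \<pi> (j l) = X.j (md l)"
  using someI_ex[OF \<pi>_exists] unfolding \<pi>_def by blast+

sublocale \<pi>: group_hom \<Gamma> X.\<Gamma> \<pi>
  by (simp add: group_hom_def group_hom_axioms_def \<Gamma>_group X.\<Gamma>_group \<pi>(1))

lemma \<pi>_word:
  assumes "w \<in> lists letters"
  shows "\<pi> (word_eval \<Gamma> j w) = word_eval X.\<Gamma> X.j (map md w)" "map md w \<in> lists X.letters"
proof -
  show "\<pi> (word_eval \<Gamma> j w) = word_eval X.\<Gamma> X.j (map md w)"
    using assms by (induction w) (use \<pi>(2) funcset_mem[OF j_closed] \<Gamma>.word_eval_closed[OF j_closed] in auto)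
  show "map md w \<in> lists X.letters" using assms md_letters by auto
qed

lemma \<pi>_vimage: "finite_index_normal K X.\<Gamma> \<Longrightarrow> finite_index_normal {x \<in> carrier \<Gamma>. \<pi> x \<in> K} \<Gamma>"
  by (rule finite_index_normal_vimage[OF \<Gamma>_group \<pi>(1)])

text \<open>A letter falls into the core of the quotient only if it differs from a core element by
  an element of the kernel. Alternation is not affected, as reduction preserves the factor of a
  letter.\<close>

lemma reduced_md:
  assumes w: "reduced w" and k: "\<forall>l\<in>set w. \<forall>r\<in>R. l \<otimes>\<^bsub>H (isl l)\<^esub> inv\<^bsub>H (isl l)\<^esub> (emb (isl l) r) \<notin> ker (isl l)"
  shows "X.reduced (map md w)"
proof -
  have "md l \<notin> X.core (isl (md l))" if l: "l \<in> set w" for l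
  proof
    assume "md l \<in> X.core (isl (md l))"
    moreover have "l \<in> carrier (H (isl l))" using w l by (auto simp: reduced_def H_carrier)
    ultimately show False using md_core[of l "isl l"] k l by auto
  qed
  moreover have "X.alternating (map md w)"
    using w X.alternating_map[of "\<lambda>x. x" "map md w"] by (simp add: successively_map reduced_def alternating_def)
  ultimately show ?thesis using w \<pi>_word(2)[of w] unfolding X.reduced_def by (auto simp: reduced_def)
qed

end

text \<open>Collects what the factors have to provide: separability of their cyclic subgroups,
  closedness of \<open>R\<close> and of its image in the profinite topologies (\<open>sepP\<close>,
  \<open>sepQ\<close>), and compatible pairs of kernels below any given pair
  (\<open>cofinal\<close>).\<close>

locale separable_amalgam = amalgam P Q R \<phi>
  for P :: "('a, 'm) monoid_scheme" and Q :: "('b, 'n) monoid_scheme" and R and \<phi> +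
  assumes csP: "cyclically_separable P" and csQ: "cyclically_separable Q"
    and sepP: "\<And>p. \<lbrakk>p \<in> carrier P; p \<notin> R\<rbrakk> \<Longrightarrow> \<exists>N. finite_index_normal N P \<and> (\<forall>r\<in>R. p \<otimes>\<^bsub>P\<^esub> inv\<^bsub>P\<^esub> r \<notin> N)"
    and sepQ: "\<And>q. \<lbrakk>q \<in> carrier Q; q \<notin> \<phi> ` R\<rbrakk> \<Longrightarrow> \<exists>M. finite_index_normal M Q \<and> (\<forall>s\<in>\<phi> ` R. q \<otimes>\<^bsub>Q\<^esub> inv\<^bsub>Q\<^esub> s \<notin> M)"
    and cofinal: "\<And>N0 M0. \<lbrakk>finite_index_normal N0 P; finite_index_normal M0 Q\<rbrakk> \<Longrightarrow>
      \<exists>N M. finite_index_normal N P \<and> N \<subseteq> N0 \<and> finite_index_normal M Q \<and> M \<subseteq> M0 \<and> \<phi> ` (N \<inter> R) = M \<inter> \<phi> ` R"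
begin

text \<open>An eventuality quantifier over compatible pairs of kernels: it is closed under finite
  conjunctions, and by \<open>cofinal\<close> a property that holds eventually holds for some pair.
  In this way finitely many requirements are met in one quotient.\<close>

definition "for_small \<Psi> \<longleftrightarrow> (\<exists>N0 M0. finite_index_normal N0 P \<and> finite_index_normal M0 Q \<and>
  (\<forall>N M. amalgam_quotient P Q R \<phi> N M \<longrightarrow> N \<subseteq> N0 \<longrightarrow> M \<subseteq> M0 \<longrightarrow> \<Psi> N M))"

abbreviation "q\<pi> \<equiv> amalgam_quotient.\<pi> P Q R \<phi>"
abbreviation "qker \<equiv> amalgam_quotient.ker :: 'a set \<Rightarrow> 'b set \<Rightarrow> bool \<Rightarrow> ('a + 'b) set"
abbreviation "q\<Gamma> N M \<equiv> amalgamated_product (P Mod N) (Q Mod M) (amalgam_quotient.R' P R N) (amalgam_quotient.\<phi>' P Q R \<phi> N M)"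

lemma for_smallI:
  assumes "finite_index_normal N0 P" "finite_index_normal M0 Q"
    "\<And>N M. \<lbrakk>amalgam_quotient P Q R \<phi> N M; N \<subseteq> N0; M \<subseteq> M0\<rbrakk> \<Longrightarrow> \<Psi> N M"
  shows "for_small \<Psi>"
  unfolding for_small_def using assms by blast

lemma for_small_mono:
  assumes "for_small \<Psi>" "\<And>N M. \<lbrakk>amalgam_quotient P Q R \<phi> N M; \<Psi> N M\<rbrakk> \<Longrightarrow> \<Psi>' N M"
  shows "for_small \<Psi>'"
  using assms unfolding for_small_def by blast

lemma for_small_conj:
  assumes "for_small \<Psi>" "for_small \<Psi>'"
  shows "for_small (\<lambda>N M. \<Psi> N M \<and> \<Psi>' N M)"
proof -
  obtain N0 M0 where 1: "finite_index_normal N0 P" "finite_index_normal M0 Q"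
    "\<And>N M. \<lbrakk>amalgam_quotient P Q R \<phi> N M; N \<subseteq> N0; M \<subseteq> M0\<rbrakk> \<Longrightarrow> \<Psi> N M" using assms(1) unfolding for_small_def by blast
  obtain N1 M1 where 2: "finite_index_normal N1 P" "finite_index_normal M1 Q"
    "\<And>N M. \<lbrakk>amalgam_quotient P Q R \<phi> N M; N \<subseteq> N1; M \<subseteq> M1\<rbrakk> \<Longrightarrow> \<Psi>' N M" using assms(2) unfolding for_small_def by blast
  show ?thesis
    by (rule for_smallI[OF P.finite_index_normal_Int[OF 1(1) 2(1)] Q.finite_index_normal_Int[OF 1(2) 2(2)]])
      (use 1(3) 2(3) in simp)
qed

lemma for_small_finite:
  assumes "finite A" "\<And>t. t \<in> A \<Longrightarrow> for_small (\<Psi> t)"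
  shows "for_small (\<lambda>N M. \<forall>t\<in>A. \<Psi> t N M)"
  using assms
proof (induction A)
  case empty
  show ?case by (rule for_smallI[OF P.finite_index_normal_carrier Q.finite_index_normal_carrier]) simp
next
  case (insert t A)
  have "for_small (\<Psi> t)" "for_small (\<lambda>N M. \<forall>t\<in>A. \<Psi> t N M)" using insert by simp_all
  from for_small_conj[OF this] show ?case by (rule for_small_mono) simp
qed

lemma for_small_obtain:
  assumes "for_small \<Psi>"
  obtains N M where "amalgam_quotient P Q R \<phi> N M" "\<Psi> N M"
proof -
  obtain N0 M0 where 1: "finite_index_normal N0 P" "finite_index_normal M0 Q"
    "\<And>N M. \<lbrakk>amalgam_quotient P Q R \<phi> N M; N \<subseteq> N0; M \<subseteq> M0\<rbrakk> \<Longrightarrow> \<Psi> N M" using assms(1) unfolding for_small_def by blast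
  obtain N M where NM: "finite_index_normal N P" "N \<subseteq> N0" "finite_index_normal M Q" "M \<subseteq> M0" "\<phi> ` (N \<inter> R) = M \<inter> \<phi> ` R"
    using cofinal[OF 1(1,2)] by blast
  have "amalgam_quotient P Q R \<phi> N M"
    by (intro amalgam_quotient.intro amalgam_quotient_axioms.intro amalgam_axioms NM)
  then show ?thesis using that 1(3) NM by blast
qed

text \<open>A single small kernel in the factor of \<open>l\<close> is enough; for the other factor
  the bound is the whole group.\<close>

lemma for_small_core:
  assumes l: "l \<in> carrier (H b)" "l \<notin> core b"
  shows "for_small (\<lambda>N M. \<forall>r\<in>R. l \<otimes>\<^bsub>H b\<^esub> inv\<^bsub>H b\<^esub> (emb b r) \<notin> qker N M b)"
proof (cases b)
  case True
  then obtain p where p: "l = Inl p" "p \<in> carrier P" using l(1) by (auto simp: H_def sum_left_def)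
  then have "p \<notin> R" using l(2) True by (auto simp: emb_def)
  then obtain N0 where N0: "finite_index_normal N0 P" "\<forall>r\<in>R. p \<otimes>\<^bsub>P\<^esub> inv\<^bsub>P\<^esub> r \<notin> N0" using sepP p by blast
  have e: "l \<otimes>\<^bsub>H b\<^esub> inv\<^bsub>H b\<^esub> (emb b r) = Inl (p \<otimes>\<^bsub>P\<^esub> inv\<^bsub>P\<^esub> r)" if "r \<in> R" for r
  proof -
    interpret i: group_hom P "H True" Inl by (simp add: group_hom_def group_hom_axioms_def H_group P.is_group Inl_hom)
    show ?thesis using p True R_sub[OF that] by (simp add: emb_def)
  qed
  show ?thesis
  proof (rule for_smallI[OF N0(1) Q.finite_index_normal_carrier])
    fix N M assume "amalgam_quotient P Q R \<phi> N M" "N \<subseteq> N0"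
    then interpret amalgam_quotient P Q R \<phi> N M by simp
    show "\<forall>r\<in>R. l \<otimes>\<^bsub>H b\<^esub> inv\<^bsub>H b\<^esub> (emb b r) \<notin> ker b"
      using N0(2) \<open>N \<subseteq> N0\<close> True e by (auto simp: ker_def)
  qed
next
  case False
  then obtain p where p: "l = Inr p" "p \<in> carrier Q" using l(1) by (auto simp: H_def sum_right_def)
  then have "p \<notin> \<phi> ` R" using l(2) False by (auto simp: emb_def)
  then obtain M0 where M0: "finite_index_normal M0 Q" "\<forall>s\<in>\<phi> ` R. p \<otimes>\<^bsub>Q\<^esub> inv\<^bsub>Q\<^esub> s \<notin> M0" using sepQ p by blast
  have e: "l \<otimes>\<^bsub>H b\<^esub> inv\<^bsub>H b\<^esub> (emb b r) = Inr (p \<otimes>\<^bsub>Q\<^esub> inv\<^bsub>Q\<^esub> (\<phi> r))" if "r \<in> R" for r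
  proof -
    interpret i: group_hom Q "H False" Inr by (simp add: group_hom_def group_hom_axioms_def H_group Q.is_group Inr_hom)
    show ?thesis using p False \<phi>_closed[OF that] by (simp add: emb_def)
  qed
  show ?thesis
  proof (rule for_smallI[OF P.finite_index_normal_carrier M0(1)])
    fix N M assume "amalgam_quotient P Q R \<phi> N M" "M \<subseteq> M0"
    then interpret amalgam_quotient P Q R \<phi> N M by simp
    show "\<forall>r\<in>R. l \<otimes>\<^bsub>H b\<^esub> inv\<^bsub>H b\<^esub> (emb b r) \<notin> ker b"
      using M0(2) \<open>M \<subseteq> M0\<close> False e by (auto simp: ker_def)
  qed
qed

lemma for_small_cyclic:
  assumes l: "l \<in> carrier (H b)" and a: "a \<in> carrier (H b)" and la: "\<And>i::int. l \<noteq> a [^]\<^bsub>H b\<^esub> i"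
  shows "for_small (\<lambda>N M. \<forall>i::int. l \<otimes>\<^bsub>H b\<^esub> inv\<^bsub>H b\<^esub> (a [^]\<^bsub>H b\<^esub> i) \<notin> qker N M b)"
proof (cases b)
  case True
  then obtain p p' where p: "l = Inl p" "p \<in> carrier P" "a = Inl p'" "p' \<in> carrier P"
    using l a by (auto simp: H_def sum_left_def)
  have pow: "a [^]\<^bsub>H b\<^esub> i = Inl (p' [^]\<^bsub>P\<^esub> i)" for i :: int
  proof -
    interpret i: group_hom P "H True" Inl by (simp add: group_hom_def group_hom_axioms_def H_group P.is_group Inl_hom)
    show ?thesis using p True i.hom_int_pow[of p' i] by simp
  qed
  have "\<exists>N. finite_index_normal N P \<and> (\<forall>i::int. p \<otimes>\<^bsub>P\<^esub> inv\<^bsub>P\<^esub> (p' [^]\<^bsub>P\<^esub> i) \<notin> N)"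
    by (rule cyclically_separableD[OF csP p(4,2)]) (use la p pow in auto)
  then obtain N0 where N0: "finite_index_normal N0 P" "\<forall>i::int. p \<otimes>\<^bsub>P\<^esub> inv\<^bsub>P\<^esub> (p' [^]\<^bsub>P\<^esub> i) \<notin> N0" by blast
  have e: "l \<otimes>\<^bsub>H b\<^esub> inv\<^bsub>H b\<^esub> (a [^]\<^bsub>H b\<^esub> i) = Inl (p \<otimes>\<^bsub>P\<^esub> inv\<^bsub>P\<^esub> (p' [^]\<^bsub>P\<^esub> i))" for i :: int
  proof -
    interpret i: group_hom P "H True" Inl by (simp add: group_hom_def group_hom_axioms_def H_group P.is_group Inl_hom)
    show ?thesis unfolding pow using p True by simp
  qed
  show ?thesis
  proof (rule for_smallI[OF N0(1) Q.finite_index_normal_carrier])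
    fix N M assume "amalgam_quotient P Q R \<phi> N M" "N \<subseteq> N0"
    then interpret amalgam_quotient P Q R \<phi> N M by simp
    show "\<forall>i::int. l \<otimes>\<^bsub>H b\<^esub> inv\<^bsub>H b\<^esub> (a [^]\<^bsub>H b\<^esub> i) \<notin> ker b"
      unfolding e using N0(2) \<open>N \<subseteq> N0\<close> True by (auto simp: ker_def)
  qed
next
  case False
  then obtain p p' where p: "l = Inr p" "p \<in> carrier Q" "a = Inr p'" "p' \<in> carrier Q"
    using l a by (auto simp: H_def sum_right_def)
  have pow: "a [^]\<^bsub>H b\<^esub> i = Inr (p' [^]\<^bsub>Q\<^esub> i)" for i :: int
  proof -
    interpret i: group_hom Q "H False" Inr by (simp add: group_hom_def group_hom_axioms_def H_group Q.is_group Inr_hom)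
    show ?thesis using p False i.hom_int_pow[of p' i] by simp
  qed
  have "\<exists>N. finite_index_normal N Q \<and> (\<forall>i::int. p \<otimes>\<^bsub>Q\<^esub> inv\<^bsub>Q\<^esub> (p' [^]\<^bsub>Q\<^esub> i) \<notin> N)"
    by (rule cyclically_separableD[OF csQ p(4,2)]) (use la p pow in auto)
  then obtain M0 where M0: "finite_index_normal M0 Q" "\<forall>i::int. p \<otimes>\<^bsub>Q\<^esub> inv\<^bsub>Q\<^esub> (p' [^]\<^bsub>Q\<^esub> i) \<notin> M0" by blast
  have e: "l \<otimes>\<^bsub>H b\<^esub> inv\<^bsub>H b\<^esub> (a [^]\<^bsub>H b\<^esub> i) = Inr (p \<otimes>\<^bsub>Q\<^esub> inv\<^bsub>Q\<^esub> (p' [^]\<^bsub>Q\<^esub> i))" for i :: int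
  proof -
    interpret i: group_hom Q "H False" Inr by (simp add: group_hom_def group_hom_axioms_def H_group Q.is_group Inr_hom)
    show ?thesis unfolding pow using p False by simp
  qed
  show ?thesis
  proof (rule for_smallI[OF P.finite_index_normal_carrier M0(1)])
    fix N M assume "amalgam_quotient P Q R \<phi> N M" "M \<subseteq> M0"
    then interpret amalgam_quotient P Q R \<phi> N M by simp
    show "\<forall>i::int. l \<otimes>\<^bsub>H b\<^esub> inv\<^bsub>H b\<^esub> (a [^]\<^bsub>H b\<^esub> i) \<notin> ker b"
      unfolding e using M0(2) \<open>M \<subseteq> M0\<close> False by (auto simp: ker_def)
  qed
qed

lemma for_small_reduced:
  assumes w: "reduced w"
  shows "for_small (\<lambda>N M. \<forall>l\<in>set w. \<forall>r\<in>R. l \<otimes>\<^bsub>H (isl l)\<^esub> inv\<^bsub>H (isl l)\<^esub> (emb (isl l) r) \<notin> qker N M (isl l))"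
proof (rule for_small_finite)
  show "finite (set w)" by simp
  fix l assume "l \<in> set w"
  then have "l \<in> carrier (H (isl l))" "l \<notin> core (isl l)" using w by (auto simp: reduced_def H_carrier)
  then show "for_small (\<lambda>N M. \<forall>r\<in>R. l \<otimes>\<^bsub>H (isl l)\<^esub> inv\<^bsub>H (isl l)\<^esub> (emb (isl l) r) \<notin> qker N M (isl l))"
    by (rule for_small_core)
qed

section \<open>Separation of elliptic and hyperbolic elements in small quotients\<close>

lemma minimal_word:
  assumes "x \<in> carrier \<Gamma>"
  obtains w where "w \<in> lists letters" "word_eval \<Gamma> j w = x" "length w \<ge> 2 \<Longrightarrow> reduced w"
proof -
  let ?P = "\<lambda>w. w \<in> lists letters \<and> word_eval \<Gamma> j w = x"
  obtain w0 where "?P w0" using j_generates[OF assms] by metis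
  then obtain w where w: "?P w" "\<forall>w'. ?P w' \<longrightarrow> length w \<le> length w'"
    using ex_has_least_nat[of ?P w0 length] by blast
  show ?thesis
  proof (rule that[of w])
    show "w \<in> lists letters" "word_eval \<Gamma> j w = x" using w by blast+
    show "reduced w" if "length w \<ge> 2" by (rule minimal_word_reduced[OF _ that]) (use w in auto)
  qed
qed

lemma short_word:
  assumes w: "w \<in> lists letters" "length w < 2"
  obtains l where "l \<in> letters" "word_eval \<Gamma> j w = j l" "w = [] \<or> w = [l]"
proof (cases w)
  case Nil
  have "\<one>\<^bsub>H True\<^esub> \<in> letters" using H.one_closed[of True] H_carrier by blast
  moreover have "j \<one>\<^bsub>H True\<^esub> = \<one>\<^bsub>\<Gamma>\<^esub>" by (rule hom_one[OF j_hom H_group \<Gamma>_group])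
  ultimately show ?thesis using that Nil by simp
next
  case (Cons l v)
  then show ?thesis using that[of l] w funcset_mem[OF j_closed] by auto
qed

text \<open>The factors embed into the amalgam, and their quotients into the quotient amalgam, so
  the claim is one about \<open>H b\<close> and its quotient, where \<open>for_small_cyclic\<close>
  decides it.\<close>

lemma for_small_neq_letter:
  assumes l: "l \<in> carrier (H b)" and a: "a \<in> carrier (H b)" and la: "\<And>i::int. j l \<noteq> j a [^]\<^bsub>\<Gamma>\<^esub> i"
  shows "for_small (\<lambda>N M. \<forall>i::int. q\<pi> N M (j l) \<noteq> q\<pi> N M (j a) [^]\<^bsub>q\<Gamma> N M\<^esub> i)"
proof -
  interpret jb: group_hom "H b" \<Gamma> j by (simp add: group_hom_def group_hom_axioms_def H_group \<Gamma>_group j_hom)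
  have "l \<noteq> a [^]\<^bsub>H b\<^esub> i" for i :: int using la[of i] jb.hom_int_pow[OF a, of i] by auto
  from for_small_cyclic[OF l a this] show ?thesis
  proof (rule for_small_mono)
    fix N M assume "amalgam_quotient P Q R \<phi> N M" and k: "\<forall>i::int. l \<otimes>\<^bsub>H b\<^esub> inv\<^bsub>H b\<^esub> (a [^]\<^bsub>H b\<^esub> i) \<notin> qker N M b"
    then interpret amalgam_quotient P Q R \<phi> N M by simp
    interpret m: group_hom "H b" "X.H b" md by (simp add: group_hom_def group_hom_axioms_def H_group X.H_group md_hom)
    interpret xj: group_hom "X.H b" X.\<Gamma> X.j by (simp add: group_hom_def group_hom_axioms_def X.H_group X.\<Gamma>_group X.j_hom)
    show "\<forall>i::int. \<pi> (j l) \<noteq> \<pi> (j a) [^]\<^bsub>X.\<Gamma>\<^esub> i"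
    proof
      fix i :: int
      have ai: "a [^]\<^bsub>H b\<^esub> i \<in> carrier (H b)" using a by simp
      have la: "l \<in> letters" "a \<in> letters" using l a by (simp_all add: H_carrier)
      have "\<pi> (j a) [^]\<^bsub>X.\<Gamma>\<^esub> i = X.j (md (a [^]\<^bsub>H b\<^esub> i))"
        unfolding \<pi>(2)[OF la(2)] using xj.hom_int_pow[OF md_closed[OF a], of i] m.hom_int_pow[OF a, of i] by simp
      moreover have "md l \<noteq> md (a [^]\<^bsub>H b\<^esub> i)" using md_eq_iff[OF l ai] k by blast
      ultimately show "\<pi> (j l) \<noteq> \<pi> (j a) [^]\<^bsub>X.\<Gamma>\<^esub> i"
        unfolding \<pi>(2)[OF la(1)] using X.j_eq_iff[OF md_closed[OF l] md_closed[OF ai]] by simp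
    qed
  qed
qed

text \<open>A reduced word of length at least 2 stays reduced and is then non-trivial; a single
  letter is compared with the powers of the identity.\<close>

lemma for_small_neq_one:
  assumes x: "x \<in> carrier \<Gamma>" "x \<noteq> \<one>\<^bsub>\<Gamma>\<^esub>"
  shows "for_small (\<lambda>N M. q\<pi> N M x \<noteq> \<one>\<^bsub>q\<Gamma> N M\<^esub>)"
proof -
  obtain w where w: "w \<in> lists letters" "word_eval \<Gamma> j w = x" "length w \<ge> 2 \<Longrightarrow> reduced w"
    using minimal_word[OF x(1)] by metis
  show ?thesis
  proof (cases "length w \<ge> 2")
    case True
    from for_small_reduced[OF w(3)[OF True]] show ?thesis
    proof (rule for_small_mono)
      fix N M assume "amalgam_quotient P Q R \<phi> N M"
        and k: "\<forall>l\<in>set w. \<forall>r\<in>R. l \<otimes>\<^bsub>H (isl l)\<^esub> inv\<^bsub>H (isl l)\<^esub> (emb (isl l) r) \<notin> qker N M (isl l)"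
      then interpret amalgam_quotient P Q R \<phi> N M by simp
      have "word_eval X.\<Gamma> X.j (map md w) \<noteq> \<one>\<^bsub>X.\<Gamma>\<^esub>"
        by (rule X.reduced_neq_one[OF reduced_md[OF w(3)[OF True] k]]) (use True in auto)
      then show "\<pi> x \<noteq> \<one>\<^bsub>X.\<Gamma>\<^esub>" using \<pi>_word(1)[OF w(1)] w(2) by simp
    qed
  next
    case False
    then obtain l where l: "l \<in> letters" "x = j l" using short_word[OF w(1)] w(2) by (metis not_le)
    define b where "b = isl l"
    have lH: "l \<in> carrier (H b)" using l by (simp add: H_carrier b_def)
    have j1: "j \<one>\<^bsub>H b\<^esub> = \<one>\<^bsub>\<Gamma>\<^esub>" by (rule hom_one[OF j_hom H_group \<Gamma>_group])
    from for_small_neq_letter[OF lH H.one_closed[of b]] have "for_small (\<lambda>N M. \<forall>i::int. q\<pi> N M (j l) \<noteq> q\<pi> N M (j \<one>\<^bsub>H b\<^esub>) [^]\<^bsub>q\<Gamma> N M\<^esub> i)"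
      using x(2) l(2) j1 by simp
    then show ?thesis
    proof (rule for_small_mono)
      fix N M assume "amalgam_quotient P Q R \<phi> N M"
        and k: "\<forall>i::int. q\<pi> N M (j l) \<noteq> q\<pi> N M (j \<one>\<^bsub>H b\<^esub>) [^]\<^bsub>q\<Gamma> N M\<^esub> i"
      then interpret amalgam_quotient P Q R \<phi> N M by simp
      show "\<pi> x \<noteq> \<one>\<^bsub>X.\<Gamma>\<^esub>" using spec[OF k, of 0] l(2) by simp
    qed
  qed
qed

text \<open>Reducedness of \<open>w\<close> in the quotient alone rules out all exponents beyond the
  length of a word for \<open>g\<close> or, for negative exponents, for its inverse. Finitely many
  exponents remain, each a matter of one non-trivial element surviving.\<close>

lemma for_small_hyperbolic:
  assumes w: "reduced w" "w \<noteq> []" "isl (last w) \<noteq> isl (hd w)" and c: "c = word_eval \<Gamma> j w"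
    and g: "g \<in> carrier \<Gamma>" and gc: "\<And>i::int. g \<noteq> c [^]\<^bsub>\<Gamma>\<^esub> i"
  shows "for_small (\<lambda>N M. \<forall>i::int. q\<pi> N M g \<noteq> q\<pi> N M c [^]\<^bsub>q\<Gamma> N M\<^esub> i)"
proof -
  have wL: "w \<in> lists letters" using w(1) by (simp add: reduced_def)
  have cG: "c \<in> carrier \<Gamma>" unfolding c by (rule \<Gamma>.word_eval_closed[OF j_closed wL])
  obtain v where v: "v \<in> lists letters" "g = word_eval \<Gamma> j v" using j_generates[OF g] by metis
  obtain v' where v': "v' \<in> lists letters" "inv\<^bsub>\<Gamma>\<^esub> g = word_eval \<Gamma> j v'" using j_generates[OF \<Gamma>.inv_closed[OF g]] by metis
  let ?B = "int (length v + length v')"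
  have "for_small (\<lambda>N M. \<forall>i\<in>{-?B..?B}. q\<pi> N M (g \<otimes>\<^bsub>\<Gamma>\<^esub> inv\<^bsub>\<Gamma>\<^esub> (c [^]\<^bsub>\<Gamma>\<^esub> i)) \<noteq> \<one>\<^bsub>q\<Gamma> N M\<^esub>)"
  proof (rule for_small_finite)
    fix i :: int
    have "g \<otimes>\<^bsub>\<Gamma>\<^esub> inv\<^bsub>\<Gamma>\<^esub> (c [^]\<^bsub>\<Gamma>\<^esub> i) \<noteq> \<one>\<^bsub>\<Gamma>\<^esub>"
      using gc[of i] \<Gamma>.mult_inv_eq_one_iff[OF g \<Gamma>.int_pow_closed[OF cG]] by blast
    then show "for_small (\<lambda>N M. q\<pi> N M (g \<otimes>\<^bsub>\<Gamma>\<^esub> inv\<^bsub>\<Gamma>\<^esub> (c [^]\<^bsub>\<Gamma>\<^esub> i)) \<noteq> \<one>\<^bsub>q\<Gamma> N M\<^esub>)"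
      using g cG by (intro for_small_neq_one) simp_all
  qed simp
  from for_small_conj[OF this for_small_reduced[OF w(1)]] show ?thesis
  proof (rule for_small_mono)
    fix N M assume "amalgam_quotient P Q R \<phi> N M"
      and k: "(\<forall>i\<in>{-?B..?B}. q\<pi> N M (g \<otimes>\<^bsub>\<Gamma>\<^esub> inv\<^bsub>\<Gamma>\<^esub> (c [^]\<^bsub>\<Gamma>\<^esub> i)) \<noteq> \<one>\<^bsub>q\<Gamma> N M\<^esub>) \<and>
        (\<forall>l\<in>set w. \<forall>r\<in>R. l \<otimes>\<^bsub>H (isl l)\<^esub> inv\<^bsub>H (isl l)\<^esub> (emb (isl l) r) \<notin> qker N M (isl l))"
    then interpret amalgam_quotient P Q R \<phi> N M by simp
    have rX: "X.reduced (map md w)" using reduced_md[OF w(1)] k by blast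
    have neX: "map md w \<noteq> []" "isl (last (map md w)) \<noteq> isl (hd (map md w))"
      using w by (simp_all add: last_map hd_map)
    have big: "word_eval X.\<Gamma> X.j (map md u) \<noteq> \<pi> c [^]\<^bsub>X.\<Gamma>\<^esub> n" if "u \<in> lists letters" "length u < n" for u and n :: nat
      using X.hyperbolic_power_neq[OF rX neX \<pi>_word(2)[OF that(1)], of n] that(2) \<pi>_word(1)[OF wL] c by simp
    show "\<forall>i::int. \<pi> g \<noteq> \<pi> c [^]\<^bsub>X.\<Gamma>\<^esub> i"
    proof (intro allI notI)
      fix i :: int assume e: "\<pi> g = \<pi> c [^]\<^bsub>X.\<Gamma>\<^esub> i"
      have \<pi>cG: "\<pi> c \<in> carrier X.\<Gamma>" "\<pi> g \<in> carrier X.\<Gamma>" using cG g by simp_all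
      consider "i \<in> {-?B..?B}" | n where "i = int n" "length v < n" | n where "i = - int n" "length v' < n"
      proof (cases "i \<ge> 0")
        case True
        then obtain n where "i = int n" using nonneg_int_cases by blast
        then show ?thesis using that(1,2) by (cases "length v < n") auto
      next
        case False
        then obtain n where "i = - int n" by (metis int_cases2 linear neg_0_le_iff_le of_nat_0_le_iff)
        then show ?thesis using that(1,3) by (cases "length v' < n") auto
      qed
      then show False
      proof cases
        case 1
        have "\<pi> (g \<otimes>\<^bsub>\<Gamma>\<^esub> inv\<^bsub>\<Gamma>\<^esub> (c [^]\<^bsub>\<Gamma>\<^esub> i)) = \<pi> g \<otimes>\<^bsub>X.\<Gamma>\<^esub> inv\<^bsub>X.\<Gamma>\<^esub> (\<pi> c [^]\<^bsub>X.\<Gamma>\<^esub> i)"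
          using g cG \<pi>.hom_int_pow[OF cG] by simp
        also have "\<dots> = \<one>\<^bsub>X.\<Gamma>\<^esub>" unfolding e using \<pi>cG by simp
        finally show False using k 1 by blast
      next
        case 2
        then show False using big[OF v(1) 2(2)] e \<pi>_word(1)[OF v(1)] v(2) by (simp add: int_pow_int)
      next
        case 3
        have "\<pi> (inv\<^bsub>\<Gamma>\<^esub> g) = \<pi> c [^]\<^bsub>X.\<Gamma>\<^esub> n"
          using e g \<pi>cG unfolding 3(1) by (simp add: X.\<Gamma>.int_pow_neg_int)
        then show False using big[OF v'(1) 3(2)] \<pi>_word(1)[OF v'(1)] v'(2) by simp
      qed
    qed
  qed
qed

text \<open>All powers of \<open>j a\<close> lie in one factor. Either \<open>g\<close> does too, or
  \<open>g\<close> has a reduced word that has at least two letters or starts in the other factor,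
  and this persists in small quotients.\<close>

lemma for_small_elliptic:
  assumes a: "a \<in> carrier (H b)" and g: "g \<in> carrier \<Gamma>" and gc: "\<And>i::int. g \<noteq> j a [^]\<^bsub>\<Gamma>\<^esub> i"
  shows "for_small (\<lambda>N M. \<forall>i::int. q\<pi> N M g \<noteq> q\<pi> N M (j a) [^]\<^bsub>q\<Gamma> N M\<^esub> i)"
proof -
  obtain v where v: "v \<in> lists letters" "word_eval \<Gamma> j v = g" "length v \<ge> 2 \<Longrightarrow> reduced v"
    using minimal_word[OF g] by metis
  have "(\<exists>l\<in>carrier (H b). g = j l) \<or> (reduced v \<and> v \<noteq> [] \<and> (length v \<ge> 2 \<or> isl (hd v) \<noteq> b))"
  proof (cases "length v \<ge> 2")
    case True
    then show ?thesis using v(3) by auto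
  next
    case False
    then obtain l where l: "l \<in> letters" "g = j l" "v = [] \<or> v = [l]" using short_word[OF v(1)] v(2) by (metis not_le)
    consider "isl l = b" | "l \<in> core (isl l)" | "isl l \<noteq> b" "l \<notin> core (isl l)" by blast
    then show ?thesis
    proof cases
      case 1
      then show ?thesis using l by (auto simp: H_carrier)
    next
      case 2
      then obtain r where "r \<in> R" "l = emb (isl l) r" by blast
      then have "g = j (emb b r)" "emb b r \<in> carrier (H b)" using l(2) j_emb emb_closed by metis+
      then show ?thesis by blast
    next
      case 3
      \<comment> \<open>The empty word would make \<open>l\<close> the identity letter, which
        belongs to the core.\<close>
      have "v \<noteq> []"
      proof
        assume "v = []"
        then have "g = j (emb b \<one>\<^bsub>P\<^esub>)" using v(2) hom_one[OF j_hom[of b] H_group \<Gamma>_group] by (simp add: emb_one)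
        moreover have "l = emb (isl l) \<one>\<^bsub>P\<^esub>"
        proof -
          have "l \<in> carrier (H (isl l))" using l(1) by (simp add: H_carrier)
          then show ?thesis using j_one_iff[of l "isl l"] l(2) v(2) \<open>v = []\<close> by (simp add: emb_one)
        qed
        ultimately show False using 3(2) R_closed(1) by blast
      qed
      then show ?thesis using l 3 by (auto simp: reduced_simps)
    qed
  qed
  then show ?thesis
  proof
    assume "\<exists>l\<in>carrier (H b). g = j l"
    then obtain l where "l \<in> carrier (H b)" "g = j l" by blast
    then show ?thesis using for_small_neq_letter[OF _ a, of l] gc by simp
  next
    assume rv: "reduced v \<and> v \<noteq> [] \<and> (length v \<ge> 2 \<or> isl (hd v) \<noteq> b)"
    from for_small_reduced[OF conjunct1[OF rv]] show ?thesis
    proof (rule for_small_mono)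
      fix N M assume "amalgam_quotient P Q R \<phi> N M"
        and k: "\<forall>l\<in>set v. \<forall>r\<in>R. l \<otimes>\<^bsub>H (isl l)\<^esub> inv\<^bsub>H (isl l)\<^esub> (emb (isl l) r) \<notin> qker N M (isl l)"
      then interpret amalgam_quotient P Q R \<phi> N M by simp
      interpret xj: group_hom "X.H b" X.\<Gamma> X.j by (simp add: group_hom_def group_hom_axioms_def X.H_group X.\<Gamma>_group X.j_hom)
      have rX: "X.reduced (map md v)" using reduced_md[of v] rv k by blast
      have aL: "a \<in> letters" using a by (simp add: H_carrier)
      show "\<forall>i::int. \<pi> g \<noteq> \<pi> (j a) [^]\<^bsub>X.\<Gamma>\<^esub> i"
      proof
        fix i :: int
        have ai: "md a [^]\<^bsub>X.H b\<^esub> i \<in> carrier (X.H b)" using md_closed[OF a] by simp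
        have "word_eval X.\<Gamma> X.j (map md v) \<noteq> X.j (md a [^]\<^bsub>X.H b\<^esub> i)"
          by (rule X.reduced_neq_letter[OF rX _ ai]) (use rv in \<open>auto simp: hd_map\<close>)
        then show "\<pi> g \<noteq> \<pi> (j a) [^]\<^bsub>X.\<Gamma>\<^esub> i"
          using xj.hom_int_pow[OF md_closed[OF a], of i] \<pi>_word(1)[OF v(1)] v(2) \<pi>(2)[OF aL] by simp
      qed
    qed
  qed
qed

text \<open>Take a shortest word among those representing any conjugate of \<open>c\<close>. If its
  ends lay in the same factor, conjugation by the last letter would bring them together and merge
  them.\<close>

lemma cyclically_reduced_conjugate:
  assumes c: "c \<in> carrier \<Gamma>"
  obtains u w where "u \<in> carrier \<Gamma>" "w \<in> lists letters" "u \<otimes>\<^bsub>\<Gamma>\<^esub> c \<otimes>\<^bsub>\<Gamma>\<^esub> inv\<^bsub>\<Gamma>\<^esub> u = word_eval \<Gamma> j w"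
    "length w \<ge> 2 \<Longrightarrow> reduced w \<and> isl (last w) \<noteq> isl (hd w)"
proof -
  let ?P = "\<lambda>w. w \<in> lists letters \<and> (\<exists>u\<in>carrier \<Gamma>. u \<otimes>\<^bsub>\<Gamma>\<^esub> c \<otimes>\<^bsub>\<Gamma>\<^esub> inv\<^bsub>\<Gamma>\<^esub> u = word_eval \<Gamma> j w)"
  obtain w0 where "w0 \<in> lists letters" "c = word_eval \<Gamma> j w0" using j_generates[OF c] by metis
  then have "?P w0" using c by (intro conjI bexI[of _ "\<one>\<^bsub>\<Gamma>\<^esub>"]) auto
  then obtain w where w: "?P w" and min: "\<forall>w'. ?P w' \<longrightarrow> length w \<le> length w'"
    using ex_has_least_nat[of ?P w0 length] by blast
  then obtain u where u: "u \<in> carrier \<Gamma>" "u \<otimes>\<^bsub>\<Gamma>\<^esub> c \<otimes>\<^bsub>\<Gamma>\<^esub> inv\<^bsub>\<Gamma>\<^esub> u = word_eval \<Gamma> j w" by blast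
  have "reduced w \<and> isl (last w) \<noteq> isl (hd w)" if len: "length w \<ge> 2"
  proof
    show "reduced w" by (rule minimal_word_reduced[OF _ len]) (use w min u in metis)+
    show "isl (last w) \<noteq> isl (hd w)"
    proof
      assume e: "isl (last w) = isl (hd w)"
      obtain a m b where s: "w = a # m @ [b]"
      proof -
        obtain a w' where "w = a # w'" using len by (cases w) auto
        moreover from this have "w' \<noteq> []" using len by auto
        then obtain m b where "w' = m @ [b]" by (metis rev_exhaust)
        ultimately show ?thesis using that by blast
      qed
      have L: "a \<in> letters" "m \<in> lists letters" "b \<in> letters" using w s by auto
      note G = funcset_mem[OF j_closed L(1)] funcset_mem[OF j_closed L(3)] \<Gamma>.word_eval_closed[OF j_closed L(2)]
      obtain d where d: "d \<in> letters" "j b \<otimes>\<^bsub>\<Gamma>\<^esub> j a = j d" using merge_letters[OF L(3,1)] e s by auto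
      have ev: "word_eval \<Gamma> j w = j a \<otimes>\<^bsub>\<Gamma>\<^esub> (word_eval \<Gamma> j m \<otimes>\<^bsub>\<Gamma>\<^esub> j b)"
        unfolding s using \<Gamma>.word_eval_append[OF j_closed L(2), of "[b]"] L(3) G by simp
      have "(j b \<otimes>\<^bsub>\<Gamma>\<^esub> u) \<otimes>\<^bsub>\<Gamma>\<^esub> c \<otimes>\<^bsub>\<Gamma>\<^esub> inv\<^bsub>\<Gamma>\<^esub> (j b \<otimes>\<^bsub>\<Gamma>\<^esub> u) = j b \<otimes>\<^bsub>\<Gamma>\<^esub> (u \<otimes>\<^bsub>\<Gamma>\<^esub> c \<otimes>\<^bsub>\<Gamma>\<^esub> inv\<^bsub>\<Gamma>\<^esub> u) \<otimes>\<^bsub>\<Gamma>\<^esub> inv\<^bsub>\<Gamma>\<^esub> (j b)"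
        using u(1) c G by (simp add: \<Gamma>.inv_mult_group \<Gamma>.m_assoc)
      also have "\<dots> = (j b \<otimes>\<^bsub>\<Gamma>\<^esub> j a) \<otimes>\<^bsub>\<Gamma>\<^esub> word_eval \<Gamma> j m" unfolding u(2) ev using G by (simp add: \<Gamma>.m_assoc)
      also have "\<dots> = word_eval \<Gamma> j (d # m)" unfolding d(2) by simp
      finally have "?P (d # m)" using d(1) L(2) u(1) G by (intro conjI bexI[of _ "j b \<otimes>\<^bsub>\<Gamma>\<^esub> u"]) simp_all
      then have "length w \<le> length (d # m)" using min by blast
      then show False by (simp add: s)
    qed
  qed
  then show ?thesis using that[OF u(1) _ u(2)] w by blast
qed

text \<open>Conjugation carries powers to powers, so \<open>c\<close> may be replaced by a
  cyclically reduced conjugate, which is hyperbolic or the image of a letter according to its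
  length.\<close>

lemma for_small_separates:
  assumes c: "c \<in> carrier \<Gamma>" and g: "g \<in> carrier \<Gamma>" and gc: "\<And>i::int. g \<noteq> c [^]\<^bsub>\<Gamma>\<^esub> i"
  shows "for_small (\<lambda>N M. \<forall>i::int. q\<pi> N M g \<noteq> q\<pi> N M c [^]\<^bsub>q\<Gamma> N M\<^esub> i)"
proof -
  obtain u w where u: "u \<in> carrier \<Gamma>" and w: "w \<in> lists letters" "u \<otimes>\<^bsub>\<Gamma>\<^esub> c \<otimes>\<^bsub>\<Gamma>\<^esub> inv\<^bsub>\<Gamma>\<^esub> u = word_eval \<Gamma> j w"
    "length w \<ge> 2 \<Longrightarrow> reduced w \<and> isl (last w) \<noteq> isl (hd w)"
    using cyclically_reduced_conjugate[OF c] by metis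
  let ?c = "u \<otimes>\<^bsub>\<Gamma>\<^esub> c \<otimes>\<^bsub>\<Gamma>\<^esub> inv\<^bsub>\<Gamma>\<^esub> u" and ?g = "u \<otimes>\<^bsub>\<Gamma>\<^esub> g \<otimes>\<^bsub>\<Gamma>\<^esub> inv\<^bsub>\<Gamma>\<^esub> u"
  have g': "?g \<in> carrier \<Gamma>" using u g by simp
  have gc': "?g \<noteq> ?c [^]\<^bsub>\<Gamma>\<^esub> i" for i :: int
    unfolding \<Gamma>.int_pow_conj[OF c u] using gc[of i] u g c by simp
  have "for_small (\<lambda>N M. \<forall>i::int. q\<pi> N M ?g \<noteq> q\<pi> N M ?c [^]\<^bsub>q\<Gamma> N M\<^esub> i)"
  proof (cases "length w \<ge> 2")
    case True
    then show ?thesis by (intro for_small_hyperbolic[OF _ _ _ w(2) g' gc']) (use w(3) in auto)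
  next
    case False
    then obtain a where a: "a \<in> letters" "?c = j a" using short_word[OF w(1)] w(2) by (metis not_le)
    have "a \<in> carrier (H (isl a))" using a(1) by (simp add: H_carrier)
    from for_small_elliptic[OF this g'] gc' show ?thesis unfolding a(2) by blast
  qed
  then show ?thesis
  proof (rule for_small_mono)
    fix N M assume "amalgam_quotient P Q R \<phi> N M" and k: "\<forall>i::int. q\<pi> N M ?g \<noteq> q\<pi> N M ?c [^]\<^bsub>q\<Gamma> N M\<^esub> i"
    then interpret amalgam_quotient P Q R \<phi> N M by simp
    have \<pi>G: "\<pi> u \<in> carrier X.\<Gamma>" "\<pi> c \<in> carrier X.\<Gamma>" using u c by simp_all
    show "\<forall>i::int. \<pi> g \<noteq> \<pi> c [^]\<^bsub>X.\<Gamma>\<^esub> i"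
    proof (intro allI notI)
      fix i :: int assume "\<pi> g = \<pi> c [^]\<^bsub>X.\<Gamma>\<^esub> i"
      then have "\<pi> ?g = \<pi> ?c [^]\<^bsub>X.\<Gamma>\<^esub> i" using u g c X.\<Gamma>.int_pow_conj[OF \<pi>G(2,1), of i] by simp
      then show False using k by blast
    qed
  qed
qed

lemma \<Gamma>_cyclically_separable: "cyclically_separable \<Gamma>"
  unfolding cyclically_separable_def
proof (intro ballI impI)
  fix c g assume c: "c \<in> carrier \<Gamma>" and g: "g \<in> carrier \<Gamma>" and gc: "\<forall>i::int. g \<noteq> c [^]\<^bsub>\<Gamma>\<^esub> i"
  obtain N M where NM: "amalgam_quotient P Q R \<phi> N M" and k: "\<forall>i::int. q\<pi> N M g \<noteq> q\<pi> N M c [^]\<^bsub>q\<Gamma> N M\<^esub> i"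
    using for_small_obtain[OF for_small_separates[OF c g]] gc by metis
  interpret amalgam_quotient P Q R \<phi> N M by (rule NM)
  have "\<exists>K. finite_index_normal K X.\<Gamma> \<and> (\<forall>i::int. \<pi> g \<otimes>\<^bsub>X.\<Gamma>\<^esub> inv\<^bsub>X.\<Gamma>\<^esub> (\<pi> c [^]\<^bsub>X.\<Gamma>\<^esub> i) \<notin> K)"
    by (rule cyclically_separableD[OF X.\<Gamma>_cyclically_separable]) (use c g k in auto)
  then obtain K where K: "finite_index_normal K X.\<Gamma>" "\<And>i::int. \<pi> g \<otimes>\<^bsub>X.\<Gamma>\<^esub> inv\<^bsub>X.\<Gamma>\<^esub> (\<pi> c [^]\<^bsub>X.\<Gamma>\<^esub> i) \<notin> K" by blast
  have "\<pi> (g \<otimes>\<^bsub>\<Gamma>\<^esub> inv\<^bsub>\<Gamma>\<^esub> (c [^]\<^bsub>\<Gamma>\<^esub> i)) = \<pi> g \<otimes>\<^bsub>X.\<Gamma>\<^esub> inv\<^bsub>X.\<Gamma>\<^esub> (\<pi> c [^]\<^bsub>X.\<Gamma>\<^esub> i)" for i :: int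
    using g c \<pi>.hom_int_pow[OF c] by simp
  then have "\<forall>i::int. g \<otimes>\<^bsub>\<Gamma>\<^esub> inv\<^bsub>\<Gamma>\<^esub> (c [^]\<^bsub>\<Gamma>\<^esub> i) \<notin> {x \<in> carrier \<Gamma>. \<pi> x \<in> K}" using K(2) by simp
  then show "\<exists>N. finite_index_normal N \<Gamma> \<and> (\<forall>i::int. g \<otimes>\<^bsub>\<Gamma>\<^esub> inv\<^bsub>\<Gamma>\<^esub> (c [^]\<^bsub>\<Gamma>\<^esub> i) \<notin> N)"
    using \<pi>_vimage[OF K(1)] by blast
qed

end

section \<open>From separation of elements to closed subgroups\<close>

lemma cyclic_subgroup_separable_if_cyclically_separable:
  assumes G: "group G" and cs: "cyclically_separable G"
  shows "cyclic_subgroup_separable G"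
  unfolding cyclic_subgroup_separable_def
proof (intro allI impI, elim conjE)
  interpret group G by fact
  fix C assume C: "subgroup C G" and cyc: "cyclic_group (G\<lparr>carrier := C\<rparr>)"
  obtain c where c: "c \<in> C" "C = range (\<lambda>i::int. c [^]\<^bsub>G\<^esub> i)" using cyclic_group_int_pow[OF C G cyc] by metis
  have cG: "c \<in> carrier G" using c(1) subgroup.subset[OF C] by blast
  let ?B = "{H #>\<^bsub>G\<^esub> g | H g. finite_index_subgroup H G \<and> g \<in> carrier G}"
  have sub: "N #>\<^bsub>G\<^esub> g \<subseteq> carrier G" if "subgroup N G" "g \<in> carrier G" for N g
    by (rule r_coset_subset_G[OF subgroup.subset[OF that(1)] that(2)])
  have "finite_index_subgroup (carrier G) G"
    unfolding finite_index_subgroup_def using finite_index_normalD(2,4)[OF finite_index_normal_carrier] by blast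
  then have "carrier G #>\<^bsub>G\<^esub> \<one>\<^bsub>G\<^esub> \<in> ?B" by blast
  then have top: "topspace (profinite_topology G) = carrier G"
    unfolding profinite_topology_def topology_generated_by_topspace
    using sub by (auto simp: finite_index_subgroup_def)
  have "openin (profinite_topology G) (carrier G - C)"
  proof (subst openin_subopen, intro ballI)
    fix g assume g: "g \<in> carrier G - C"
    then have gc: "g \<noteq> c [^]\<^bsub>G\<^esub> i" for i :: int using c(2) by blast
    obtain N where N: "finite_index_normal N G" "\<And>i::int. g \<otimes>\<^bsub>G\<^esub> inv\<^bsub>G\<^esub> (c [^]\<^bsub>G\<^esub> i) \<notin> N"
      using cyclically_separableD[OF cs cG _ gc] g by blast
    note N' = finite_index_normalD[OF N(1)]
    have gG: "g \<in> carrier G" using g by blast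
    have "N #>\<^bsub>G\<^esub> g \<in> ?B" using N' gG unfolding finite_index_subgroup_def by blast
    then have "openin (profinite_topology G) (N #>\<^bsub>G\<^esub> g)"
      unfolding profinite_topology_def by (rule topology_generated_by_Basis)
    moreover have "g \<in> N #>\<^bsub>G\<^esub> g" by (rule rcos_self[OF gG N'(2)])
    \<comment> \<open>A power of \<open>c\<close> in this neighbourhood of \<open>g\<close> would
      put \<open>g \<otimes> inv (c [^] i)\<close> into \<open>N\<close>.\<close>
    moreover have "(N #>\<^bsub>G\<^esub> g) \<inter> C = {}"
    proof (rule ccontr)
      assume "(N #>\<^bsub>G\<^esub> g) \<inter> C \<noteq> {}"
      then obtain n i where n: "n \<in> N" "c [^]\<^bsub>G\<^esub> (i::int) = n \<otimes>\<^bsub>G\<^esub> g" using c(2) unfolding r_coset_def by auto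
      have nG: "n \<in> carrier G" using n(1) N'(5) by blast
      have "g \<otimes>\<^bsub>G\<^esub> inv\<^bsub>G\<^esub> (c [^]\<^bsub>G\<^esub> i) = inv\<^bsub>G\<^esub> n"
        unfolding n(2) using nG gG by (simp add: inv_mult_group)
      then show False using N(2) subgroup.m_inv_closed[OF N'(2) n(1)] by metis
    qed
    ultimately show "\<exists>T. openin (profinite_topology G) T \<and> g \<in> T \<and> T \<subseteq> carrier G - C"
      using sub[OF N'(2) gG] by blast
  qed
  then show "closedin (profinite_topology G) C"
    unfolding closedin_def top using subgroup.subset[OF C] by blast
qed

text \<open>The subgroup is a finite union of translates of a cyclic group, and \<open>p\<close>
  lies in none of them.\<close>

lemma virtually_cyclic_subgroup_separated:
  assumes G: "group G" "cyclically_separable G" and U: "subgroup U G" "virtually_cyclic (G\<lparr>carrier := U\<rparr>)"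
    and p: "p \<in> carrier G" "p \<notin> U"
  shows "\<exists>N. finite_index_normal N G \<and> (\<forall>u\<in>U. p \<otimes>\<^bsub>G\<^esub> inv\<^bsub>G\<^esub> u \<notin> N)"
proof -
  interpret G: group G by (rule G)
  obtain d T where d: "d \<in> U" and T: "finite T" "T \<subseteq> U" "\<And>u. u \<in> U \<Longrightarrow> \<exists>t\<in>T. \<exists>i::int. u = d [^]\<^bsub>G\<^esub> i \<otimes>\<^bsub>G\<^esub> t"
    using virtually_cyclic_cosets[OF U(1) G(1) U(2)] by metis
  have neq: "p \<noteq> d [^]\<^bsub>G\<^esub> i \<otimes>\<^bsub>G\<^esub> t" if "t \<in> T" for t and i :: int
    using p(2) subgroup.m_closed[OF U(1) G.subgroup_int_pow_closed[OF U(1) d]] T(2) that by blast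
  have dG: "d \<in> carrier G" and TG: "T \<subseteq> carrier G" using d T(2) subgroup.subset[OF U(1)] by auto
  obtain N where N: "finite_index_normal N G" "\<forall>t\<in>T. \<forall>i::int. p \<otimes>\<^bsub>G\<^esub> inv\<^bsub>G\<^esub> (d [^]\<^bsub>G\<^esub> i \<otimes>\<^bsub>G\<^esub> t) \<notin> N"
    using G.cyclically_separable_finite_cosets[OF G(2) dG T(1) TG p(1) neq] by blast
  then show ?thesis using T(3) by metis
qed

theorem corollary8p7:
  fixes P :: "'a monoid" and Q :: "'b monoid"
    and V\<^sub>P :: "'v set" and E\<^sub>P :: "('v \<times> 'v) set" and G\<^sub>P :: "'v \<Rightarrow> 'g monoid"
    and V\<^sub>Q :: "'w set" and E\<^sub>Q :: "('w \<times> 'w) set" and G\<^sub>Q :: "'w \<Rightarrow> 'h monoid"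
    and R :: "'a set" and S :: "'b set" and \<phi> :: "'a \<Rightarrow> 'b"
  assumes "group P" and "group Q"
    and "right_angled_Artin V\<^sub>P E\<^sub>P G\<^sub>P \<or> right_angled_Coxeter V\<^sub>P E\<^sub>P G\<^sub>P"
    and "virtually_embeds P (graph_product V\<^sub>P E\<^sub>P G\<^sub>P)"
    and "right_angled_Artin V\<^sub>Q E\<^sub>Q G\<^sub>Q \<or> right_angled_Coxeter V\<^sub>Q E\<^sub>Q G\<^sub>Q"
    and "virtually_embeds Q (graph_product V\<^sub>Q E\<^sub>Q G\<^sub>Q)"
    and "subgroup R P" and "virtually_cyclic (P\<lparr>carrier := R\<rparr>)"
    and "subgroup S Q" and "virtually_cyclic (Q\<lparr>carrier := S\<rparr>)"
    and "\<phi> \<in> iso (P\<lparr>carrier := R\<rparr>) (Q\<lparr>carrier := S\<rparr>)"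
  shows "cyclic_subgroup_separable (amalgamated_product P Q R \<phi>)"
proof -
  note P = \<open>group P\<close> and Q = \<open>group Q\<close> and R = \<open>subgroup R P\<close> and S = \<open>subgroup S Q\<close>
    and vR = \<open>virtually_cyclic (P\<lparr>carrier := R\<rparr>)\<close> and vS = \<open>virtually_cyclic (Q\<lparr>carrier := S\<rparr>)\<close> and \<phi> = assms(11)
  interpret P: group P by (rule P)
  interpret Q: group Q by (rule Q)
  \<comment> \<open>The Artin and Coxeter cases unite here; from now on the factors enter only
    through their power filtrations.\<close>
  have pfP: "power_filtered P"
    using assms(3) right_angled_Artin_power_filtered right_angled_Coxeter_power_filtered
      power_filtered_virtually_embeds[OF P _ assms(4)] by blast
  have pfQ: "power_filtered Q"
    using assms(5) right_angled_Artin_power_filtered right_angled_Coxeter_power_filtered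
      power_filtered_virtually_embeds[OF Q _ assms(6)] by blast
  have csP: "cyclically_separable P" by (rule power_filtered_cyclically_separable[OF P pfP])
  have csQ: "cyclically_separable Q" by (rule power_filtered_cyclically_separable[OF Q pfQ])
  have bij: "bij_betw \<phi> R S" and \<phi>hom: "\<phi> \<in> hom (P\<lparr>carrier := R\<rparr>) (Q\<lparr>carrier := S\<rparr>)" using \<phi> by (simp_all add: iso_def)
  then have S_eq: "\<phi> ` R = S" by (simp add: bij_betw_def)
  interpret separable_amalgam P Q R \<phi>
  proof (intro separable_amalgam.intro amalgam.intro amalgam_axioms.intro separable_amalgam_axioms.intro)
    show "\<phi> \<in> hom (P\<lparr>carrier := R\<rparr>) Q" using \<phi>hom subgroup.subset[OF S] by (auto simp: hom_def)
    show "inj_on \<phi> R" using bij by (simp add: bij_betw_def)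
    show "\<exists>N. finite_index_normal N P \<and> (\<forall>r\<in>R. p \<otimes>\<^bsub>P\<^esub> inv\<^bsub>P\<^esub> r \<notin> N)" if "p \<in> carrier P" "p \<notin> R" for p
      by (rule virtually_cyclic_subgroup_separated[OF P csP R vR that])
    show "\<exists>M. finite_index_normal M Q \<and> (\<forall>s\<in>\<phi> ` R. q \<otimes>\<^bsub>Q\<^esub> inv\<^bsub>Q\<^esub> s \<notin> M)" if "q \<in> carrier Q" "q \<notin> \<phi> ` R" for q
      using virtually_cyclic_subgroup_separated[OF Q csQ S vS] that unfolding S_eq by blast
    show "\<exists>N M. finite_index_normal N P \<and> N \<subseteq> N0 \<and> finite_index_normal M Q \<and> M \<subseteq> M0 \<and> \<phi> ` (N \<inter> R) = M \<inter> \<phi> ` R"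
      if "finite_index_normal N0 P" "finite_index_normal M0 Q" for N0 M0
      unfolding S_eq by (rule compatible_finite_index_normal[OF P pfP Q pfQ R vR S \<phi> that])
  qed (rule P Q R csP csQ)+
  show ?thesis by (rule cyclic_subgroup_separable_if_cyclically_separable[OF \<Gamma>_group \<Gamma>_cyclically_separable])
qed

end
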